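(* Let $n\ge 1$ be an integer and let $0<\alpha\le 2$. Then every pair $(u,v)$ with $u>0$, $v>0$ is admissible for the variational problem defining $\mathscr{N}_\alpha$, and for any $u,v>0$ $$ \mathscr{N}_\alpha(u,v)=u^{2(\alpha-1)/\alpha}\,\frac{h_\alpha^2(t)}{f_\alpha^{2(\alpha-1)/\alpha}(t)}, $$ where $t=t(u,v)\in(1,\infty)$ is uniquely determined by the relation $$ f_\alpha^{2-\alpha}(t)\,f_{\alpha-2}^{\alpha}(t)=u^{2-\alpha}v^{\alpha}. $$ Here, for real $\beta$ and $t>1$, $$ f_\beta(t)=t^{2-n}(t^2-1)^{n/2}\,F\!\left(\tfrac{2-\beta}{2},\tfrac{2+\beta}{2};\tfrac{n+2}{2};1-t^2\right), $$ $$ h_\beta(t)=t^{1-n}(t^2-1)^{n/2}\,F\!\left(\tfrac{2-\beta}{2},\tfrac{\beta}{2};\tfrac{n+2}{2};1-t^2\right). $$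
   Context: $F(a,b;c;z)$ is the Gauss hypergeometric function ${}_2F_1$ (for $z=1-t^2\le 0$ it is understood by analytic continuation to $\mathbb{C}\setminus[1,\infty)$). Let $\omega_n=\pi^{n/2}/\Gamma(\frac n2+1)$ be the volume of the unit ball of $\mathbb{R}^n$ and $d_\omega x=\frac{1}{\omega_n}dx$ the normalized Lebesgue measure. For a measurable $\rho$ on $\mathbb{R}^n$ with $0\le\rho\le1$ and $0\notin\operatorname{supp}\rho$ (an admissible density), and $\beta\in\mathbb{R}$, put $$ \mathcal{F}_\beta\rho=\int_{\mathbb{R}^n}\frac{\rho(x)}{|x|^{n-\beta}}\,d_\omega x,\qquad \mathcal{H}_\beta\rho=\int_{\mathbb{R}^n}\frac{x_1\rho(x)}{|x|^{n+2-\beta}}\,d_\omega x . $$ A pair $(u,v)$ is admissible if there is an admissible density $\rho$ with $\mathcal{F}_\alpha\rho=u$ and $\mathcal{F}_{\alpha-2}\rho=v$. For an admissible pair with $u,v>0$, $$ \mathscr{N}_\alpha(u,v)=\sup_\rho\{|\mathcal{H}_\alpha\rho|^2:\ \mathcal{F}_\alpha\rho=u,\ \mathcal{F}_{\alpha-2}\rho=v\}, $$ the supremum being over all admissible densities $\rho$ satisfying the two constraints (by Cauchy's inequality the integral $\mathcal{H}_\alpha\rho$ then converges absolutely). *)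

theory Defs
  imports "HOL-Complex_Analysis.Complex_Analysis"
begin

section \<open>The Gauss hypergeometric function\<close>

text \<open>
  The principal branch: the function holomorphic on the plane cut along \<open>[1, \<infinity>)\<close> that agrees
  with the hypergeometric series on the unit disc. By the identity theorem its values on the
  cut plane are unique; its values on the cut itself are unspecified.
\<close>

definition hypergeo_2F1 :: "complex \<Rightarrow> complex \<Rightarrow> complex \<Rightarrow> complex \<Rightarrow> complex" where
  "hypergeo_2F1 a b c =
     (SOME g. g holomorphic_on (- complex_of_real ` {1..}) \<and>
              (\<forall>z\<in>ball 0 1. g z = eval_fps (fps_hypergeo [a, b] [c] 1) z))"

text \<open>For real parameters and real \<open>x < 1\<close> the value is real, so \<open>Re\<close> loses nothing.\<close>

definition hypergeo_2F1_real :: "real \<Rightarrow> real \<Rightarrow> real \<Rightarrow> real \<Rightarrow> real" where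
  "hypergeo_2F1_real a b c x =
     Re (hypergeo_2F1 (of_real a) (of_real b) (of_real c) (of_real x))"

definition f_fun :: "nat \<Rightarrow> real \<Rightarrow> real \<Rightarrow> real" where
  "f_fun n \<beta> t = t powr (2 - real n) * (t\<^sup>2 - 1) powr (real n / 2) *
     hypergeo_2F1_real ((2 - \<beta>) / 2) ((2 + \<beta>) / 2) ((real n + 2) / 2) (1 - t\<^sup>2)"

definition h_fun :: "nat \<Rightarrow> real \<Rightarrow> real \<Rightarrow> real" where
  "h_fun n \<beta> t = t powr (1 - real n) * (t\<^sup>2 - 1) powr (real n / 2) *
     hypergeo_2F1_real ((2 - \<beta>) / 2) (\<beta> / 2) ((real n + 2) / 2) (1 - t\<^sup>2)"

section \<open>The variational problem\<close>

definition lebesgue_normalized :: "(real ^ 'n) measure" where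
  "lebesgue_normalized =
     scale_measure (ennreal (1 / unit_ball_vol (real CARD('n)))) lebesgue"

definition admissible_density :: "(real ^ 'n \<Rightarrow> real) \<Rightarrow> bool" where
  "admissible_density \<rho> \<longleftrightarrow>
     \<rho> \<in> borel_measurable lebesgue \<and> (\<forall>x. 0 \<le> \<rho> x \<and> \<rho> x \<le> 1) \<and> 0 \<notin> closure {x. \<rho> x \<noteq> 0}"

text \<open>\<open>\<F>\<^sub>\<beta> \<rho>\<close> takes the value \<open>\<infinity>\<close> if the integral of the nonnegative integrand diverges.\<close>

definition F_fun :: "real \<Rightarrow> (real ^ 'n \<Rightarrow> real) \<Rightarrow> ennreal" where
  "F_fun \<beta> \<rho> =
     (\<integral>\<^sup>+x. ennreal (\<rho> x / norm x powr (real CARD('n) - \<beta>)) \<partial>lebesgue_normalized)"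

text \<open>
  The index \<open>k\<close> plays the role of the first coordinate: \<open>x $ k\<close> is \<open>x\<^sub>1\<close>, since an
  arbitrary finite index type has no distinguished first element.
\<close>

definition H_fun :: "'n \<Rightarrow> real \<Rightarrow> (real ^ 'n \<Rightarrow> real) \<Rightarrow> real" where
  "H_fun k \<beta> \<rho> =
     (LINT x|lebesgue_normalized. x $ k * \<rho> x / norm x powr (real CARD('n) + 2 - \<beta>))"

definition feasible_densities :: "real \<Rightarrow> real \<Rightarrow> real \<Rightarrow> (real ^ 'n \<Rightarrow> real) set" where
  "feasible_densities \<alpha> u v =
     {\<rho>. admissible_density \<rho> \<and> 0 \<le> u \<and> 0 \<le> v \<and>
         F_fun \<alpha> \<rho> = ennreal u \<and> F_fun (\<alpha> - 2) \<rho> = ennreal v}"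

definition admissible_pair :: "'n::finite itself \<Rightarrow> real \<Rightarrow> real \<Rightarrow> real \<Rightarrow> bool" where
  "admissible_pair _ \<alpha> u v \<longleftrightarrow>
     (\<exists>\<rho> :: real ^ 'n \<Rightarrow> real. \<rho> \<in> feasible_densities \<alpha> u v)"

text \<open>The supremum is taken in \<^typ>\<open>ereal\<close>, so that finiteness is not presupposed.\<close>

definition N_fun :: "'n::finite \<Rightarrow> real \<Rightarrow> real \<Rightarrow> real \<Rightarrow> ereal" where
  "N_fun k \<alpha> u v =
     (SUP \<rho> \<in> (feasible_densities \<alpha> u v :: (real ^ 'n \<Rightarrow> real) set).
        ereal (\<bar>H_fun k \<alpha> \<rho>\<bar>\<^sup>2))"

end

theory Submission
  imports Defs
begin

text \<open>
  Write \<open>e\<close> for the first coordinate direction. Lagrange multipliers and the bathtub principle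
  suggest that the extremal densities are the indicators of the sets
  \<open>{x. |x|\<^sup>2 + s\<^sup>2 \<le> 2 t s (e \<bullet> x)}\<close>, the balls with centre \<open>s t e\<close> and radius \<open>s \<surd>(t\<^sup>2 - 1)\<close>;
  these are hyperbolic balls of the half space, nested in \<open>t\<close>. By homogeneity
  everything reduces to \<open>s = 1\<close>, where the functionals of the ball have to be identified with
  \<open>f\<^sub>\<beta>(t)\<close> and \<open>h\<^sub>\<alpha>(t)\<close>.

  For this, the mean over a ball of \<open>q = |x|\<^sup>p\<close> or \<open>q = (e \<bullet> x) |x|\<^sup>p\<close> is expanded as in Pizzetti's
  formula: the Laplacian of \<open>q\<close> is a multiple of the same function with \<open>p - 2\<close> in place of \<open>p\<close>, so the mean is a
  hypergeometric series in \<open>1 - 1/t\<^sup>2\<close>. Euler's integral gives the analytic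
  continuation of the hypergeometric function, and substitutions in that integral turn the series in
  \<open>1 - 1/t\<^sup>2\<close> into the value at \<open>1 - t\<^sup>2\<close> (Pfaff's transformation). The equation for \<open>t\<close> is
  solvable because \<open>f\<^sub>\<beta>\<close> increases from \<open>0\<close>, without bound if \<open>\<beta> \<ge> 0\<close>.
\<close>

section \<open>The hypergeometric function as an Euler integral\<close>

text \<open>On the ball with parameters s and t the three functionals are s^\<alpha> f_\<alpha>(t),
  s^(\<alpha>-2) f_(\<alpha>-2)(t) and s^(\<alpha>-1) h_\<alpha>(t). Eliminating s from the first
  two gives the equation for t; inserting s = (u / f_\<alpha>(t))^(1/\<alpha>) into the square of
  the third gives the asserted value. Two obstacles shape the analysis. The hypergeometric function
  is a choice among continuations, so a continuation must be produced before any value is known, and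
  Euler's integral supplies one only when an upper parameter lies strictly between 0 and c. The
  indices \<alpha> and \<alpha> - 2 may need different parameters in this role, and \<beta> = 2
  makes one of them 0: hence two substitutions and a separate case. The other obstacle is
  convergence. The origin, where |x|^p may be singular, is at relative distance 1 from the centre,
  and the expansion must hold for every relative radius R < 1. With the bounds at hand a Lagrange
  remainder tends to 0 only for R^2 < 1/2; Cauchy's form reaches all R < 1.\<close>

text \<open>The mean value inequality turns the bound \<open>B\<close> on the derivative into an
  integrable bound for the difference quotients, so dominated convergence applies along every
  sequence tending to 0. The scalar field is left general: the Euler integral needs a complex
  variable, the ball integrals a real one.\<close>

lemma has_field_derivative_integral:
  fixes f f' :: "'a::{real_normed_field, banach, second_countable_topology} \<Rightarrow> 'b \<Rightarrow> 'a"
  assumes r: "0 < r"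
    and int: "\<And>x. x \<in> ball x0 r \<Longrightarrow> integrable M (f x)"
    and meas: "f' x0 \<in> borel_measurable M"
    and der: "\<And>x t. x \<in> ball x0 r \<Longrightarrow> ((\<lambda>x. f x t) has_field_derivative f' x t) (at x)"
    and bnd: "\<And>x t. x \<in> ball x0 r \<Longrightarrow> norm (f' x t) \<le> B t"
    and B: "integrable M B"
  shows "((\<lambda>x. \<integral>t. f x t \<partial>M) has_field_derivative (\<integral>t. f' x0 t \<partial>M)) (at x0)"
proof -
  have lip: "norm (f x t - f x0 t) \<le> B t * norm (x - x0)" if "x \<in> ball x0 r" for x t
    by (rule field_differentiable_bound[of "ball x0 r" _ "\<lambda>x. f' x t"])
       (use that r der bnd in \<open>auto intro: has_field_derivative_at_within\<close>)
  have "((\<lambda>h. ((\<integral>t. f (x0 + h) t \<partial>M) - (\<integral>t. f x0 t \<partial>M)) / h) \<longlongrightarrow> (\<integral>t. f' x0 t \<partial>M)) (at 0)"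
    unfolding tendsto_at_iff_sequentially comp_def
  proof safe
    fix X :: "nat \<Rightarrow> 'a"
    assume X0: "\<forall>i. X i \<in> UNIV - {0}" and X: "X \<longlonglongrightarrow> 0"
    \<comment> \<open>Domination holds only inside the ball, so an initial segment of the sequence
      is dropped; \<open>LIMSEQ_offset\<close> restores it at the end.\<close>
    obtain N where N: "\<And>i. i \<ge> N \<Longrightarrow> norm (X i) < r"
      using LIMSEQ_D[OF X r] by auto
    define Y where "Y i = X (i + N)" for i
    have Y: "Y \<longlonglongrightarrow> 0" using LIMSEQ_ignore_initial_segment[OF X, of N] by (simp add: Y_def[abs_def])
    have Yr: "x0 + Y i \<in> ball x0 r" and Y0: "Y i \<noteq> 0" for i
      using N[of "i + N"] X0 by (auto simp: Y_def dist_norm)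
    have x0: "x0 \<in> ball x0 r" using r by simp
    have "(\<lambda>i. \<integral>t. (f (x0 + Y i) t - f x0 t) / Y i \<partial>M) \<longlonglongrightarrow> (\<integral>t. f' x0 t \<partial>M)"
    proof (rule integral_dominated_convergence[where w=B])
      show "(\<lambda>t. (f (x0 + Y i) t - f x0 t) / Y i) \<in> borel_measurable M" for i
        using int[OF Yr] int[OF x0] by (intro borel_measurable_integrable integrable_divide Bochner_Integration.integrable_diff)
      show "AE t in M. (\<lambda>i. (f (x0 + Y i) t - f x0 t) / Y i) \<longlonglongrightarrow> f' x0 t"
      proof (rule AE_I2)
        fix t
        have "((\<lambda>h. (f (x0 + h) t - f x0 t) / h) \<longlongrightarrow> f' x0 t) (at 0)"
          using der[OF x0] by (simp add: DERIV_def)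
        then show "(\<lambda>i. (f (x0 + Y i) t - f x0 t) / Y i) \<longlonglongrightarrow> f' x0 t"
          unfolding tendsto_at_iff_sequentially comp_def using Y Y0 by auto
      qed
      show "AE t in M. norm ((f (x0 + Y i) t - f x0 t) / Y i) \<le> B t" for i
        using lip[OF Yr] Y0 by (intro AE_I2) (auto simp: norm_divide divide_simps)
    qed (use meas B in auto)
    also have "(\<lambda>i. \<integral>t. (f (x0 + Y i) t - f x0 t) / Y i \<partial>M)
       = (\<lambda>i. ((\<integral>t. f (x0 + Y i) t \<partial>M) - (\<integral>t. f x0 t \<partial>M)) / Y i)"
      using int[OF Yr] int[OF x0] by simp
    finally show "(\<lambda>i. ((\<integral>t. f (x0 + X i) t \<partial>M) - (\<integral>t. f x0 t \<partial>M)) / X i) \<longlonglongrightarrow> (\<integral>t. f' x0 t \<partial>M)"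
      unfolding Y_def by (rule LIMSEQ_offset)
  qed
  then show ?thesis by (simp add: DERIV_def)
qed

section \<open>Euler's integral on the slit plane\<close>

text \<open>The Beta density with its cut-off built in, so that all integrals run over the whole
  line; \<open>d\<close> stands for c - b.\<close>

definition euler_weight :: "real \<Rightarrow> real \<Rightarrow> real \<Rightarrow> real" where
  "euler_weight b d s = indicator {0..1} s * (s powr (b - 1) * (1 - s) powr (d - 1))"

lemma euler_weight_measurable [measurable]: "euler_weight b d \<in> borel_measurable borel"
  unfolding euler_weight_def by measurable

lemma euler_weight_nonneg: "0 \<le> euler_weight b d s"
  by (simp add: euler_weight_def)

lemma euler_weight_eq_0: "s \<notin> {0..1} \<Longrightarrow> euler_weight b d s = 0"
  by (simp add: euler_weight_def)

lemma euler_weight_integral: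
  assumes "0 < b" "0 < d"
  shows "integrable lborel (euler_weight b d)" "(LBINT s. euler_weight b d s) = Beta b d"
proof -
  have i: "set_integrable lborel {0..1} (\<lambda>t::real. t powr (b - 1) * (1 - t) powr (d - 1))"
    by (rule integrable_Beta[OF assms])
  then show "integrable lborel (euler_weight b d)"
    by (simp add: set_integrable_def euler_weight_def[abs_def])
  have "(LBINT s:{0..1}. s powr (b - 1) * (1 - s) powr (d - 1)) = Beta b d"
    using has_integral_Beta_real[OF assms] set_borel_integral_eq_integral(2)[OF i]
    by (simp add: integral_unique)
  then show "(LBINT s. euler_weight b d s) = Beta b d"
    by (simp add: set_lebesgue_integral_def euler_weight_def[abs_def])
qed

lemma Beta_real_pos: "0 < Beta b (d::real)" if "0 < b" "0 < d"
  using that by (simp add: Beta_def Gamma_real_pos)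

lemma Beta_shift:
  assumes "0 < b" "0 < (d::real)"
  shows "Beta (b + real k) d = Beta b d * pochhammer b k / pochhammer (b + d) k"
proof -
  have 1: "pochhammer b k = Gamma (b + real k) / Gamma b"
    using assms by (intro pochhammer_Gamma) (auto dest: nonpos_Ints_nonpos)
  have 2: "pochhammer (b + d) k = Gamma (b + d + real k) / Gamma (b + d)"
    using assms by (intro pochhammer_Gamma) (auto dest: nonpos_Ints_nonpos)
  have "Gamma b > 0" "Gamma (b + d) > 0" "Gamma (b + d + real k) > 0"
    using assms by (auto intro: Gamma_real_pos)
  then show ?thesis
    unfolding 1 2 Beta_def by (simp add: add_ac)
qed

lemma euler_weight_power: "0 < b \<Longrightarrow> euler_weight b d s * s ^ k = euler_weight (b + real k) d s"
  by (cases "s = 0") (auto simp: euler_weight_def indicator_def powr_realpow powr_diff powr_add)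

abbreviation slit_plane :: "complex set" where
  "slit_plane \<equiv> - complex_of_real ` {1..}"

text \<open>If 1 - z s = -x with x \<ge> 0, then z = (1 + x) / s \<ge> 1 lies on the cut. So the
  principal power in Euler's integrand is holomorphic in z along the whole interval of
  integration.\<close>

lemma slit_plane_not_nonpos:
  assumes "z \<in> slit_plane" "s \<in> {0..1}"
  shows "1 - z * complex_of_real s \<notin> \<real>\<^sub>\<le>\<^sub>0"
proof
  assume "1 - z * complex_of_real s \<in> \<real>\<^sub>\<le>\<^sub>0"
  then obtain y where "y \<le> 0" and y: "1 - z * of_real s = of_real y"
    by (auto elim: nonpos_Reals_cases)
  define x where "x = - y"
  have x: "x \<ge> 0" "z * of_real s = of_real (1 + x)"
    using \<open>y \<le> 0\<close> y by (auto simp: x_def algebra_simps)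
  have "s \<noteq> 0"
  proof
    assume "s = 0"
    then have "complex_of_real (1 + x) = of_real 0" using x by simp
    then have "1 + x = 0" by (simp only: of_real_eq_iff)
    then show False using x by simp
  qed
  with x assms have "z = of_real ((1 + x) / s)" by (simp add: field_simps)
  moreover have "(1 + x) / s \<ge> 1" using assms x \<open>s \<noteq> 0\<close> by (auto simp: field_simps)
  ultimately show False using assms by blast
qed

lemma slit_plane_open: "open slit_plane"
proof -
  have "closed (complex_of_real ` {1..})"
    by (intro closed_injective_linear_image) (auto simp: linear_iff scaleR_conv_of_real inj_def)
  then show ?thesis by (simp add: open_Compl)
qed

text \<open>The set is star-shaped about 0: a point u z on the cut would make 1 - z u a nonpositive
  real. Connectedness is what the identity theorem requires.\<close>

lemma slit_plane_connected: "connected slit_plane"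
proof (rule starlike_imp_connected)
  show "starlike slit_plane"
    unfolding starlike_def
  proof (intro bexI ballI subsetI)
    show "(0::complex) \<in> slit_plane" by auto
    fix z w assume z: "z \<in> slit_plane" and "w \<in> closed_segment 0 z"
    then obtain u where u: "0 \<le> u" "u \<le> 1" "w = of_real u * z"
      by (auto simp: closed_segment_def scaleR_conv_of_real)
    show "w \<in> slit_plane"
    proof
      assume "w \<in> complex_of_real ` {1..}"
      then obtain x where "1 \<le> x" "w = of_real x" by auto
      then have "1 - z * of_real u = of_real (1 - x)" using u by (simp add: mult.commute)
      then have "1 - z * of_real u \<in> \<real>\<^sub>\<le>\<^sub>0" using \<open>1 \<le> x\<close>
        by (metis diff_le_0_iff_le nonpos_Reals_of_real_iff)
      then show False using slit_plane_not_nonpos[OF z, of u] u by auto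
    qed
  qed
qed

definition euler_integral :: "real \<Rightarrow> real \<Rightarrow> real \<Rightarrow> complex \<Rightarrow> complex" where
  "euler_integral a b d z =
     (LBINT s. of_real (euler_weight b d s) * (1 - z * of_real s) powr (- of_real a))"

text \<open>The kernel is continuous on the compact product of \<open>K\<close> and [0, 1], since
  its base avoids the nonpositive reals there.\<close>

lemma euler_kernel_bound:
  assumes "compact K" "K \<subseteq> slit_plane"
  obtains C where "\<And>z s. z \<in> K \<Longrightarrow> s \<in> {0..1} \<Longrightarrow> norm ((1 - z * complex_of_real s) powr a) \<le> C"
proof -
  have ne: "1 - fst p * complex_of_real (snd p) \<notin> \<real>\<^sub>\<le>\<^sub>0" if "p \<in> K \<times> {0..1}" for p
    using that assms(2) by (intro slit_plane_not_nonpos) auto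
  have "continuous_on (K \<times> {0..1}) (\<lambda>(z, s). (1 - z * complex_of_real s) powr a)"
    unfolding case_prod_beta
  proof (rule continuous_on_powr_complex)
    show "K \<times> {0..1} \<subseteq> {p. 0 \<le> Re (1 - fst p * complex_of_real (snd p)) \<or> Im (1 - fst p * complex_of_real (snd p)) \<noteq> 0}"
      using ne unfolding complex_nonpos_Reals_iff by force
    show "0 < Re a" if "p \<in> K \<times> {0..1}" "1 - fst p * complex_of_real (snd p) = 0" for p
      using ne[OF that(1)] that(2) by simp
  qed (intro continuous_intros)+
  then have "compact ((\<lambda>(z, s). (1 - z * complex_of_real s) powr a) ` (K \<times> {0..1}))"
    by (intro compact_continuous_image compact_Times assms compact_Icc)
  then obtain C where "\<forall>x\<in>(\<lambda>(z, s). (1 - z * complex_of_real s) powr a) ` (K \<times> {0..1}). norm x \<le> C"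
    using compact_imp_bounded bounded_iff by blast
  then show ?thesis by (intro that[of C]) auto
qed

lemma euler_integrand_integrable:
  assumes "0 < b" "0 < d" "z \<in> slit_plane"
  shows "integrable lborel (\<lambda>s. of_real (euler_weight b d s) * (1 - z * of_real s) powr a)"
proof -
  obtain C where C: "\<And>s. s \<in> {0..1} \<Longrightarrow> norm ((1 - z * complex_of_real s) powr a) \<le> C"
    using euler_kernel_bound[of "{z}" a] assms(3) by (metis compact_sing empty_subsetI insert_subset singletonI)
  show ?thesis
  proof (rule Bochner_Integration.integrable_bound)
    show "integrable lborel (\<lambda>s. C * euler_weight b d s)"
      using euler_weight_integral[OF assms(1,2)] by simp
    show "AE s in lborel. norm (complex_of_real (euler_weight b d s) * (1 - z * complex_of_real s) powr a)
       \<le> norm (C * euler_weight b d s)"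
    proof (rule AE_I2)
      fix s
      show "norm (complex_of_real (euler_weight b d s) * (1 - z * complex_of_real s) powr a)
       \<le> norm (C * euler_weight b d s)"
      proof (cases "s \<in> {0..1}")
        case True
        have "norm ((1 - z * complex_of_real s) powr a) \<le> \<bar>C\<bar>" using C[OF True] by linarith
        from mult_right_mono[OF this, of "\<bar>euler_weight b d s\<bar>"] show ?thesis by (simp add: norm_mult abs_mult mult.commute)
      qed (simp add: euler_weight_eq_0)
    qed
  qed measurable
qed

text \<open>Differentiation under the integral sign on a closed disc inside the slit plane. The
  factor s produced by the derivative is at most 1, so a multiple of the weight still
  dominates.\<close>

lemma euler_integral_holomorphic:
  assumes "0 < b" "0 < d"
  shows "euler_integral a b d holomorphic_on slit_plane"
proof (subst holomorphic_on_open[OF slit_plane_open], intro ballI)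
  fix z assume "z \<in> slit_plane"
  then obtain r where r: "0 < r" "cball z r \<subseteq> slit_plane"
    using slit_plane_open open_contains_cball by blast
  define k' :: "complex \<Rightarrow> real \<Rightarrow> complex" where
    "k' x s = of_real (euler_weight b d s) * (of_real a * of_real s * (1 - x * of_real s) powr (- of_real a - 1))" for x s
  obtain C where C: "\<And>x s. x \<in> cball z r \<Longrightarrow> s \<in> {0..1} \<Longrightarrow> norm ((1 - x * complex_of_real s) powr (- of_real a - 1)) \<le> C"
    using euler_kernel_bound[of "cball z r"] r by (metis compact_cball)
  have "(euler_integral a b d has_field_derivative (LBINT s. k' z s)) (at z)"
    unfolding euler_integral_def[abs_def]
  proof (rule has_field_derivative_integral[OF r(1), where B="\<lambda>s. \<bar>a\<bar> * \<bar>C\<bar> * euler_weight b d s"])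
    fix x assume x: "x \<in> ball z r"
    then have "x \<in> cball z r" by simp
    then have x': "x \<in> slit_plane" using r by blast
    show "integrable lborel (\<lambda>s. of_real (euler_weight b d s) * (1 - x * of_real s) powr (- of_real a))"
      by (rule euler_integrand_integrable[OF assms x'])
    fix s :: real
    show "((\<lambda>x. of_real (euler_weight b d s) * (1 - x * of_real s) powr (- of_real a)) has_field_derivative k' x s) (at x)"
    proof (cases "s \<in> {0..1}")
      case True
      then show ?thesis unfolding k'_def
        using slit_plane_not_nonpos[OF x' True] by (auto intro!: derivative_eq_intros)
    qed (simp add: k'_def euler_weight_eq_0)
    show "norm (k' x s) \<le> \<bar>a\<bar> * \<bar>C\<bar> * euler_weight b d s"
    proof (cases "s \<in> {0..1}")
      case True
      have "norm ((1 - x * complex_of_real s) powr (- of_real a - 1)) \<le> \<bar>C\<bar>"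
        using C[OF _ True, of x] x by auto
      moreover have "\<bar>s\<bar> \<le> 1" using True by auto
      ultimately have "\<bar>s\<bar> * norm ((1 - x * complex_of_real s) powr (- of_real a - 1)) \<le> 1 * \<bar>C\<bar>"
        by (intro mult_mono) auto
      then have "euler_weight b d s * (\<bar>a\<bar> * (\<bar>s\<bar> * norm ((1 - x * complex_of_real s) powr (- of_real a - 1))))
         \<le> euler_weight b d s * (\<bar>a\<bar> * \<bar>C\<bar>)"
        by (intro mult_left_mono) (auto simp: euler_weight_nonneg)
      then show ?thesis
        by (simp add: k'_def norm_mult mult_ac euler_weight_nonneg)
    qed (simp add: k'_def euler_weight_eq_0)
  next
    show "k' z \<in> borel_measurable lborel" unfolding k'_def by measurable
    show "integrable lborel (\<lambda>s. \<bar>a\<bar> * \<bar>C\<bar> * euler_weight b d s)"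
      using euler_weight_integral[OF assms] by simp
  qed
  then show "\<exists>f'. (euler_integral a b d has_field_derivative f') (at z)" by blast
qed

text \<open>The binomial series with exponent -a; the signs of the binomial coefficients and of the
  powers of -z cancel.\<close>

lemma pochhammer_series:
  fixes z :: complex
  assumes "norm z < 1"
  shows "(\<lambda>k. pochhammer a k / fact k * z ^ k) sums (1 - z) powr (- a)"
    "summable (\<lambda>k. norm (pochhammer a k / fact k * z ^ k))"
proof -
  have eq: "(- a gchoose k) * (- z) ^ k = pochhammer a k / fact k * z ^ k" for k
  proof -
    have "(- a gchoose k) * (- z) ^ k = ((- 1) ^ k * (- 1) ^ k) * (pochhammer a k / fact k * z ^ k)"
      unfolding gbinomial_pochhammer power_minus[of z] by simp
    then show ?thesis by (simp flip: power_add power_mult_distrib)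
  qed
  show "(\<lambda>k. pochhammer a k / fact k * z ^ k) sums (1 - z) powr (- a)"
    using gen_binomial_complex[of "- z" "- a"] assms by (simp add: eq)
  \<comment> \<open>A point with modulus between |z| and 1: convergence there gives absolute
    convergence at z.\<close>
  define y where "y = complex_of_real ((norm z + 1) / 2)"
  have "norm y = (norm z + 1) / 2" by (simp add: y_def del: of_real_divide)
  then have y: "norm z < norm y" "norm y < 1" using assms by auto
  have "summable (\<lambda>k. (- a gchoose k) * (- y) ^ k)"
    using gen_binomial_complex[of "- y" "- a"] y by (auto simp: sums_iff)
  then have "summable (\<lambda>k. norm ((- a gchoose k) * (- z) ^ k))"
    by (rule powser_insidea) (use y in auto)
  then show "summable (\<lambda>k. norm (pochhammer a k / fact k * z ^ k))" by (simp only: eq)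
qed

text \<open>Expand the kernel binomially and integrate term by term. The factor s^k raises b by k,
  and the quotient of the Beta values is (b)_k / (b + d)_k. The absolutely convergent binomial
  series at z dominates, because 0 \<le> s \<le> 1.\<close>

lemma euler_integral_sums:
  assumes "0 < b" "0 < d" "norm z < 1"
  shows "(\<lambda>k. of_real (Beta b d * (pochhammer a k * pochhammer b k / (pochhammer (b + d) k * fact k))) * z ^ k)
           sums euler_integral a b d z"
proof -
  define u :: "nat \<Rightarrow> real \<Rightarrow> complex" where
    "u k s = of_real (euler_weight b d s) * (pochhammer (of_real a) k / fact k * (z * of_real s) ^ k)" for k s
  have u: "u k s = pochhammer (of_real a) k / fact k * z ^ k * of_real (euler_weight (b + real k) d s)" for k s
    using euler_weight_power[OF assms(1), of d s k, symmetric]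
    by (simp add: u_def power_mult_distrib mult_ac)
  have ui: "integrable lborel (u k)" for k
    unfolding u using euler_weight_integral(1)[of "b + real k" d] assms by simp
  have "(\<lambda>k. LBINT s. u k s) sums (LBINT s. (\<Sum>k. u k s))"
  proof (rule sums_integral[OF ui])
    have "norm (u k s) \<le> norm (pochhammer (of_real a) k / fact k * z ^ k) * euler_weight b d s" for k s
    proof (cases "s \<in> {0..1}")
      case True
      then have "norm s ^ k \<le> 1" by (simp add: power_le_one)
      then have "(norm (pochhammer (complex_of_real a) k) / fact k * norm z ^ k * euler_weight b d s) * norm s ^ k
        \<le> norm (pochhammer (complex_of_real a) k) / fact k * norm z ^ k * euler_weight b d s"
        by (intro mult_right_le_one_le) (auto simp: euler_weight_nonneg)
      then show ?thesis
        by (simp add: u_def norm_mult norm_divide norm_power power_mult_distrib euler_weight_nonneg mult_ac)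
    qed (simp add: u_def euler_weight_eq_0)
    note le = this
    have sm: "summable (\<lambda>k. norm (pochhammer (of_real a) k / fact k * z ^ k))"
      by (rule pochhammer_series(2)[OF assms(3)])
    show "AE s in lborel. summable (\<lambda>k. norm (u k s))"
    proof (rule AE_I2)
      fix s
      show "summable (\<lambda>k. norm (u k s))"
        by (rule summable_comparison_test'[OF summable_mult2[OF sm, of "euler_weight b d s"]])
           (use le in simp)
    qed
    show "summable (\<lambda>k. LBINT s. norm (u k s))"
    proof (rule summable_comparison_test'[OF summable_mult2[OF sm, of "Beta b d"]])
      fix k
      have "(LBINT s. norm (u k s)) \<le> (LBINT s. norm (pochhammer (of_real a) k / fact k * z ^ k) * euler_weight b d s)"
        using ui le euler_weight_integral[OF assms(1,2)] by (intro integral_mono) auto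
      then show "norm (LBINT s. norm (u k s)) \<le> norm (pochhammer (of_real a) k / fact k * z ^ k) * Beta b d"
        using euler_weight_integral[OF assms(1,2)] by simp
    qed
  qed
  moreover have "(LBINT s. (\<Sum>k. u k s)) = euler_integral a b d z"
    unfolding euler_integral_def
  proof (rule Bochner_Integration.integral_cong)
    fix s
    show "(\<Sum>k. u k s) = of_real (euler_weight b d s) * (1 - z * of_real s) powr (- of_real a)"
    proof (cases "s \<in> {0..1}")
      case True
      then have "norm (z * of_real s) < 1"
        using assms(3) mult_right_le_one_le[of "norm z" s] by (simp add: norm_mult)
      from pochhammer_series(1)[OF this, of "of_real a"]
      show ?thesis unfolding u_def by (intro sums_unique[symmetric] sums_mult)
    qed (simp add: u_def euler_weight_eq_0)
  qed simp
  moreover have "(LBINT s. u k s) = of_real (Beta b d * (pochhammer a k * pochhammer b k / (pochhammer (b + d) k * fact k))) * z ^ k" for k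
    unfolding u using assms by (simp add: euler_weight_integral Beta_shift pochhammer_of_real)
  ultimately show ?thesis by simp
qed

section \<open>Identifying the chosen continuation\<close>

lemma eval_fps_hypergeo_sums:
  fixes a b c :: real
  shows "eval_fps (fps_hypergeo [of_real a, of_real b] [of_real c] 1) z =
    (\<Sum>k. of_real (pochhammer a k * pochhammer b k / (pochhammer c k * fact k)) * (z::complex) ^ k)"
  by (simp add: eval_fps_def pochhammer_of_real)

text \<open>The coefficients are symmetric, so both choices are made under the same condition and
  agree whether or not a continuation exists.\<close>

lemma hypergeo_2F1_commute: "hypergeo_2F1 a b c = hypergeo_2F1 b a c"
proof -
  have "fps_hypergeo [a, b] [c] 1 = fps_hypergeo [b, a] [c] 1"
    by (simp add: fps_eq_iff mult.commute)
  then show ?thesis by (simp add: hypergeo_2F1_def)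
qed

lemma hypergeo_2F1_real_commute: "hypergeo_2F1_real a b c x = hypergeo_2F1_real b a c x"
  by (simp add: hypergeo_2F1_real_def hypergeo_2F1_commute[of "of_real a"])

text \<open>A single continuation \<open>g\<close> serves twice: it witnesses that the choice is
  made from a nonempty set, and by the identity theorem it equals the function chosen.\<close>

lemma hypergeo_2F1_unique:
  assumes "g holomorphic_on slit_plane"
    and "\<And>z. z \<in> ball 0 1 \<Longrightarrow> g z = eval_fps (fps_hypergeo [a, b] [c] 1) z"
    and "z \<in> slit_plane"
  shows "hypergeo_2F1 a b c z = g z"
proof -
  let ?P = "\<lambda>g. g holomorphic_on slit_plane \<and> (\<forall>z\<in>ball 0 1. g z = eval_fps (fps_hypergeo [a, b] [c] 1) z)"
  have P: "?P (hypergeo_2F1 a b c)"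
    unfolding hypergeo_2F1_def by (rule someI[of ?P g]) (use assms in auto)
  show ?thesis
  proof (rule analytic_continuation_open[of "ball 0 1" slit_plane "hypergeo_2F1 a b c" g])
    show "ball 0 1 \<subseteq> slit_plane" by auto
    show "hypergeo_2F1 a b c w = g w" if "w \<in> ball 0 1" for w
      using P assms(2)[OF that] that by simp
    show "hypergeo_2F1 a b c holomorphic_on slit_plane" using P by blast
    show "ball 0 1 \<noteq> ({} :: complex set)" by simp
  qed (use assms slit_plane_open slit_plane_connected in auto)
qed

lemma hypergeo_2F1_euler:
  assumes "0 < b" "b < c" "z \<in> slit_plane"
  shows "hypergeo_2F1 (of_real a) (of_real b) (of_real c) z = euler_integral a b (c - b) z / of_real (Beta b (c - b))"
proof (rule hypergeo_2F1_unique[OF _ _ assms(3)])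
  have B: "Beta b (c - b) > 0" using Beta_real_pos assms by auto
  show "(\<lambda>z. euler_integral a b (c - b) z / complex_of_real (Beta b (c - b))) holomorphic_on slit_plane"
    using euler_integral_holomorphic[of b "c - b" a] assms B by (intro holomorphic_intros) auto
  fix z :: complex assume z: "z \<in> ball 0 1"
  have "(\<lambda>k. (of_real (Beta b (c - b) * (pochhammer a k * pochhammer b k / (pochhammer c k * fact k))) * z ^ k) / of_real (Beta b (c - b)))
           sums (euler_integral a b (c - b) z / of_real (Beta b (c - b)))"
    using euler_integral_sums[of b "c - b" z a] z assms by (intro sums_divide) auto
  moreover have "(of_real (Beta b (c - b) * (pochhammer a k * pochhammer b k / (pochhammer c k * fact k))) * z ^ k) / of_real (Beta b (c - b))
      = of_real (pochhammer a k * pochhammer b k / (pochhammer c k * fact k)) * z ^ k" for k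
    using B by (simp only: of_real_mult) (simp add: field_simps)
  ultimately show "euler_integral a b (c - b) z / of_real (Beta b (c - b)) =
      eval_fps (fps_hypergeo [complex_of_real a, complex_of_real b] [complex_of_real c] 1) z"
    by (simp only: eval_fps_hypergeo_sums) (rule sums_unique)
qed

section \<open>Pfaff's transformation on the real axis\<close>

definition euler_integral_real :: "real \<Rightarrow> real \<Rightarrow> real \<Rightarrow> real \<Rightarrow> real" where
  "euler_integral_real a b d x = (LBINT s. euler_weight b d s * (1 - x * s) powr (- a))"

text \<open>For x < 1 and s in [0, 1] the base 1 - x s is positive, so the principal power is the
  real power.\<close>

lemma euler_integral_of_real:
  assumes "0 < b" "0 < d" "x < 1"
  shows "euler_integral a b d (of_real x) = of_real (euler_integral_real a b d x)"
    "integrable lborel (\<lambda>s. euler_weight b d s * (1 - x * s) powr (- a))"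
proof -
  have eq: "of_real (euler_weight b d s) * (1 - complex_of_real x * of_real s) powr (- of_real a)
     = complex_of_real (euler_weight b d s * (1 - x * s) powr (- a))" for s
  proof (cases "s \<in> {0..1}")
    case True
    have "x * s < 1"
    proof (cases "x \<le> 0")
      case True
      then have "x * s \<le> 0" using \<open>s \<in> {0..1}\<close> by (auto intro: mult_nonpos_nonneg)
      then show ?thesis by simp
    next
      case False
      then have "x * s \<le> x" using True by (simp add: mult_left_le)
      then show ?thesis using assms by simp
    qed
    then have "complex_of_real (1 - x * s) powr of_real (- a) = of_real ((1 - x * s) powr (- a))"
      by (intro powr_of_real) auto
    then show ?thesis by simp
  qed (simp add: euler_weight_eq_0)
  show "euler_integral a b d (of_real x) = of_real (euler_integral_real a b d x)"
    unfolding euler_integral_def euler_integral_real_def eq by (rule integral_complex_of_real)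
  have "complex_of_real x \<in> slit_plane" using assms by auto
  from euler_integrand_integrable[OF assms(1,2) this, of "- of_real a"]
  show "integrable lborel (\<lambda>s. euler_weight b d s * (1 - x * s) powr (- a))"
    unfolding eq complex_of_real_integrable_eq .
qed

lemma hypergeo_2F1_real_euler:
  assumes "0 < b" "b < c" "x < 1"
  shows "hypergeo_2F1_real a b c x = euler_integral_real a b (c - b) x / Beta b (c - b)"
proof -
  have "complex_of_real x \<in> slit_plane" using assms by auto
  from hypergeo_2F1_euler[OF assms(1,2) this, of a] show ?thesis
    using assms by (simp add: hypergeo_2F1_real_def euler_integral_of_real)
qed

lemma euler_integral_real_sums:
  assumes "0 < b" "0 < d" "\<bar>x\<bar> < 1"
  shows "(\<lambda>k. Beta b d * (pochhammer a k * pochhammer b k / (pochhammer (b + d) k * fact k)) * x ^ k)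
           sums euler_integral_real a b d x"
proof -
  have "(\<lambda>k. complex_of_real (Beta b d * (pochhammer a k * pochhammer b k / (pochhammer (b + d) k * fact k)) * x ^ k))
    sums of_real (euler_integral_real a b d x)"
    using euler_integral_sums[of b d "of_real x" a] assms euler_integral_of_real(1)[of b d x a] by simp
  then show ?thesis by (simp only: sums_of_real_iff)
qed

text \<open>The substitution s -> 1 - s exchanges \<open>b\<close> and \<open>d\<close>, and 1 - (1
  - t^2)(1 - s) = t^2 (1 - (1 - 1/t^2) s), from which the power of t is pulled out.\<close>

lemma euler_integral_real_reflect:
  assumes t: "0 < t"
  shows "euler_integral_real a b d (1 - t\<^sup>2) = t powr (- 2 * a) * euler_integral_real a d b (1 - 1 / t\<^sup>2)"
proof -
  have "euler_integral_real a b d (1 - t\<^sup>2) =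
      (LBINT s. euler_weight b d (1 + - 1 * s) * (1 - (1 - t\<^sup>2) * (1 + - 1 * s)) powr (- a))"
    unfolding euler_integral_real_def by (subst lborel_integral_real_affine[where c="-1" and t=1]) auto
  also have "\<dots> = (LBINT s. t powr (- 2 * a) * (euler_weight d b s * (1 - (1 - 1 / t\<^sup>2) * s) powr (- a)))"
  proof (rule Bochner_Integration.integral_cong)
    fix s :: real
    have w: "euler_weight b d (1 + - 1 * s) = euler_weight d b s"
      by (auto simp: euler_weight_def indicator_def)
    show "euler_weight b d (1 + - 1 * s) * (1 - (1 - t\<^sup>2) * (1 + - 1 * s)) powr (- a)
      = t powr (- 2 * a) * (euler_weight d b s * (1 - (1 - 1 / t\<^sup>2) * s) powr (- a))"
    proof (cases "s \<in> {0..1}")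
      case True
      have e: "1 - (1 - t\<^sup>2) * (1 + - 1 * s) = t\<^sup>2 * (1 - (1 - 1 / t\<^sup>2) * s)"
        using t by (simp add: field_simps)
      have "t\<^sup>2 * (1 - (1 - 1 / t\<^sup>2) * s) = t\<^sup>2 * (1 - s) + s" using t by (simp add: field_simps)
      also have "\<dots> \<ge> 0" using True by simp
      finally have "0 \<le> 1 - (1 - 1 / t\<^sup>2) * s" using t by (simp add: zero_le_mult_iff)
      then have "(t\<^sup>2 * (1 - (1 - 1 / t\<^sup>2) * s)) powr (- a) = t powr (- 2 * a) * (1 - (1 - 1 / t\<^sup>2) * s) powr (- a)"
        using t by (simp add: powr_mult powr_powr flip: powr_numeral)
      then show ?thesis unfolding w e by simp
    qed (unfold w, simp add: euler_weight_eq_0)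
  qed simp
  finally show ?thesis by (simp add: euler_integral_real_def)
qed

text \<open>The substitution \<open>s \<mapsto> s / (t\<^sup>2 (1 - y s))\<close> with \<open>y = 1 - 1 / t\<^sup>2\<close> is an increasing
  self-map of \<open>[0, 1]\<close>.\<close>

lemma euler_integral_real_moebius:
  assumes t: "1 < t" and b: "0 < b" and d: "0 < d"
  shows "euler_integral_real a b d (1 - t\<^sup>2) = t powr (- 2 * b) * euler_integral_real (b + d - a) b d (1 - 1 / t\<^sup>2)"
proof -
  define D where "D s = t\<^sup>2 - s * (t\<^sup>2 - 1)" for s
  define g where "g s = s / D s" for s
  define g' where "g' s = t\<^sup>2 / (D s)\<^sup>2" for s
  have t2: "t\<^sup>2 > 1" using t by (simp add: one_less_power)
  have D: "D s > 0" if "s \<in> {0..1}" for s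
  proof -
    have "s * (t\<^sup>2 - 1) \<le> 1 * (t\<^sup>2 - 1)" using that t2 by (intro mult_right_mono) auto
    then show ?thesis by (simp add: D_def)
  qed
  let ?f = "\<lambda>s. s powr (b - 1) * (1 - s) powr (d - 1) * (1 - (1 - t\<^sup>2) * s) powr (- a)"
  have g01: "g 0 = 0" "g 1 = 1" by (auto simp: g_def D_def)
  have x: "1 - t\<^sup>2 < 1" using t by simp
  have f_eq: "euler_weight b d s * (1 - (1 - t\<^sup>2) * s) powr (- a) = ?f s * indicator {g 0..g 1} s" for s
    by (simp add: euler_weight_def g01)
  have "set_integrable lborel {g 0..g 1} ?f"
    using euler_integral_of_real(2)[OF b d x, of a] unfolding f_eq by (simp add: set_integrable_def mult.commute)
  then have "(LBINT s. ?f s * indicator {g 0..g 1} s) = (LBINT s. ?f (g s) * g' s * indicator {0..1} s)"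
  proof (rule integral_substitution)
    fix s :: real assume s: "s \<in> {0..1}"
    show "(g has_real_derivative g' s) (at s)"
      using D[OF s] unfolding g_def[abs_def] g'_def D_def
      by (auto intro!: derivative_eq_intros simp: power2_eq_square field_simps)
    show "0 \<le> g' s" by (simp add: g'_def)
  next
    have "continuous_on {0..1} D" unfolding D_def[abs_def] by (intro continuous_intros)
    then show "continuous_on {0..1} g'" unfolding g'_def[abs_def] 
      by (intro continuous_intros) (auto dest: D)
  qed simp
  also have "\<dots> = (LBINT s. t powr (- 2 * b) * (euler_weight b d s * (1 - (1 - 1 / t\<^sup>2) * s) powr (- (b + d - a))))"
  proof (rule Bochner_Integration.integral_cong)
    fix s :: real
    show "?f (g s) * g' s * indicator {0..1} s =
      t powr (- 2 * b) * (euler_weight b d s * (1 - (1 - 1 / t\<^sup>2) * s) powr (- (b + d - a)))"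
    proof (cases "s \<in> {0..1}")
      case True
      note Ds = D[OF True]
      \<comment> \<open>Every base in the transformed integrand is a product of powers of s, 1 - s,
        t and \<open>E\<close>. The exponents of \<open>E\<close> are 1 - b, 1 - d, a and -2, with
        sum -(b + d - a).\<close>
      define E where "E = 1 - (1 - 1 / t\<^sup>2) * s"
      have DE: "D s = t\<^sup>2 * E" using t by (simp add: D_def E_def field_simps)
      have E: "E > 0" using Ds t unfolding DE by (simp add: zero_less_mult_iff)
      have 1: "1 - g s = (1 - s) / E"
        using Ds E t unfolding g_def DE by (simp add: E_def field_simps)
      have 2: "1 - (1 - t\<^sup>2) * g s = 1 / E"
        using Ds E t unfolding g_def DE by (simp add: E_def field_simps)
      have 3: "g s powr (b - 1) = s powr (b - 1) * t powr (- 2 * b + 2) * E powr (1 - b)"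
      proof -
        have "g s = s * t powr (-2) * E powr (-1)"
          using t E by (simp add: g_def DE powr_minus powr_numeral divide_simps)
        also have "\<dots> powr (b - 1) = s powr (b - 1) * t powr (- 2 * b + 2) * E powr (1 - b)"
        proof -
          have "(s * t powr (-2) * E powr (-1)) powr (b - 1)
            = s powr (b - 1) * (t powr (-2)) powr (b - 1) * (E powr (-1)) powr (b - 1)"
            using True powr_ge_zero[of t "-2"] powr_ge_zero[of E "-1"] by (metis atLeastAtMost_iff mult_nonneg_nonneg powr_mult)
          then show ?thesis unfolding powr_powr by (simp add: algebra_simps)
        qed
        finally show ?thesis .
      qed
      have 4: "(1 - g s) powr (d - 1) = (1 - s) powr (d - 1) * E powr (1 - d)"
        unfolding 1 using True E by (simp add: powr_divide powr_diff powr_minus field_simps)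
      have 5: "(1 - (1 - t\<^sup>2) * g s) powr (- a) = E powr a"
        unfolding 2 using E by (simp add: powr_divide powr_minus)
      have 6: "g' s = t powr (-2) * E powr (-2)"
        using t E by (simp add: g'_def DE powr_minus powr_numeral power2_eq_square divide_simps)
      have "?f (g s) * g' s = s powr (b - 1) * (1 - s) powr (d - 1) *
          (t powr (- 2 * b + 2) * t powr (-2)) * (E powr (1 - b) * E powr (1 - d) * E powr a * E powr (-2))"
        unfolding 3 4 5 6 by (simp only: mult_ac)
      also have "\<dots> = s powr (b - 1) * (1 - s) powr (d - 1) * t powr (- 2 * b) * E powr (- (b + d - a))"
        by (simp flip: powr_add) (simp add: algebra_simps)
      finally show ?thesis using True by (simp add: euler_weight_def E_def)
    qed (simp add: euler_weight_eq_0)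
  qed simp
  finally show ?thesis unfolding euler_integral_real_def f_eq by simp
qed

text \<open>The series breaks off after its constant term. This covers \<open>f_fun\<close> with
  \<beta> = 2, whose parameters 0 and 2 are both outside the open interval from 0 to c when the
  dimension is at most 2.\<close>

lemma hypergeo_2F1_0:
  fixes b c :: real
  assumes "z \<in> slit_plane"
  shows "hypergeo_2F1 (of_real 0) (of_real b) (of_real c) z = 1"
proof (rule hypergeo_2F1_unique[OF _ _ assms])
  fix z :: complex
  have "(\<Sum>k. complex_of_real (pochhammer 0 k * pochhammer b k / (pochhammer c k * fact k)) * z ^ k)
     = (\<Sum>k\<in>{0}. complex_of_real (pochhammer 0 k * pochhammer b k / (pochhammer c k * fact k)) * z ^ k)"
    by (intro suminf_finite) (auto simp: pochhammer_0_left)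
  then show "1 = eval_fps (fps_hypergeo [complex_of_real 0, complex_of_real b] [complex_of_real c] 1) z"
    unfolding eval_fps_hypergeo_sums by simp
qed auto

lemma hypergeo_2F1_real_0: "x < 1 \<Longrightarrow> hypergeo_2F1_real 0 b c x = 1"
proof -
  assume "x < 1"
  then have "complex_of_real x \<in> slit_plane" by auto
  from hypergeo_2F1_0[OF this, of b c] show ?thesis by (simp add: hypergeo_2F1_real_def)
qed

text \<open>The left side is the series of F(a, c - b; c; 1 - 1/t^2), which converges for all t > 1,
  whereas 1 - t^2 leaves the unit disc. If 0 < a < c, the Moebius substitution keeps
  \<open>a\<close> as the parameter of the Beta weight; if 0 < b < c, reflection turns
  \<open>b\<close> into c - b. For a = 0 both sides are 1.\<close>

lemma hypergeo_2F1_real_pfaff: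
  assumes t: "1 < t" and ab: "a = 0 \<or> 0 < a \<and> a < c \<or> 0 < b \<and> b < c"
  shows "(\<lambda>k. pochhammer a k * pochhammer (c - b) k / (pochhammer c k * fact k) * (1 - 1 / t\<^sup>2) ^ k)
    sums (t powr (2 * a) * hypergeo_2F1_real a b c (1 - t\<^sup>2))"
proof -
  have x: "1 - t\<^sup>2 < 1" using t by simp
  have "t\<^sup>2 > 1" using t by (simp add: one_less_power)
  then have "0 < 1 / t\<^sup>2" "1 / t\<^sup>2 < 1" by (auto simp: divide_simps)
  then have y: "\<bar>1 - 1 / t\<^sup>2\<bar> < 1" by linarith
  have tt: "t powr (2 * a) * (t powr (- 2 * a) * z) = z" for z
    using t by (simp add: powr_minus)
  have scale: "(\<lambda>k. p k * y ^ k) sums z"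
    if "(\<lambda>k. Bt * p k * y ^ k) sums (Bt * z)" "Bt > 0" for p y z and Bt :: real
    using sums_mult[OF that(1), of "1 / Bt"] that(2) by simp
  consider "a = 0" | "0 < a" "a < c" | "0 < b" "b < c" using ab by auto
  then show ?thesis
  proof cases
    case 1
    have "(\<lambda>k. pochhammer 0 k * pochhammer (c - b) k / (pochhammer c k * fact k) * (1 - 1 / t\<^sup>2) ^ k) sums
      (\<Sum>k\<in>{0}. pochhammer 0 k * pochhammer (c - b) k / (pochhammer c k * fact k) * (1 - 1 / t\<^sup>2) ^ k)"
      by (intro sums_finite) (auto simp: pochhammer_0_left)
    then show ?thesis using 1 t hypergeo_2F1_real_0[OF x] by simp
  next
    case 2
    have B: "Beta a (c - a) > 0" using Beta_real_pos 2 by simp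
    have eq: "t powr (2 * a) * hypergeo_2F1_real a b c (1 - t\<^sup>2)
       = euler_integral_real (c - b) a (c - a) (1 - 1 / t\<^sup>2) / Beta a (c - a)"
      using 2 tt euler_integral_real_moebius[OF t, of a "c - a" b]
      by (simp add: hypergeo_2F1_real_commute[of a] hypergeo_2F1_real_euler x)
    have "(\<lambda>k. Beta a (c - a) * (pochhammer a k * pochhammer (c - b) k / (pochhammer c k * fact k)) * (1 - 1 / t\<^sup>2) ^ k)
       sums (Beta a (c - a) * (euler_integral_real (c - b) a (c - a) (1 - 1 / t\<^sup>2) / Beta a (c - a)))"
      using euler_integral_real_sums[of a "c - a" "1 - 1 / t\<^sup>2" "c - b"] 2 y B by (simp add: mult.commute)
    from scale[OF this B] show ?thesis unfolding eq .
  next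
    case 3
    have B: "Beta (c - b) b > 0" using Beta_real_pos 3 by simp
    have eq: "t powr (2 * a) * hypergeo_2F1_real a b c (1 - t\<^sup>2)
       = euler_integral_real a (c - b) b (1 - 1 / t\<^sup>2) / Beta (c - b) b"
      using 3 t tt euler_integral_real_reflect[of t a b "c - b"]
      by (simp add: hypergeo_2F1_real_euler x Beta_commute)
    have "(\<lambda>k. Beta (c - b) b * (pochhammer a k * pochhammer (c - b) k / (pochhammer c k * fact k)) * (1 - 1 / t\<^sup>2) ^ k)
       sums (Beta (c - b) b * (euler_integral_real a (c - b) b (1 - 1 / t\<^sup>2) / Beta (c - b) b))"
      using euler_integral_real_sums[of "c - b" b "1 - 1 / t\<^sup>2" a] 3 y B by simp
    from scale[OF this B] show ?thesis unfolding eq .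
  qed
qed

lemma hypergeo_2F1_holomorphic:
  fixes a b c :: real
  assumes "a = 0 \<or> 0 < a \<and> a < c \<or> 0 < b \<and> b < c"
  shows "hypergeo_2F1 (of_real a) (of_real b) (of_real c) holomorphic_on slit_plane"
proof -
  have *: "hypergeo_2F1 (of_real a) (of_real b) (of_real c) holomorphic_on slit_plane" if b: "0 < b" "b < c" for a b :: real
  proof -
    have "(\<lambda>z. euler_integral a b (c - b) z / complex_of_real (Beta b (c - b))) holomorphic_on slit_plane"
      using euler_integral_holomorphic[of b "c - b" a] b Beta_real_pos[of b "c - b"] by (intro holomorphic_intros) auto
    then show ?thesis by (rule holomorphic_transform) (simp add: hypergeo_2F1_euler[OF b])
  qed
  consider "a = 0" | "0 < a" "a < c" | "0 < b" "b < c" using assms by auto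
  then show ?thesis
  proof cases
    case 1
    have "(\<lambda>z. 1) holomorphic_on slit_plane" by simp
    then show ?thesis
      by (rule holomorphic_transform) (simp only: 1 hypergeo_2F1_0)
  next
    case 2
    then show ?thesis using *[of a b] by (simp only: hypergeo_2F1_commute)
  next
    case 3
    then show ?thesis by (rule *)
  qed
qed

lemma hypergeo_2F1_real_continuous:
  fixes a b c :: real
  assumes "a = 0 \<or> 0 < a \<and> a < c \<or> 0 < b \<and> b < c"
  shows "continuous_on {..<1} (hypergeo_2F1_real a b c)"
  unfolding hypergeo_2F1_real_def[abs_def]
  by (intro continuous_intros continuous_on_compose2[OF holomorphic_on_imp_continuous_on[OF hypergeo_2F1_holomorphic[OF assms]]])
     auto

section \<open>Pizzetti expansion of ball integrals\<close>

lemma lborel_integral_translate: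
  fixes f :: "'a::euclidean_space \<Rightarrow> real"
  assumes [measurable]: "f \<in> borel_measurable borel"
  shows "(LBINT y. f (y + v)) = (LBINT y. f y)"
proof -
  have "(LBINT y. f y) = (\<integral>y. f y \<partial>(distr lborel borel ((+) v)))"
    by (simp only: lborel_distr_plus)
  also have "\<dots> = (LBINT y. f (v + y))" by (subst integral_distr) auto
  finally show ?thesis by (simp add: add.commute)
qed

text \<open>The unit sphere is exceptional in two places: truncated functions need not be
  differentiable on it, and open and closed balls differ by it.\<close>

lemma AE_not_in_sphere:
  "AE y in lborel. y \<notin> sphere (c::'a::euclidean_space) r"
proof -
  have "sphere c r \<in> null_sets lebesgue"
    using negligible_sphere[of c r] by (simp add: negligible_iff_null_sets)
  then have "sphere c r \<in> null_sets lborel"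
    by (subst (asm) null_sets_completion_iff) auto
  then show ?thesis by (rule AE_not_in)
qed

section \<open>Integration by parts against powers of a bump function\<close>

text \<open>The normalization makes the gradient equal to -y. Hence \<open>bump y ^ j\<close> times
  y is minus the gradient of \<open>bump y ^ Suc j / Suc j\<close>, and that power vanishes on the
  unit sphere.\<close>

definition bump :: "'a::euclidean_space \<Rightarrow> real" where
  "bump y = (1 - (norm y)\<^sup>2) / 2"

lemma bump_continuous [continuous_intros]: "continuous_on S bump"
  unfolding bump_def[abs_def] by (intro continuous_intros) auto

lemma bump_measurable [measurable]: "bump \<in> borel_measurable borel"
  by (intro borel_measurable_continuous_onI bump_continuous)

lemma bump_pos: "y \<in> ball 0 1 \<Longrightarrow> 0 < bump y"
  by (simp add: bump_def power_less_one_iff)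

lemma bump_le: "bump y \<le> 1 / 2"
  by (simp add: bump_def)

lemma bump_nonpos: "1 \<le> norm y \<Longrightarrow> bump y \<le> 0"
  by (simp add: bump_def)

text \<open>For |y| < 1 and r = min 1 |z| the difference factors as (r - |y|) (r + |y|) / 2, where
  the second factor is at most 1 and the first is at most |z| - |y|.\<close>

lemma bump_lipschitz: "\<bar>max 0 (bump y) - max 0 (bump z)\<bar> \<le> norm (y - z)"
proof -
  have *: "max 0 (bump y) - max 0 (bump z) \<le> norm (y - z)" for y z :: 'a
  proof (cases "norm y < 1")
    case True
    define r where "r = min 1 (norm z)"
    have r: "r \<le> 1" "r \<ge> 0" by (auto simp: r_def)
    have "max 0 (bump z) = (1 - r\<^sup>2) / 2"
    proof (cases "norm z \<le> 1")
      case True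
      then have "(norm z)\<^sup>2 \<le> 1" by (simp add: power_le_one)
      then show ?thesis using True by (simp add: r_def bump_def)
    next
      case False
      then show ?thesis using bump_nonpos[of z] by (simp add: r_def)
    qed
    moreover have "max 0 (bump y) = (1 - (norm y)\<^sup>2) / 2"
      using bump_pos[of y] True by (simp add: bump_def)
    moreover have "(1 - (norm y)\<^sup>2) / 2 - (1 - r\<^sup>2) / 2 = (r - norm y) * ((r + norm y) / 2)"
      by (simp add: power2_eq_square field_simps)
    moreover have "(r - norm y) * ((r + norm y) / 2) \<le> norm (y - z)"
    proof (cases "norm y \<le> r")
      case True
      have "(r - norm y) * ((r + norm y) / 2) \<le> (r - norm y) * 1"
        using True r \<open>norm y < 1\<close> by (intro mult_left_mono) auto
      also have "\<dots> \<le> norm z - norm y" by (simp add: r_def)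
      also have "\<dots> \<le> norm (y - z)" by (metis norm_minus_commute norm_triangle_ineq2)
      finally show ?thesis .
    next
      case False
      then have "(r - norm y) * ((r + norm y) / 2) \<le> 0" using r by (intro mult_nonpos_nonneg) auto
      then show ?thesis by (rule order_trans) simp
    qed
    ultimately show ?thesis by linarith
  next
    case False
    then have "max 0 (bump y) = 0" using bump_nonpos[of y] by simp
    then show ?thesis by (metis add_increasing2 diff_le_eq max.cobounded1 norm_ge_zero order_trans)
  qed
  show ?thesis using *[of y z] *[of z y] by (simp add: abs_le_iff norm_minus_commute)
qed

lemma set_integrable_ball_continuous:
  fixes f :: "'a::euclidean_space \<Rightarrow> real"
  assumes "continuous_on (cball c r) f"
  shows "set_integrable lborel (ball c r) f"
proof (rule set_integrable_subset)
  show "set_integrable lborel (cball c r) f"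
    unfolding set_integrable_def by (rule borel_integrable_compact[OF compact_cball assms])
qed auto

text \<open>Integration by parts in the direction \<open>e\<close>: the integral of the \<open>e\<close>-derivative of a
  compactly supported Lipschitz function vanishes, by translation invariance and dominated convergence.\<close>

lemma ball_integration_by_parts:
  fixes g D :: "'a::euclidean_space \<Rightarrow> real"
  assumes r: "1 < r" and e: "norm e = 1"
    and der: "\<And>y. y \<in> ball 0 r \<Longrightarrow> ((\<lambda>s. g (y + s *\<^sub>R e)) has_real_derivative D y) (at 0)"
    and cg: "continuous_on (ball 0 r) g" and cD: "continuous_on (ball 0 r) D"
  shows "(LINT y:ball 0 1|lborel. bump y ^ j * (y \<bullet> e) * g y)
     = (LINT y:ball 0 1|lborel. bump y ^ Suc j * D y) / real (Suc j)"
proof -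
  define m where "m = Suc j"
  \<comment> \<open>An intermediate radius: \<open>g\<close> and \<open>D\<close> are bounded on the
    closed ball of radius \<open>r'\<close>, which leaves room for translates by up to
    \<open>r' - 1\<close>.\<close>
  define r' where "r' = (1 + r) / 2"
  have r': "1 < r'" "r' < r" using r by (auto simp: r'_def)
  have bd: "\<exists>C. \<forall>y\<in>cball 0 r'. \<bar>h y\<bar> \<le> C" if "continuous_on (ball 0 r) h" for h :: "'a \<Rightarrow> real"
  proof -
    have "continuous_on (cball 0 r') h" using that r' by (rule_tac continuous_on_subset) auto
    then have "bounded (h ` cball 0 r')" by (intro compact_imp_bounded compact_continuous_image compact_cball)
    then show ?thesis by (auto simp: bounded_iff)
  qed
  obtain Cg where Cg: "\<And>y. y \<in> cball 0 r' \<Longrightarrow> \<bar>g y\<bar> \<le> Cg" using bd[OF cg] by blast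
  obtain CD where CD: "\<And>y. y \<in> cball 0 r' \<Longrightarrow> \<bar>D y\<bar> \<le> CD" using bd[OF cD] by blast
  have C0: "0 \<le> Cg" "0 \<le> CD" using Cg[of 0] CD[of 0] r' by auto
  \<comment> \<open>The positive part makes the cut-off globally Lipschitz. As \<open>m\<close> is
    at least 1, the power vanishes outside the open ball, so \<open>G\<close> has no jump at the
    sphere.\<close>
  define \<psi> where "\<psi> y = max 0 (bump y) ^ m" for y :: 'a
  define G where "G y = indicator (ball 0 1) y * (bump y ^ m * g y)" for y
  have Geq: "G y = \<psi> y * g y" for y
    using bump_pos[of y] bump_nonpos[of y] by (auto simp: G_def \<psi>_def m_def indicator_def)
  have \<psi>0: "\<psi> y = 0" if "1 \<le> norm y" for y
    using bump_nonpos[OF that] by (simp add: \<psi>_def m_def)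
  have mb: "norm (max 0 (bump y)) \<le> 1" for y :: 'a using bump_le[of y] by auto
  have \<psi>lip: "\<bar>\<psi> y - \<psi> z\<bar> \<le> real m * norm (y - z)" for y z
  proof -
    have "norm (\<psi> y - \<psi> z) \<le> real m * norm (max 0 (bump y) - max 0 (bump z))"
      unfolding \<psi>_def by (rule norm_power_diff[OF mb mb])
    also have "\<dots> \<le> real m * norm (y - z)" using bump_lipschitz by (intro mult_left_mono) auto
    finally show ?thesis by simp
  qed
  have \<psi>1: "\<bar>\<psi> y\<bar> \<le> 1" for y using mb[of y] by (simp add: \<psi>_def power_le_one abs_le_iff)
  have der_at: "((\<lambda>s. g (y + s *\<^sub>R e)) has_real_derivative D (y + s *\<^sub>R e)) (at s)"
    if "y + s *\<^sub>R e \<in> ball 0 r" for y s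
    using DERIV_shift[of "\<lambda>u. g (y + u *\<^sub>R e)" "D (y + s *\<^sub>R e)" 0 s] der[OF that]
    by (simp add: algebra_simps)
  have glip: "\<bar>g (y + h *\<^sub>R e) - g y\<bar> \<le> CD * \<bar>h\<bar>" if "y \<in> cball 0 r'" "y + h *\<^sub>R e \<in> cball 0 r'" for y h
  proof -
    have seg: "y + s *\<^sub>R e \<in> cball 0 r'" if "s \<in> closed_segment 0 h" for s
    proof -
      obtain u where u: "0 \<le> u" "u \<le> 1" "s = u * h" using \<open>s \<in> _\<close> by (auto simp: closed_segment_def)
      have "(1 - u) *\<^sub>R y + u *\<^sub>R (y + h *\<^sub>R e) \<in> cball 0 r'"
        using u \<open>y \<in> _\<close> \<open>y + h *\<^sub>R e \<in> _\<close> by (intro convexD[OF convex_cball]) auto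
      moreover have "(1 - u) *\<^sub>R y + u *\<^sub>R (y + h *\<^sub>R e) = y + s *\<^sub>R e" by (simp add: u algebra_simps)
      ultimately show ?thesis by simp
    qed
    have "norm (g (y + h *\<^sub>R e) - g (y + 0 *\<^sub>R e)) \<le> CD * norm (h - 0)"
    proof (rule field_differentiable_bound[of "closed_segment 0 h"])
      fix s assume s: "s \<in> closed_segment 0 h"
      have "y + s *\<^sub>R e \<in> ball 0 r" using seg[OF s] r' by auto
      from der_at[OF this] show "((\<lambda>s. g (y + s *\<^sub>R e)) has_real_derivative D (y + s *\<^sub>R e)) (at s within closed_segment 0 h)"
        by (rule has_field_derivative_at_within)
      show "norm (D (y + s *\<^sub>R e)) \<le> CD" using CD[OF seg[OF s]] by simp
    qed auto
    then show ?thesis by simp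
  qed
  \<comment> \<open>The Lipschitz constant of the product: |\<psi>| \<le> 1 times that of
    \<open>g\<close>, plus the bound for \<open>g\<close> times the constant \<open>m\<close> of
    \<psi>.\<close>
  define L where "L = CD + Cg * real m"
  have Llip: "\<bar>G (y + h *\<^sub>R e) - G y\<bar> \<le> L * \<bar>h\<bar> * indicator (cball 0 2) y"
    if h: "\<bar>h\<bar> \<le> r' - 1" "\<bar>h\<bar> \<le> 1" for y h
  proof (cases "norm y < 1 \<or> norm (y + h *\<^sub>R e) < 1")
    case True
    have hh: "norm (h *\<^sub>R e) = \<bar>h\<bar>" using e by simp
    have y: "norm y < 1 + \<bar>h\<bar>" "norm (y + h *\<^sub>R e) < 1 + \<bar>h\<bar>"
      using True norm_triangle_ineq4[of "y + h *\<^sub>R e" "h *\<^sub>R e"] norm_triangle_ineq[of y "h *\<^sub>R e"] hh by auto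
    then have yb: "y \<in> cball 0 r'" "y + h *\<^sub>R e \<in> cball 0 r'" and y2: "y \<in> cball 0 2" using h by auto
    have "G (y + h *\<^sub>R e) - G y = \<psi> (y + h *\<^sub>R e) * (g (y + h *\<^sub>R e) - g y) + g y * (\<psi> (y + h *\<^sub>R e) - \<psi> y)"
      unfolding Geq by (simp add: algebra_simps)
    also have "\<bar>\<dots>\<bar> \<le> \<bar>\<psi> (y + h *\<^sub>R e)\<bar> * \<bar>g (y + h *\<^sub>R e) - g y\<bar> + \<bar>g y\<bar> * \<bar>\<psi> (y + h *\<^sub>R e) - \<psi> y\<bar>"
      by (metis abs_mult abs_triangle_ineq)
    also have "\<dots> \<le> 1 * (CD * \<bar>h\<bar>) + Cg * (real m * \<bar>h\<bar>)"
      using \<psi>lip[of "y + h *\<^sub>R e" y] hh C0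
      by (intro add_mono mult_mono \<psi>1 glip Cg yb) auto
    finally show ?thesis using y2 by (simp add: L_def algebra_simps)
  next
    case False
    then have "G (y + h *\<^sub>R e) - G y = 0" using \<psi>0 by (simp add: Geq)
    then show ?thesis using C0 by (simp add: L_def)
  qed
  have cG: "continuous_on (cball 0 1) (\<lambda>y. bump y ^ m * g y)"
    using r by (intro continuous_intros continuous_on_subset[OF cg]) auto
  have Gint: "integrable lborel G"
    using set_integrable_ball_continuous[OF cG] by (simp add: set_integrable_def G_def[abs_def])
  then have [measurable]: "G \<in> borel_measurable borel" by auto
  \<comment> \<open>Step sizes tending to 0, all small enough for \<open>Llip\<close>.\<close>
  define X where "X i = min (r' - 1) 1 / real (Suc i)" for i
  have X: "X i > 0" "X i \<le> r' - 1" "X i \<le> 1" for i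
  proof -
    define M where "M = min (r' - 1) 1"
    have M: "M > 0" using r' by (simp add: M_def)
    then have "M / real (Suc i) \<le> M" by (simp add: divide_le_eq)
    then show "X i \<le> r' - 1" "X i \<le> 1" by (auto simp: X_def M_def)
    show "X i > 0" using M by (simp add: X_def M_def)
  qed
  have Xlim: "X \<longlonglongrightarrow> 0"
    unfolding X_def by (rule LIMSEQ_Suc[OF lim_const_over_n, unfolded o_def])
  \<comment> \<open>The derivative of \<open>G\<close> along \<open>e\<close> off the sphere. Once
    its integral is known to be 0, its two terms are the two sides of the claim.\<close>
  define E where "E y = indicator (ball 0 1) y * (bump y ^ m * D y - real m * bump y ^ j * (y \<bullet> e) * g y)" for y
  have c1: "continuous_on (cball 0 1) (\<lambda>y. bump y ^ m * D y)"
    using r by (intro continuous_intros continuous_on_subset[OF cD]) auto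
  have c2: "continuous_on (cball 0 1) (\<lambda>y. real m * bump y ^ j * (y \<bullet> e) * g y)"
    using r by (intro continuous_intros continuous_on_subset[OF cg]) auto
  note i1 = set_integrable_ball_continuous[OF c1] and i2 = set_integrable_ball_continuous[OF c2]
  have Ediff: "E y = indicator (ball 0 1) y *\<^sub>R (bump y ^ m * D y) - indicator (ball 0 1) y *\<^sub>R (real m * bump y ^ j * (y \<bullet> e) * g y)" for y
    by (simp add: E_def algebra_simps)
  have Eint: "integrable lborel E"
    unfolding Ediff using i1 i2 unfolding set_integrable_def by (rule Bochner_Integration.integrable_diff)
  have "(\<lambda>i. LBINT y. (G (y + X i *\<^sub>R e) - G y) / X i) \<longlonglongrightarrow> (LBINT y. E y)"
  proof (rule integral_dominated_convergence[where w="\<lambda>y. L * indicator (cball 0 2) y"])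
    show "AE y in lborel. norm ((G (y + X i *\<^sub>R e) - G y) / X i) \<le> L * indicator (cball 0 2) y" for i
    proof (rule AE_I2)
      fix y
      show "norm ((G (y + X i *\<^sub>R e) - G y) / X i) \<le> L * indicator (cball 0 2) y"
        using Llip[of "X i" y] X[of i] by (simp add: abs_mult divide_le_eq mult_ac)
    qed
    have "integrable lborel (\<lambda>y. indicator (cball (0::'a) 2) y :: real)"
      using emeasure_compact_finite[OF compact_cball, of "0::'a" 2] by (intro integrable_real_indicator) (auto simp: less_top)
    then show "integrable lborel (\<lambda>y::'a. L * indicator (cball 0 2) y)" by simp
    show "AE y in lborel. (\<lambda>i. (G (y + X i *\<^sub>R e) - G y) / X i) \<longlonglongrightarrow> E y"
      using AE_not_in_sphere[of 0 1]
    proof eventually_elim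
      case (elim y)
      have "((\<lambda>s. G (y + s *\<^sub>R e)) has_real_derivative E y) (at 0)"
      proof (cases "norm y < 1")
        case True
        have 1: "((\<lambda>s. bump (y + s *\<^sub>R e) ^ m * g (y + s *\<^sub>R e)) has_real_derivative
          (bump y ^ m * D y - real m * bump y ^ j * (y \<bullet> e) * g y)) (at 0)"
        proof -
          have "((\<lambda>s. bump (y + s *\<^sub>R e)) has_real_derivative - (y \<bullet> e)) (at 0)"
            unfolding bump_def power2_norm_eq_inner
            by (auto intro!: derivative_eq_intros simp: inner_commute inner_add_left inner_add_right)
          then have 1: "((\<lambda>s. bump (y + s *\<^sub>R e) ^ m) has_real_derivative - (real m * bump y ^ j * (y \<bullet> e))) (at 0)"
            by (rule DERIV_power[THEN DERIV_cong]) (simp add: m_def)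
          have 2: "((\<lambda>s. g (y + s *\<^sub>R e)) has_real_derivative D y) (at 0)"
            using True r by (intro der) simp
          show ?thesis by (rule DERIV_mult[OF 1 2, THEN DERIV_cong]) (simp add: algebra_simps)
        qed
        have "\<forall>\<^sub>F s in at 0. y + s *\<^sub>R e \<in> ball 0 1"
        proof (rule topological_tendstoD)
          show "((\<lambda>s. y + s *\<^sub>R e) \<longlongrightarrow> y) (at 0)" by (auto intro!: tendsto_eq_intros)
        qed (use True in auto)
        then have "\<forall>\<^sub>F s in nhds 0. G (y + s *\<^sub>R e) = bump (y + s *\<^sub>R e) ^ m * g (y + s *\<^sub>R e)"
          unfolding eventually_at_filter
          by eventually_elim (use True in \<open>auto simp: G_def\<close>)
        then show ?thesis using 1 True by (subst DERIV_cong_ev[OF refl _ refl]) (auto simp: E_def)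
      next
        case False
        then have ny: "norm y > 1" using elim by auto
        have "\<forall>\<^sub>F s in at 0. y + s *\<^sub>R e \<in> - cball 0 1"
        proof (rule topological_tendstoD)
          show "((\<lambda>s. y + s *\<^sub>R e) \<longlongrightarrow> y) (at 0)" by (auto intro!: tendsto_eq_intros)
        qed (use ny in auto)
        then have "\<forall>\<^sub>F s in nhds 0. G (y + s *\<^sub>R e) = 0"
          unfolding eventually_at_filter
          by eventually_elim (use ny in \<open>auto simp: G_def indicator_def\<close>)
        then show ?thesis using ny by (subst DERIV_cong_ev[OF refl _ refl]) (auto simp: E_def)
      qed
      then have "((\<lambda>s. (G (y + s *\<^sub>R e) - G y) / s) \<longlongrightarrow> E y) (at 0)"
        by (simp add: DERIV_def)
      moreover have "X i \<noteq> 0" for i using X(1)[of i] by simp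
      ultimately show ?case unfolding tendsto_at_iff_sequentially comp_def using Xlim by auto
    qed
  qed (use Eint in auto)
  moreover have "(LBINT y. (G (y + X i *\<^sub>R e) - G y) / X i) = 0" for i
  proof -
    have m: "(+) (X i *\<^sub>R e) \<in> measurable lborel borel" by simp
    have "integrable lborel (\<lambda>y. G (X i *\<^sub>R e + y))"
      by (rule integrable_distr[OF m]) (simp only: lborel_distr_plus Gint)
    then have "(LBINT y. (G (y + X i *\<^sub>R e) - G y)) = (LBINT y. G (y + X i *\<^sub>R e)) - (LBINT y. G y)"
      using Gint by (intro Bochner_Integration.integral_diff) (simp_all add: add.commute)
    then show ?thesis by (simp add: lborel_integral_translate)
  qed
  ultimately have "(\<lambda>i. 0) \<longlonglongrightarrow> (LBINT y. E y)" by (simp only:)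
  then have "(LBINT y. E y) = 0" using LIMSEQ_unique[of "\<lambda>_. 0" "LBINT y. E y" 0] by simp
  moreover have "(LBINT y. E y) = (LINT y:ball 0 1|lborel. bump y ^ m * D y)
       - (LINT y:ball 0 1|lborel. real m * bump y ^ j * (y \<bullet> e) * g y)"
    unfolding Ediff using i1 i2 unfolding set_integrable_def set_lebesgue_integral_def
    by (rule Bochner_Integration.integral_diff)
  moreover have "(LINT y:ball 0 1|lborel. real m * bump y ^ j * (y \<bullet> e) * g y)
     = real m * (LINT y:ball 0 1|lborel. bump y ^ j * (y \<bullet> e) * g y)"
    unfolding set_integral_mult_right[symmetric] by (simp add: mult.assoc)
  ultimately show ?thesis by (simp add: m_def field_simps)
qed

section \<open>Homogeneous functions and their Laplacians\<close>

text \<open>One family for both functionals: \<delta> = 1, a = 0 gives |x|^p, and \<delta> = 0, a =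
  e gives (e . x) |x|^p. The recurring hypothesis
  \<open>a \<bullet> x = d * (\<delta> + a \<bullet> x)\<close> is Euler's relation for homogeneity
  of degree \<open>d\<close>, with d = 0 and d = 1 respectively.\<close>

definition affine_powr :: "real \<Rightarrow> 'a::euclidean_space \<Rightarrow> real \<Rightarrow> 'a \<Rightarrow> real" where
  "affine_powr \<delta> a p x = (\<delta> + a \<bullet> x) * norm x powr p"

definition affine_powr_grad :: "real \<Rightarrow> 'a::euclidean_space \<Rightarrow> real \<Rightarrow> 'a \<Rightarrow> 'a \<Rightarrow> real" where
  "affine_powr_grad \<delta> a p v x =
     (a \<bullet> v) * norm x powr p + p * (\<delta> + a \<bullet> x) * norm x powr (p - 2) * (x \<bullet> v)"

definition affine_powr_hess :: "real \<Rightarrow> 'a::euclidean_space \<Rightarrow> real \<Rightarrow> 'a \<Rightarrow> 'a \<Rightarrow> real" where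
  "affine_powr_hess \<delta> a p v x =
     2 * p * (a \<bullet> v) * norm x powr (p - 2) * (x \<bullet> v) + p * (\<delta> + a \<bullet> x) * norm x powr (p - 2) * (v \<bullet> v)
     + p * (p - 2) * (\<delta> + a \<bullet> x) * norm x powr (p - 4) * (x \<bullet> v)\<^sup>2"

lemma norm_powr_line_derivative:
  assumes "x \<noteq> (0::'a::euclidean_space)"
  shows "((\<lambda>s. norm (x + s *\<^sub>R v) powr p) has_real_derivative p * norm x powr (p - 2) * (x \<bullet> v)) (at 0)"
proof -
  have pos: "(x + s *\<^sub>R v) \<bullet> (x + s *\<^sub>R v) \<ge> 0" for s by simp
  have eq: "norm y powr q = (y \<bullet> y) powr (q / 2)" for y :: 'a and q
    by (simp add: norm_eq_sqrt_inner powr_half_sqrt[symmetric] powr_powr)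
  have e2: "(p - 2) / 2 = p / 2 - 1" by simp
  have x: "x \<bullet> x > 0" using assms by simp
  show ?thesis unfolding eq e2
    using x by (auto intro!: derivative_eq_intros simp: inner_commute inner_add_left inner_add_right algebra_simps)
qed

lemma affine_powr_derivative:
  assumes "x \<noteq> (0::'a::euclidean_space)"
  shows "((\<lambda>s. affine_powr \<delta> a p (x + s *\<^sub>R v)) has_real_derivative affine_powr_grad \<delta> a p v x) (at 0)"
  unfolding affine_powr_def affine_powr_grad_def
  by (rule norm_powr_line_derivative[OF assms] derivative_eq_intros refl | simp add: inner_add_right algebra_simps)+

lemma affine_powr_grad_derivative:
  assumes "x \<noteq> (0::'a::euclidean_space)"
  shows "((\<lambda>s. affine_powr_grad \<delta> a p v (x + s *\<^sub>R v)) has_real_derivative affine_powr_hess \<delta> a p v x) (at 0)"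
proof -
  have e: "p - 2 - 2 = p - 4" by simp
  show ?thesis
  unfolding affine_powr_hess_def affine_powr_grad_def
  by (rule norm_powr_line_derivative[OF assms] derivative_eq_intros refl
     | simp add: inner_add_right inner_add_left algebra_simps power2_eq_square e)+
qed

lemma line_derivative_scaled:
  fixes h :: "'a::euclidean_space \<Rightarrow> real"
  assumes "((\<lambda>s. h (x + s *\<^sub>R v)) has_real_derivative D) (at 0)"
  shows "((\<lambda>s. h (x + (R * s) *\<^sub>R v)) has_real_derivative R * D) (at 0)"
proof -
  have "((\<lambda>s. R * s) has_real_derivative R) (at 0)" by (auto intro!: derivative_eq_intros)
  then show ?thesis
    using DERIV_chain2[of "\<lambda>s. h (x + s *\<^sub>R v)" D "\<lambda>s. R * s" 0 R UNIV] assms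
    by (simp add: mult.commute)
qed

text \<open>The sum over the basis is the Laplacian. The cross term contributes 2 d by Euler's
  relation, the term with \<open>b \<bullet> b\<close> the dimension, and the radial one p -
  2.\<close>

lemma sum_Basis_hess:
  fixes a x :: "'a::euclidean_space"
  assumes "x \<noteq> 0" "\<And>x. a \<bullet> x = d * (\<delta> + a \<bullet> x)"
  shows "(\<Sum>b\<in>Basis. affine_powr_hess \<delta> a p b x)
     = p * (p + DIM('a) - 2 + 2 * d) * affine_powr \<delta> a (p - 2) x"
proof -
  have 1: "(\<Sum>b\<in>Basis. (a \<bullet> b) * (x \<bullet> b)) = a \<bullet> x"
    by (simp add: euclidean_inner[of a x])
  have 2: "(\<Sum>b\<in>Basis. (x \<bullet> b)\<^sup>2) = norm x powr 2"
    using assms by (simp add: power2_eq_square euclidean_inner[of x x, symmetric] power2_norm_eq_inner[symmetric] powr_numeral)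
  have "(\<Sum>b\<in>Basis. affine_powr_hess \<delta> a p b x) = (\<Sum>b\<in>Basis. 2 * p * norm x powr (p - 2) * ((a \<bullet> b) * (x \<bullet> b))
     + p * (\<delta> + a \<bullet> x) * norm x powr (p - 2)
     + p * (p - 2) * (\<delta> + a \<bullet> x) * norm x powr (p - 4) * (x \<bullet> b)\<^sup>2)"
    unfolding affine_powr_hess_def by (intro sum.cong) (auto simp: algebra_simps)
  also have "\<dots> = 2 * p * norm x powr (p - 2) * (a \<bullet> x) + DIM('a) * (p * (\<delta> + a \<bullet> x) * norm x powr (p - 2))
     + p * (p - 2) * (\<delta> + a \<bullet> x) * (norm x powr (p - 4) * norm x powr 2)"
    by (simp add: sum.distrib sum_distrib_left[symmetric] 1 2 mult.assoc)
  also have "norm x powr (p - 4) * norm x powr 2 = norm x powr (p - 2)"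
    unfolding powr_add[symmetric] by simp
  also have "2 * p * norm x powr (p - 2) * (a \<bullet> x) = 2 * p * norm x powr (p - 2) * (d * (\<delta> + a \<bullet> x))"
    using assms(2)[of x] by simp
  finally show ?thesis by (simp add: affine_powr_def algebra_simps)
qed

text \<open>Splits a derivative whose direction varies with the point of integration into fixed
  directions, to which integration by parts applies.\<close>

lemma affine_powr_grad_Basis:
  "affine_powr_grad \<delta> a p y x = (\<Sum>b\<in>Basis. (y \<bullet> b) * affine_powr_grad \<delta> a p b x)"
proof -
  have 1: "(\<Sum>b\<in>Basis. (z \<bullet> b) * (y \<bullet> b)) = z \<bullet> y" for z :: 'a
    by (simp add: euclidean_inner[of z y])
  have "(\<Sum>b\<in>Basis. (y \<bullet> b) * affine_powr_grad \<delta> a p b x) = (\<Sum>b\<in>Basis. norm x powr p * ((a \<bullet> b) * (y \<bullet> b))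
      + p * (\<delta> + a \<bullet> x) * norm x powr (p - 2) * ((x \<bullet> b) * (y \<bullet> b)))"
    unfolding affine_powr_grad_def by (intro sum.cong) (auto simp: algebra_simps)
  also have "\<dots> = affine_powr_grad \<delta> a p y x"
    unfolding sum.distrib sum_distrib_left[symmetric] 1 by (simp add: affine_powr_grad_def)
  finally show ?thesis ..
qed

lemma shifted_nonzero:
  assumes "norm e = 1" "\<bar>R\<bar> < 1" "norm y \<le> 1"
  shows "e + R *\<^sub>R (y::'a::euclidean_space) \<noteq> 0"
proof
  assume "e + R *\<^sub>R y = 0"
  then have "norm e = norm (R *\<^sub>R y)" by (metis add_eq_0_iff norm_minus_cancel)
  also have "\<dots> = \<bar>R\<bar> * norm y" by simp
  also have "\<dots> \<le> \<bar>R\<bar>" using assms by (simp add: mult_left_le)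
  finally show False using assms by simp
qed

lemma affine_powr_continuous:
  assumes "continuous_on S f" "\<And>x. x \<in> S \<Longrightarrow> f x \<noteq> 0"
  shows "continuous_on S (\<lambda>x. affine_powr \<delta> a p (f x))"
  unfolding affine_powr_def using assms by (intro continuous_intros) auto

lemma affine_powr_grad_continuous:
  assumes "continuous_on S f" "continuous_on S g" "\<And>x. x \<in> S \<Longrightarrow> f x \<noteq> 0"
  shows "continuous_on S (\<lambda>x. affine_powr_grad \<delta> a p (g x) (f x))"
  unfolding affine_powr_grad_def using assms by (intro continuous_intros) auto

lemma affine_powr_hess_continuous:
  assumes "continuous_on S f" "\<And>x. x \<in> S \<Longrightarrow> f x \<noteq> 0"
  shows "continuous_on S (\<lambda>x. affine_powr_hess \<delta> a p v (f x))"
  unfolding affine_powr_hess_def using assms by (intro continuous_intros) auto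

section \<open>Moments and their expansion in the radius\<close>

definition bump_moment :: "real \<Rightarrow> 'a::euclidean_space \<Rightarrow> 'a \<Rightarrow> nat \<Rightarrow> real \<Rightarrow> real \<Rightarrow> real" where
  "bump_moment \<delta> a e j p R = (LINT y:ball 0 1|lborel. bump y ^ j * affine_powr \<delta> a p (e + R *\<^sub>R y))"

lemma bump_moment_integrable:
  assumes "norm e = 1" "\<bar>R\<bar> < 1"
  shows "set_integrable lborel (ball 0 1) (\<lambda>y. bump y ^ j * affine_powr \<delta> a p (e + R *\<^sub>R y))"
  by (intro set_integrable_ball_continuous continuous_intros affine_powr_continuous)
     (use shifted_nonzero[OF assms] in auto)

text \<open>Differentiation in R produces the derivative in direction y. Since y times the j-th
  power of the bump is minus a gradient, integrating by parts coordinate by coordinate replaces it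
  by R times the Laplacian, with one more power of the bump; the Laplacian lowers p by 2. The factor
  R shows that R^2/2 is the natural variable.\<close>

lemma bump_moment_derivative:
  fixes a e :: "'a::euclidean_space"
  assumes e: "norm e = 1" and R: "\<bar>R\<bar> < 1" and a: "\<And>x. a \<bullet> x = d * (\<delta> + a \<bullet> x)"
  shows "((bump_moment \<delta> a e j p) has_real_derivative
     R * (p * (p + DIM('a) - 2 + 2 * d)) / real (Suc j) * bump_moment \<delta> a e (Suc j) (p - 2) R) (at R)"
proof -
  \<comment> \<open>Half the distance to the ends of (-1, 1): on the compact interval
    \<open>K\<close> the points e + \<rho> y stay away from 0.\<close>
  define r where "r = (1 - \<bar>R\<bar>) / 2"
  have r: "r > 0" using R by (simp add: r_def)
  define K where "K = cball R r"
  have K1: "\<bar>\<rho>\<bar> < 1" if "\<rho> \<in> K" for \<rho> using that R by (auto simp: K_def r_def dist_real_def abs_if split: if_splits)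
  define f' where "f' \<rho> y = indicator (ball 0 1) y * (bump y ^ j * affine_powr_grad \<delta> a p y (e + \<rho> *\<^sub>R y))" for \<rho> and y :: 'a
  have nz: "e + \<rho> *\<^sub>R y \<noteq> 0" if "\<rho> \<in> K" "norm y \<le> 1" for \<rho> y
    using shifted_nonzero[OF e K1] that by auto
  have cont: "continuous_on (K \<times> cball 0 1) (\<lambda>p'. bump (snd p') ^ j * affine_powr_grad \<delta> a p (snd p') (e + fst p' *\<^sub>R snd p'))"
    by (intro continuous_intros affine_powr_grad_continuous continuous_on_compose2[OF bump_continuous[of UNIV]])
       (use nz in auto)
  have "compact (K \<times> cball (0::'a) 1)" unfolding K_def by (intro compact_Times compact_cball)
  then have "bounded ((\<lambda>p'. bump (snd p') ^ j * affine_powr_grad \<delta> a p (snd p') (e + fst p' *\<^sub>R snd p')) ` (K \<times> cball 0 1))"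
    using cont by (intro compact_imp_bounded compact_continuous_image)
  then obtain C where C: "\<And>\<rho> y. \<rho> \<in> K \<Longrightarrow> norm y \<le> 1 \<Longrightarrow> \<bar>bump y ^ j * affine_powr_grad \<delta> a p y (e + \<rho> *\<^sub>R y)\<bar> \<le> C"
    unfolding bounded_iff by force
  have main: "((\<lambda>\<rho>. LBINT y. indicator (ball 0 1) y * (bump y ^ j * affine_powr \<delta> a p (e + \<rho> *\<^sub>R y)))
     has_real_derivative (LBINT y. f' R y)) (at R)"
  proof (rule has_field_derivative_integral[OF r, where B="\<lambda>y. C * indicator (ball 0 1) y"])
    fix \<rho> assume "\<rho> \<in> ball R r"
    then have \<rho>: "\<rho> \<in> K" by (simp add: K_def)
    show "integrable lborel (\<lambda>y. indicator (ball 0 1) y * (bump y ^ j * affine_powr \<delta> a p (e + \<rho> *\<^sub>R y)))"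
      using bump_moment_integrable[OF e K1[OF \<rho>]] by (simp add: set_integrable_def)
    fix y :: 'a
    show "norm (f' \<rho> y) \<le> C * indicator (ball 0 1) y"
      using C[OF \<rho>, of y] by (auto simp: f'_def indicator_def)
    show "((\<lambda>\<rho>. indicator (ball 0 1) y * (bump y ^ j * affine_powr \<delta> a p (e + \<rho> *\<^sub>R y))) has_real_derivative f' \<rho> y) (at \<rho>)"
    proof (cases "y \<in> ball 0 1")
      case True
      have "((\<lambda>s. affine_powr \<delta> a p (e + \<rho> *\<^sub>R y + s *\<^sub>R y)) has_real_derivative affine_powr_grad \<delta> a p y (e + \<rho> *\<^sub>R y)) (at 0)"
        using True by (intro affine_powr_derivative nz \<rho>) auto
      then have "((\<lambda>s. affine_powr \<delta> a p (e + s *\<^sub>R y)) has_real_derivative affine_powr_grad \<delta> a p y (e + \<rho> *\<^sub>R y)) (at \<rho>)"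
        using DERIV_shift[of "\<lambda>s. affine_powr \<delta> a p (e + s *\<^sub>R y)" _ 0 \<rho>] by (simp add: algebra_simps)
      then show ?thesis using True unfolding f'_def by (auto intro!: derivative_eq_intros)
    qed (simp add: f'_def)
  next
    have c: "continuous_on (cball 0 1) (\<lambda>y. bump y ^ j * affine_powr_grad \<delta> a p y (e + R *\<^sub>R y))"
      using shifted_nonzero[OF e R] by (intro continuous_intros affine_powr_grad_continuous) auto
    show "f' R \<in> borel_measurable lborel"
      using set_integrable_ball_continuous[OF c] unfolding f'_def[abs_def] set_integrable_def by auto
    have "integrable lborel (\<lambda>y. indicator (ball (0::'a) 1) y :: real)"
      using emeasure_lborel_ball_finite[of "0::'a" 1] by (intro integrable_real_indicator) auto
    then show "integrable lborel (\<lambda>y::'a. C * indicator (ball 0 1) y)" by simp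
  qed
  define g where "g b y = affine_powr_grad \<delta> a p b (e + R *\<^sub>R y)" for b y
  define D where "D b y = R * affine_powr_hess \<delta> a p b (e + R *\<^sub>R y)" for b y
  \<comment> \<open>Any radius above 1 with |R| \<open>r1\<close> < 1 would do; it provides the
    neighbourhood of the closed unit ball that \<open>ball_integration_by_parts\<close> asks
    for.\<close>
  define r1 where "r1 = 2 / (1 + \<bar>R\<bar>)"
  have r1: "1 < r1" using R by (simp add: r1_def)
  have nz1: "e + R *\<^sub>R y \<noteq> 0" if "norm y < r1" for y
  proof -
    have "\<bar>R\<bar> * r1 < 1" using R by (simp add: r1_def divide_simps)
    have "norm ((1 / r1) *\<^sub>R y) \<le> 1" using that r1 by simp
    moreover have "\<bar>R * r1\<bar> < 1" using \<open>\<bar>R\<bar> * r1 < 1\<close> r1 by (simp add: abs_mult)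
    ultimately have "e + (R * r1) *\<^sub>R ((1 / r1) *\<^sub>R y) \<noteq> 0" by (intro shifted_nonzero e)
    then show ?thesis using r1 by simp
  qed
  have ibp: "(LINT y:ball 0 1|lborel. bump y ^ j * (y \<bullet> b) * g b y)
     = (LINT y:ball 0 1|lborel. bump y ^ Suc j * D b y) / real (Suc j)" if b: "b \<in> Basis" for b
  proof (rule ball_integration_by_parts[OF r1])
    show "norm b = 1" using b by simp
    show "continuous_on (ball 0 r1) (g b)"
      unfolding g_def using nz1 by (intro continuous_intros affine_powr_grad_continuous) auto
    show "continuous_on (ball 0 r1) (D b)"
      unfolding D_def using nz1 by (intro continuous_intros affine_powr_hess_continuous) auto
    fix y :: 'a assume "y \<in> ball 0 r1"
    then have "e + R *\<^sub>R y \<noteq> 0" using nz1 by simp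
    from line_derivative_scaled[OF affine_powr_grad_derivative[OF this, of \<delta> a p b], of R]
    show "((\<lambda>s. g b (y + s *\<^sub>R b)) has_real_derivative D b y) (at 0)"
      unfolding g_def D_def by (simp add: algebra_simps)
  qed
  have nzb: "e + R *\<^sub>R y \<noteq> 0" if "norm y \<le> 1" for y using shifted_nonzero[OF e R that] .
  have i1: "integrable lborel (\<lambda>y. indicator (ball 0 1) y *\<^sub>R (bump y ^ j * (y \<bullet> b) * g b y))" for b
    unfolding set_integrable_def[symmetric] g_def using nzb
    by (intro set_integrable_ball_continuous continuous_intros affine_powr_grad_continuous) auto
  have i2: "integrable lborel (\<lambda>y. indicator (ball 0 1) y *\<^sub>R (bump y ^ Suc j * D b y))" for b
    unfolding set_integrable_def[symmetric] D_def using nzb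
    by (intro set_integrable_ball_continuous continuous_intros affine_powr_hess_continuous) auto
  have "(LBINT y. f' R y) = (LBINT y. (\<Sum>b\<in>Basis. indicator (ball 0 1) y *\<^sub>R (bump y ^ j * (y \<bullet> b) * g b y)))"
    unfolding f'_def g_def by (subst affine_powr_grad_Basis) (simp add: sum_distrib_left mult_ac)
  also have "\<dots> = (\<Sum>b\<in>Basis. LINT y:ball 0 1|lborel. bump y ^ j * (y \<bullet> b) * g b y)"
    unfolding set_lebesgue_integral_def by (rule Bochner_Integration.integral_sum[OF i1])
  also have "\<dots> = (\<Sum>b\<in>Basis. LINT y:ball 0 1|lborel. bump y ^ Suc j * D b y) / real (Suc j)"
    unfolding sum_divide_distrib by (intro sum.cong refl ibp)
  also have "(\<Sum>b\<in>Basis. LINT y:ball 0 1|lborel. bump y ^ Suc j * D b y)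
     = (LBINT y. (\<Sum>b\<in>Basis. indicator (ball 0 1) y *\<^sub>R (bump y ^ Suc j * D b y)))"
    unfolding set_lebesgue_integral_def by (rule Bochner_Integration.integral_sum[OF i2, symmetric])
  also have "\<dots> = (LBINT y. (R * (p * (p + DIM('a) - 2 + 2 * d))) * (indicator (ball 0 1) y *\<^sub>R (bump y ^ Suc j * affine_powr \<delta> a (p - 2) (e + R *\<^sub>R y))))"
  proof (rule Bochner_Integration.integral_cong[OF refl])
    fix y :: 'a
    show "(\<Sum>b\<in>Basis. indicator (ball 0 1) y *\<^sub>R (bump y ^ Suc j * D b y))
      = (R * (p * (p + DIM('a) - 2 + 2 * d))) * (indicator (ball 0 1) y *\<^sub>R (bump y ^ Suc j * affine_powr \<delta> a (p - 2) (e + R *\<^sub>R y)))"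
    proof (cases "y \<in> ball 0 1")
      case True
      have "(\<Sum>b\<in>Basis. bump y ^ Suc j * D b y) = bump y ^ Suc j * R * (\<Sum>b\<in>Basis. affine_powr_hess \<delta> a p b (e + R *\<^sub>R y))"
        unfolding D_def by (simp add: sum_distrib_left mult.assoc)
      also have "\<dots> = bump y ^ Suc j * R * (p * (p + DIM('a) - 2 + 2 * d) * affine_powr \<delta> a (p - 2) (e + R *\<^sub>R y))"
        using True by (subst sum_Basis_hess[OF nzb a]) auto
      finally show ?thesis using True by simp
    qed simp
  qed
  also have "\<dots> = R * (p * (p + DIM('a) - 2 + 2 * d)) * bump_moment \<delta> a e (Suc j) (p - 2) R"
    unfolding bump_moment_def set_lebesgue_integral_def by (rule integral_mult_right_zero)
  finally have "(LBINT y. f' R y) = R * (p * (p + DIM('a) - 2 + 2 * d)) / real (Suc j) * bump_moment \<delta> a e (Suc j) (p - 2) R"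
    by simp
  then show ?thesis using main
    by (simp add: bump_moment_def[abs_def] set_lebesgue_integral_def)
qed

text \<open>Integration by parts with g(y) = y . b, summed over the basis, together with |y|^2 = 1 -
  2 bump y, gives n I(k+1) / (k+1) = I(k) - 2 I(k+1), where n is the dimension. The recursion starts
  at the volume of the unit ball.\<close>

lemma bump_integral:
  "(LINT y:ball 0 1|lborel. bump (y::'a::euclidean_space) ^ k)
     = unit_ball_vol (real DIM('a)) * fact k / (2 ^ k * pochhammer (real DIM('a) / 2 + 1) k)"
proof (induction k)
  case 0
  have "(LINT y:ball (0::'a) 1|lborel. (1::real)) = measure lborel (ball (0::'a) 1)"
    unfolding set_lebesgue_integral_def by simp
  also have "\<dots> = unit_ball_vol (real DIM('a))" using content_ball[of 1 "0::'a"] by simp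
  finally show ?case by simp
next
  case (Suc k)
  define I where "I j = (LINT y:ball 0 1|lborel. bump (y::'a) ^ j)" for j
  have i: "integrable lborel (\<lambda>y::'a. indicator (ball 0 1) y *\<^sub>R (bump y ^ j))" for j
    unfolding set_integrable_def[symmetric]
    by (intro set_integrable_ball_continuous continuous_intros)
  have i1: "integrable lborel (\<lambda>y::'a. indicator (ball 0 1) y *\<^sub>R (bump y ^ k * (y \<bullet> b) * (y \<bullet> b)))" for b
    unfolding set_integrable_def[symmetric]
    by (intro set_integrable_ball_continuous continuous_intros)
  have "(LINT y:ball 0 1|lborel. bump y ^ k * (y \<bullet> b) * (y \<bullet> b)) = I (Suc k) / real (Suc k)"
    if "b \<in> Basis" for b :: 'a
  proof -
    have "((\<lambda>s. (y + s *\<^sub>R b) \<bullet> b) has_real_derivative 1) (at 0)" for y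
      using that by (auto intro!: derivative_eq_intros simp: inner_add_left)
    then show ?thesis
      using ball_integration_by_parts[of 2 b "\<lambda>y. y \<bullet> b" "\<lambda>_. 1" k] that
      by (simp add: I_def continuous_intros)
  qed
  then have "real DIM('a) * (I (Suc k) / real (Suc k)) = (\<Sum>b\<in>Basis. (LINT y:ball 0 1|lborel. bump y ^ k * (y \<bullet> b) * ((y::'a) \<bullet> b)))"
    by simp
  also have "\<dots> = (LBINT y. (\<Sum>b\<in>Basis. indicator (ball 0 1) y *\<^sub>R (bump y ^ k * (y \<bullet> b) * ((y::'a) \<bullet> b))))"
    unfolding set_lebesgue_integral_def by (rule Bochner_Integration.integral_sum[OF i1, symmetric])
  also have "\<dots> = (LBINT y. (indicator (ball (0::'a) 1) y *\<^sub>R (bump y ^ k) - 2 * (indicator (ball 0 1) y *\<^sub>R (bump y ^ Suc k))))"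
  proof (rule Bochner_Integration.integral_cong[OF refl])
    fix y :: 'a
    have "(\<Sum>b\<in>Basis. (y \<bullet> b) * (y \<bullet> b)) = 1 - 2 * bump y"
      by (simp add: bump_def euclidean_inner[of y y, symmetric] power2_norm_eq_inner field_simps)
    then have "(\<Sum>b\<in>Basis. bump y ^ k * (y \<bullet> b) * (y \<bullet> b)) = bump y ^ k * (1 - 2 * bump y)"
      by (simp add: mult.assoc flip: sum_distrib_left)
    then show "(\<Sum>b\<in>Basis. indicator (ball 0 1) y *\<^sub>R (bump y ^ k * (y \<bullet> b) * (y \<bullet> b)))
      = indicator (ball (0::'a) 1) y *\<^sub>R (bump y ^ k) - 2 * (indicator (ball 0 1) y *\<^sub>R (bump y ^ Suc k))"
      by (simp flip: sum_distrib_left) (simp add: algebra_simps)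
  qed
  also have "\<dots> = I k - 2 * I (Suc k)"
    unfolding I_def set_lebesgue_integral_def using i[of k] i[of "Suc k"]
    by (subst Bochner_Integration.integral_diff) auto
  finally have "I (Suc k) * (real DIM('a) / 2 + 1 + real k) * 2 = I k * real (Suc k)"
    by (simp add: field_simps)
  moreover have "pochhammer (real DIM('a) / 2 + 1) k > 0" "real DIM('a) / 2 + 1 + real k > 0"
    by (auto intro!: pochhammer_pos add_nonneg_pos)
  ultimately show ?case
    using Suc.IH unfolding I_def[symmetric] by (simp add: pochhammer_Suc divide_simps) (simp add: algebra_simps)
qed

text \<open>The vanishing of the bump at the sphere compensates the growth of |x|^(-2) at x = e +
  \<sigma> y: |x| \<ge> 1 - \<sigma> |y|, and (1 - |y|^2)(1 - \<sigma>^2) \<le> (1 - \<sigma> |y|)^2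
  because (\<sigma> - |y|)^2 \<ge> 0. So each of the \<open>N\<close> factors bump / |x|^2 is at
  most 1 / (2 (1 - \<sigma>^2)).\<close>

lemma bump_moment_bound:
  fixes e :: "'a::euclidean_space"
  assumes e: "norm e = 1" and R: "0 \<le> R" "R < 1"
  obtains C where "0 \<le> C" "\<And>\<sigma> N. 0 \<le> \<sigma> \<Longrightarrow> \<sigma> \<le> R \<Longrightarrow>
     \<bar>bump_moment \<delta> a e N (p - 2 * real N) \<sigma>\<bar> \<le> C / (2 * (1 - \<sigma>\<^sup>2)) ^ N"
proof -
  have "compact ({0..R} \<times> cball (0::'a) 1)" by (intro compact_Times compact_cball compact_Icc)
  moreover have "continuous_on ({0..R} \<times> cball 0 1) (\<lambda>q. affine_powr \<delta> a p (e + fst q *\<^sub>R snd q))"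
    by (intro continuous_intros affine_powr_continuous) (use shifted_nonzero[OF e] R in auto)
  ultimately have "bounded ((\<lambda>q. affine_powr \<delta> a p (e + fst q *\<^sub>R snd q)) ` ({0..R} \<times> cball 0 1))"
    by (intro compact_imp_bounded compact_continuous_image)
  then obtain C where bd: "\<And>q. q \<in> {0..R} \<times> cball 0 1 \<Longrightarrow> norm (affine_powr \<delta> a p (e + fst q *\<^sub>R snd q)) \<le> C"
    unfolding bounded_iff by blast
  have C: "\<bar>affine_powr \<delta> a p (e + \<sigma> *\<^sub>R y)\<bar> \<le> C" if "0 \<le> \<sigma>" "\<sigma> \<le> R" "norm y \<le> 1" for \<sigma> y
    using bd[of "(\<sigma>, y)"] that by simp
  have C0: "0 \<le> C" using C[of 0 0] R by auto
  define V where "V = measure lborel (ball (0::'a) 1)"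
  show ?thesis
  proof (rule that[of "C * V"])
    show "0 \<le> C * V" using C0 by (simp add: V_def)
    fix \<sigma> N assume \<sigma>: "0 \<le> \<sigma>" "\<sigma> \<le> R"
    then have s1: "\<sigma> < 1" "\<sigma>\<^sup>2 < 1" using R by (auto simp: power_less_one_iff)
    define q where "q = p - 2 * real N"
    have le: "\<bar>bump y ^ N * affine_powr \<delta> a q (e + \<sigma> *\<^sub>R y)\<bar> \<le> C / (2 * (1 - \<sigma>\<^sup>2)) ^ N" if y: "y \<in> ball 0 1" for y :: 'a
    proof -
      let ?x = "e + \<sigma> *\<^sub>R y"
      have ny: "norm y < 1" using y by simp
      have "?x \<noteq> 0" using shifted_nonzero[OF e, of \<sigma> y] s1 \<sigma> ny by auto
      then have x0: "norm ?x > 0" by simp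
      have "1 - \<sigma> * norm y \<le> norm ?x"
        using norm_triangle_ineq2[of e "- (\<sigma> *\<^sub>R y)"] e \<sigma> by simp
      moreover have "0 \<le> 1 - \<sigma> * norm y" using mult_mono[of \<sigma> 1 "norm y" 1] \<sigma> s1 ny by simp
      ultimately have "(1 - \<sigma> * norm y)\<^sup>2 \<le> (norm ?x)\<^sup>2" by (intro power_mono)
      moreover have "(1 - (norm y)\<^sup>2) * (1 - \<sigma>\<^sup>2) \<le> (1 - \<sigma> * norm y)\<^sup>2"
        using zero_le_power2[of "\<sigma> - norm y"] by (simp add: power2_eq_square algebra_simps)
      ultimately have "(1 - (norm y)\<^sup>2) * (1 - \<sigma>\<^sup>2) \<le> (norm ?x)\<^sup>2" by linarith
      then have "bump y * (2 * (1 - \<sigma>\<^sup>2)) \<le> 1 * (norm ?x)\<^sup>2" by (simp add: bump_def field_simps)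
      then have *: "bump y / (norm ?x)\<^sup>2 \<le> 1 / (2 * (1 - \<sigma>\<^sup>2))"
        using x0 s1 by (intro mult_imp_div_pos_le) (simp_all add: pos_le_divide_eq mult.commute)
      have "norm ?x powr q = norm ?x powr p / ((norm ?x)\<^sup>2) ^ N"
        using powr_realpow[OF x0, of "2 * N"] unfolding q_def powr_diff by (simp add: power_mult)
      then have "bump y ^ N * affine_powr \<delta> a q ?x = (bump y / (norm ?x)\<^sup>2) ^ N * affine_powr \<delta> a p ?x"
        by (simp add: affine_powr_def power_divide)
      also have "\<bar>\<dots>\<bar> = (bump y / (norm ?x)\<^sup>2) ^ N * \<bar>affine_powr \<delta> a p ?x\<bar>"
        using bump_pos[OF y] by (simp add: abs_mult power_abs)
      also have "\<dots> \<le> (1 / (2 * (1 - \<sigma>\<^sup>2))) ^ N * C"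
        using bump_pos[OF y] ny \<sigma> s1 by (intro mult_mono power_mono * C) auto
      finally show ?thesis by (simp add: power_divide)
    qed
    have int: "integrable lborel (\<lambda>y. indicator (ball 0 1) y *\<^sub>R (bump y ^ N * affine_powr \<delta> a q (e + \<sigma> *\<^sub>R y)))"
      unfolding set_integrable_def[symmetric] using \<sigma> R by (intro bump_moment_integrable e) auto
    have ind: "integrable lborel (\<lambda>y. indicator (ball (0::'a) 1) y :: real)"
      using emeasure_lborel_ball_finite[of "0::'a" 1] by (intro integrable_real_indicator) auto
    have "\<bar>bump_moment \<delta> a e N q \<sigma>\<bar> \<le> (LBINT y. \<bar>indicator (ball 0 1) y *\<^sub>R (bump y ^ N * affine_powr \<delta> a q (e + \<sigma> *\<^sub>R y))\<bar>)"
      unfolding bump_moment_def set_lebesgue_integral_def by (rule integral_abs_bound)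
    also have "\<dots> \<le> (LBINT y. C / (2 * (1 - \<sigma>\<^sup>2)) ^ N * indicator (ball (0::'a) 1) y)"
    proof (rule integral_mono)
      fix y :: 'a
      show "\<bar>indicator (ball 0 1) y *\<^sub>R (bump y ^ N * affine_powr \<delta> a q (e + \<sigma> *\<^sub>R y))\<bar>
         \<le> C / (2 * (1 - \<sigma>\<^sup>2)) ^ N * indicator (ball 0 1) y"
        using le[of y] by (auto simp: indicator_def)
    qed (use int ind in auto)
    also have "\<dots> = C / (2 * (1 - \<sigma>\<^sup>2)) ^ N * V"
      by (simp add: V_def)
    finally show "\<bar>bump_moment \<delta> a e N (p - 2 * real N) \<sigma>\<bar> \<le> C * V / (2 * (1 - \<sigma>\<^sup>2)) ^ N"
      by (simp add: q_def)
  qed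
qed

text \<open>Taylor's formula in the variable \<open>s\<^sup>2 / 2\<close>, with Cauchy's form of the remainder.\<close>

lemma taylor_half_square:
  fixes F :: "nat \<Rightarrow> real \<Rightarrow> real"
  assumes R: "0 < R" and F: "\<And>k s. 0 \<le> s \<Longrightarrow> s \<le> R \<Longrightarrow> (F k has_real_derivative s * F (Suc k) s) (at s)"
  obtains \<sigma> where "0 < \<sigma>" "\<sigma> < R"
    "F 0 R = (\<Sum>k\<le>N. F k 0 * (R\<^sup>2 / 2) ^ k / fact k)
       + R * (\<sigma> * F (Suc N) \<sigma> * ((R\<^sup>2 - \<sigma>\<^sup>2) / 2) ^ N / fact N)"
proof -
  \<comment> \<open>The Taylor polynomial with moving centre s, evaluated at R. Its s-derivative
    telescopes to a single term. At s = R only the summand k = 0 survives, and at s = 0 it is the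
    polynomial of the claim, so the mean value theorem gives the remainder.\<close>
  define T where "T M s = (\<Sum>k\<le>M. F k s * ((R\<^sup>2 - s\<^sup>2) / 2) ^ k / fact k)" for M s
  have T: "(T M has_real_derivative s * F (Suc M) s * ((R\<^sup>2 - s\<^sup>2) / 2) ^ M / fact M) (at s)"
    if s: "0 \<le> s" "s \<le> R" for M s
  proof (induction M)
    case 0
    then show ?case using F[OF s, of 0] by (simp add: T_def[abs_def])
  next
    case (Suc M)
    have X: "((\<lambda>s. (R\<^sup>2 - s\<^sup>2) / 2) has_real_derivative - s) (at s)"
      by (auto intro!: derivative_eq_intros)
    have "((\<lambda>s. F (Suc M) s * ((R\<^sup>2 - s\<^sup>2) / 2) ^ Suc M / fact (Suc M)) has_real_derivative
       (s * F (Suc (Suc M)) s * ((R\<^sup>2 - s\<^sup>2) / 2) ^ Suc M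
         + F (Suc M) s * (real (Suc M) * ((R\<^sup>2 - s\<^sup>2) / 2) ^ M * (- s))) / fact (Suc M)) (at s)"
      by (rule DERIV_cdivide, rule DERIV_mult'[OF F[OF s] DERIV_power[OF X], THEN DERIV_cong]) simp
    from DERIV_add[OF Suc.IH this]
    have "(T (Suc M) has_real_derivative s * F (Suc M) s * ((R\<^sup>2 - s\<^sup>2) / 2) ^ M / fact M +
       (s * F (Suc (Suc M)) s * ((R\<^sup>2 - s\<^sup>2) / 2) ^ Suc M
         + F (Suc M) s * (real (Suc M) * ((R\<^sup>2 - s\<^sup>2) / 2) ^ M * (- s))) / fact (Suc M)) (at s)"
      by (simp add: T_def[abs_def])
    also have "s * F (Suc M) s * ((R\<^sup>2 - s\<^sup>2) / 2) ^ M / fact M +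
       (s * F (Suc (Suc M)) s * ((R\<^sup>2 - s\<^sup>2) / 2) ^ Suc M
         + F (Suc M) s * (real (Suc M) * ((R\<^sup>2 - s\<^sup>2) / 2) ^ M * (- s))) / fact (Suc M)
      = s * F (Suc (Suc M)) s * ((R\<^sup>2 - s\<^sup>2) / 2) ^ Suc M / fact (Suc M)"
    proof -
      define X where "X = ((R\<^sup>2 - s\<^sup>2) / 2) ^ M"
      define f where "f = (fact M :: real)"
      have "f > 0" by (simp add: f_def)
      then show ?thesis unfolding X_def[symmetric] fact_Suc f_def[symmetric]
        by (simp add: field_simps del: of_nat_Suc)
    qed
    finally show ?case .
  qed
  obtain \<sigma> where \<sigma>: "0 < \<sigma>" "\<sigma> < R"
    "T N R - T N 0 = (R - 0) * (\<sigma> * F (Suc N) \<sigma> * ((R\<^sup>2 - \<sigma>\<^sup>2) / 2) ^ N / fact N)"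
    using MVT2[OF R, of "T N" "\<lambda>s. s * F (Suc N) s * ((R\<^sup>2 - s\<^sup>2) / 2) ^ N / fact N"] T by auto
  moreover have "T N R = F 0 R"
    unfolding T_def by (subst sum.mono_neutral_right[of _ "{0}"]) auto
  moreover have "T N 0 = (\<Sum>k\<le>N. F k 0 * (R\<^sup>2 / 2) ^ k / fact k)" by (simp add: T_def)
  ultimately show ?thesis by (intro that[of \<sigma>]) auto
qed

lemma pochhammer_power_tendsto_0:
  assumes "\<bar>x\<bar> < (1::real)"
  shows "(\<lambda>k. pochhammer a k / fact k * x ^ k) \<longlonglongrightarrow> 0"
proof -
  have "summable (\<lambda>k. norm (pochhammer (complex_of_real a) k / fact k * of_real x ^ k))"
    by (rule pochhammer_series(2)) (use assms in simp)
  then have "(\<lambda>k. norm (pochhammer (complex_of_real a) k / fact k * of_real x ^ k)) \<longlonglongrightarrow> 0"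
    by (rule summable_LIMSEQ_zero)
  moreover have "norm (pochhammer (complex_of_real a) k / fact k * of_real x ^ k) = norm (pochhammer a k / fact k * x ^ k)" for k
    by (simp add: pochhammer_of_real norm_mult norm_divide norm_power abs_mult power_abs)
  ultimately show ?thesis by (simp only: tendsto_norm_zero_iff)
qed

text \<open>Each Laplacian contributes a factor 4 (A + k)(B + k), so the iterated ones build up the
  Pochhammer symbols. At R = 0 the homogeneous function is frozen at \<open>e\<close>, where |e| =
  1, and only the bump integrals remain.\<close>

theorem ball_integral_sums:
  fixes a e :: "'a::euclidean_space" and p :: real
  assumes e: "norm e = 1" and R: "0 < R" "R < 1" and a: "\<And>x. a \<bullet> x = d * (\<delta> + a \<bullet> x)"
  defines "A \<equiv> - p / 2" and "B \<equiv> - (p + DIM('a) - 2 + 2 * d) / 2" and "n \<equiv> real DIM('a)"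
  shows "(\<lambda>k. pochhammer A k * pochhammer B k / (pochhammer (n / 2 + 1) k * fact k) * (R\<^sup>2) ^ k * (unit_ball_vol n * (\<delta> + a \<bullet> e)))
     sums (LINT y:ball 0 1|lborel. (\<delta> + a \<bullet> (e + R *\<^sub>R y)) * norm (e + R *\<^sub>R y) powr p)"
proof -
  \<comment> \<open>\<open>F k\<close> is the k-th derivative of the ball integral with respect to
    s^2/2; the factorial collects the divisors \<open>Suc j\<close> from
    \<open>bump_moment_derivative\<close>.\<close>
  define F where "F k s = 4 ^ k * pochhammer A k * pochhammer B k / fact k * bump_moment \<delta> a e k (p - 2 * real k) s" for k s
  have F: "(F k has_real_derivative s * F (Suc k) s) (at s)" if s: "0 \<le> s" "s \<le> R" for k s
  proof -
    define q where "q = p - 2 * real k"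
    have lam: "q * (q + DIM('a) - 2 + 2 * d) = 4 * ((A + real k) * (B + real k))"
      by (simp add: q_def A_def B_def field_simps)
    have "(F k has_real_derivative 4 ^ k * pochhammer A k * pochhammer B k / fact k *
        (s * (q * (q + DIM('a) - 2 + 2 * d)) / real (Suc k) * bump_moment \<delta> a e (Suc k) (q - 2) s)) (at s)"
      unfolding F_def[abs_def] q_def[symmetric] using s R
      by (intro DERIV_cmult bump_moment_derivative e a) auto
    also have "4 ^ k * pochhammer A k * pochhammer B k / fact k *
        (s * (q * (q + DIM('a) - 2 + 2 * d)) / real (Suc k) * bump_moment \<delta> a e (Suc k) (q - 2) s) = s * F (Suc k) s"
      unfolding lam F_def by (simp add: q_def pochhammer_Suc algebra_simps divide_simps)
    finally show ?thesis .
  qed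
  obtain C where C: "0 \<le> C" "\<And>\<sigma> N. 0 \<le> \<sigma> \<Longrightarrow> \<sigma> \<le> R \<Longrightarrow>
     \<bar>bump_moment \<delta> a e N (p - 2 * real N) \<sigma>\<bar> \<le> C / (2 * (1 - \<sigma>\<^sup>2)) ^ N"
    using bump_moment_bound[OF e, of R \<delta> a p] R by auto
  have R2: "R\<^sup>2 < 1" using R by (simp add: power_less_one_iff)
  define S where "S N = (\<Sum>k\<le>N. F k 0 * (R\<^sup>2 / 2) ^ k / fact k)" for N
  \<comment> \<open>A constant times two terms of binomial series at the point R < 1, each of which
    tends to 0. The shift to A + 1 and B + 1 comes from splitting the first factor off the
    Pochhammer symbols of order N + 1.\<close>
  define rem where "rem N = 2 * C / (1 - R\<^sup>2) * \<bar>A\<bar> * \<bar>B\<bar> * (\<bar>pochhammer (A + 1) N / fact N * R ^ N\<bar> * \<bar>pochhammer (B + 1) N / fact N * R ^ N\<bar>)" for N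
  have "\<bar>F 0 R - S N\<bar> \<le> rem N" for N
  proof -
    obtain \<sigma> where \<sigma>: "0 < \<sigma>" "\<sigma> < R"
      "F 0 R = S N + R * (\<sigma> * F (Suc N) \<sigma> * ((R\<^sup>2 - \<sigma>\<^sup>2) / 2) ^ N / fact N)"
      unfolding S_def by (rule taylor_half_square[of R F N, OF R(1) F]) auto
    have s2: "\<sigma>\<^sup>2 < R\<^sup>2" using \<sigma> by (intro power_strict_mono) auto
    define P where "P = \<bar>pochhammer A (Suc N)\<bar> * \<bar>pochhammer B (Suc N)\<bar>"
    have P: "P = \<bar>A\<bar> * \<bar>B\<bar> * (\<bar>pochhammer (A + 1) N\<bar> * \<bar>pochhammer (B + 1) N\<bar>)"
      by (simp add: P_def pochhammer_rec abs_mult)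
    have P0: "0 \<le> P" by (simp add: P_def)
    have "\<bar>F (Suc N) \<sigma>\<bar> \<le> 4 ^ Suc N * P / fact (Suc N) * (C / (2 * (1 - \<sigma>\<^sup>2)) ^ Suc N)"
      unfolding F_def abs_mult abs_divide using C(2)[of \<sigma> "Suc N"] \<sigma> P0
      by (intro mult_mono) (auto simp: P_def abs_mult)
    also have "\<dots> = P * C / fact (Suc N) * (2 / (1 - \<sigma>\<^sup>2)) ^ Suc N"
    proof -
      have "(4::real) ^ Suc N = 2 ^ Suc N * 2 ^ Suc N" by (simp flip: power_mult_distrib)
      then show ?thesis by (simp only: power_mult_distrib power_divide) (simp add: divide_simps)
    qed
    finally have FN: "\<bar>F (Suc N) \<sigma>\<bar> \<le> P * C / fact (Suc N) * (2 / (1 - \<sigma>\<^sup>2)) ^ Suc N" .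
    have "\<bar>F 0 R - S N\<bar> = (R * \<sigma>) * \<bar>F (Suc N) \<sigma>\<bar> * (((R\<^sup>2 - \<sigma>\<^sup>2) / 2) ^ N / fact N)"
      using \<sigma> R s2 by (simp add: abs_mult power_abs)
    also have "\<dots> \<le> 1 * (P * C / fact (Suc N) * (2 / (1 - \<sigma>\<^sup>2)) ^ Suc N) * (((R\<^sup>2 - \<sigma>\<^sup>2) / 2) ^ N / fact N)"
      using s2 \<sigma> R mult_mono[of R 1 \<sigma> 1] by (intro mult_right_mono mult_mono FN) auto
    also have "\<dots> = P * C / (fact (Suc N) * fact N) * (2 / (1 - \<sigma>\<^sup>2)) * ((R\<^sup>2 - \<sigma>\<^sup>2) / (1 - \<sigma>\<^sup>2)) ^ N"
      by (simp add: power_divide divide_simps)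
    also have "\<dots> \<le> P * C / (fact N * fact N) * (2 / (1 - R\<^sup>2)) * (R\<^sup>2) ^ N"
    proof (intro mult_mono power_mono)
      show "P * C / (fact (Suc N) * fact N) \<le> P * C / (fact N * fact N)"
        using P0 C(1) by (intro divide_left_mono mult_right_mono) (auto simp: fact_mono)
      show "2 / (1 - \<sigma>\<^sup>2) \<le> 2 / (1 - R\<^sup>2)" using s2 R2 by (intro divide_left_mono) auto
      \<comment> \<open>The gain of Cauchy's form: the numerator R^2 - \<sigma>^2 compensates the
        loss of 1 - \<sigma>^2 in the moment bound, uniformly in the unknown \<sigma>.\<close>
      have "R\<^sup>2 - \<sigma>\<^sup>2 \<le> R\<^sup>2 * (1 - \<sigma>\<^sup>2)"
        using R2 \<sigma> mult_left_le_one_le[of "\<sigma>\<^sup>2" "R\<^sup>2"] by (simp add: algebra_simps)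
      then show "(R\<^sup>2 - \<sigma>\<^sup>2) / (1 - \<sigma>\<^sup>2) \<le> R\<^sup>2" using s2 R2 by (simp add: divide_le_eq)
    qed (use P0 C(1) s2 R2 in auto)
    also have "\<dots> = rem N"
      unfolding P rem_def using R
      by (simp add: abs_mult power_abs divide_simps power2_eq_square power_mult_distrib)
    finally show ?thesis .
  qed
  moreover have "rem \<longlonglongrightarrow> 0"
  proof -
    have "(\<lambda>N. 2 * C / (1 - R\<^sup>2) * \<bar>A\<bar> * \<bar>B\<bar> * (\<bar>pochhammer (A + 1) N / fact N * R ^ N\<bar> * \<bar>pochhammer (B + 1) N / fact N * R ^ N\<bar>))
       \<longlonglongrightarrow> 2 * C / (1 - R\<^sup>2) * \<bar>A\<bar> * \<bar>B\<bar> * (\<bar>0\<bar> * \<bar>0\<bar>)"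
      using R by (intro tendsto_mult tendsto_const tendsto_rabs pochhammer_power_tendsto_0) auto
    then show ?thesis by (simp add: rem_def[abs_def])
  qed
  ultimately have "(\<lambda>N. F 0 R - S N) \<longlonglongrightarrow> 0"
    by (rule_tac Lim_null_comparison[of _ rem]) auto
  then have "(\<lambda>N. F 0 R - (F 0 R - S N)) \<longlonglongrightarrow> F 0 R - 0" by (intro tendsto_diff tendsto_const)
  then have "(\<lambda>k. F k 0 * (R\<^sup>2 / 2) ^ k / fact k) sums F 0 R"
    by (simp add: sums_def_le S_def)
  moreover have "F 0 R = (LINT y:ball 0 1|lborel. (\<delta> + a \<bullet> (e + R *\<^sub>R y)) * norm (e + R *\<^sub>R y) powr p)"
    by (simp add: F_def bump_moment_def affine_powr_def)
  moreover have "F k 0 * (R\<^sup>2 / 2) ^ k / fact k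
     = pochhammer A k * pochhammer B k / (pochhammer (n / 2 + 1) k * fact k) * (R\<^sup>2) ^ k * (unit_ball_vol n * (\<delta> + a \<bullet> e))" for k
  proof -
    have "bump_moment \<delta> a e k (p - 2 * real k) 0 = (LINT y:ball 0 1|lborel. (\<delta> + a \<bullet> e) * bump (y::'a) ^ k)"
      by (simp add: bump_moment_def affine_powr_def e mult.commute)
    also have "\<dots> = (\<delta> + a \<bullet> e) * (unit_ball_vol n * fact k / (2 ^ k * pochhammer (n / 2 + 1) k))"
      unfolding set_integral_mult_right bump_integral n_def ..
    finally have m: "bump_moment \<delta> a e k (p - 2 * real k) 0
       = (\<delta> + a \<bullet> e) * (unit_ball_vol n * fact k / (2 ^ k * pochhammer (n / 2 + 1) k))" .
    have "pochhammer (n / 2 + 1) k > 0" by (auto intro!: pochhammer_pos add_nonneg_pos simp: n_def)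
    moreover have "(4::real) ^ k = 2 ^ k * 2 ^ k" by (simp flip: power_mult_distrib)
    ultimately show ?thesis unfolding F_def m by (simp add: power_divide divide_simps)
  qed
  ultimately show ?thesis by simp
qed

section \<open>Integrals over hyperbolic balls\<close>

text \<open>In this form, rather than by centre and radius, the set is the region where the bathtub
  integrand is nonnegative, and monotonicity in t is immediate.\<close>

definition hyperbolic_ball :: "'a::euclidean_space \<Rightarrow> real \<Rightarrow> real \<Rightarrow> 'a set" where
  "hyperbolic_ball e t s = {x. (norm x)\<^sup>2 + s\<^sup>2 \<le> 2 * t * s * (e \<bullet> x)}"

lemma hyperbolic_ball_eq_cball:
  assumes "norm e = 1" "1 \<le> t" "0 < s"
  shows "hyperbolic_ball e t s = cball ((s * t) *\<^sub>R e) (s * sqrt (t\<^sup>2 - 1))"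
proof -
  have t2: "1 \<le> t\<^sup>2" using assms by (simp add: one_le_power)
  have "x \<in> hyperbolic_ball e t s \<longleftrightarrow> x \<in> cball ((s * t) *\<^sub>R e) (s * sqrt (t\<^sup>2 - 1))" for x
  proof -
    have ee: "e \<bullet> e = 1" using assms(1) by (simp add: dot_square_norm)
    have "(norm ((s * t) *\<^sub>R e - x))\<^sup>2 = (s * t)\<^sup>2 - 2 * t * s * (e \<bullet> x) + (norm x)\<^sup>2"
      unfolding power2_norm_eq_inner
      by (simp add: inner_diff_left inner_diff_right ee inner_commute power2_eq_square algebra_simps)
    moreover have "(s * sqrt (t\<^sup>2 - 1))\<^sup>2 = (s * t)\<^sup>2 - s\<^sup>2"
      using t2 by (simp add: power_mult_distrib algebra_simps)
    moreover have "norm ((s * t) *\<^sub>R e - x) \<le> s * sqrt (t\<^sup>2 - 1) \<longleftrightarrow>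
       (norm ((s * t) *\<^sub>R e - x))\<^sup>2 \<le> (s * sqrt (t\<^sup>2 - 1))\<^sup>2"
      using abs_le_square_iff[of "norm ((s * t) *\<^sub>R e - x)" "s * sqrt (t\<^sup>2 - 1)"] assms t2 by simp
    ultimately show ?thesis by (auto simp: hyperbolic_ball_def dist_norm)
  qed
  then show ?thesis by blast
qed

lemma hyperbolic_ball_closed: "closed (hyperbolic_ball e t s)"
  unfolding hyperbolic_ball_def by (intro closed_Collect_le continuous_intros)

lemma hyperbolic_ball_borel [measurable]: "hyperbolic_ball e t s \<in> sets borel"
  by (rule borel_closed[OF hyperbolic_ball_closed])

lemma hyperbolic_ball_nonzero: "0 < s \<Longrightarrow> x \<in> hyperbolic_ball e t s \<Longrightarrow> x \<noteq> 0"
  by (auto simp: hyperbolic_ball_def)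

lemma hyperbolic_ball_compact:
  assumes "norm e = 1" "1 \<le> t" "0 < s"
  shows "compact (hyperbolic_ball e t s)"
  unfolding hyperbolic_ball_eq_cball[OF assms] by (rule compact_cball)

lemma lborel_integral_affine:
  fixes f :: "'a::euclidean_space \<Rightarrow> real"
  assumes [measurable]: "f \<in> borel_measurable borel" and c: "0 < c"
  shows "(LBINT x. f x) = c ^ DIM('a) * (LBINT y. f (v + c *\<^sub>R y))"
proof -
  have "(LBINT x. f x) = (\<integral>x. f x \<partial>density (distr lborel borel (\<lambda>x. v + c *\<^sub>R x)) (\<lambda>_. \<bar>c\<bar> ^ DIM('a)))"
    using c by (subst lborel_affine[of c v]) auto
  also have "\<dots> = (\<integral>x. \<bar>c\<bar> ^ DIM('a) *\<^sub>R f x \<partial>distr lborel borel (\<lambda>x. v + c *\<^sub>R x))"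
    by (subst integral_density) auto
  also have "\<dots> = (LBINT y. c ^ DIM('a) * f (v + c *\<^sub>R y))"
    using c by (subst integral_distr) auto
  finally show ?thesis by simp
qed

text \<open>With r = sqrt (t^2 - 1), the map y -> s t (e + (r/t) y) carries the unit ball onto the
  hyperbolic ball. Homogeneity extracts (s t)^(p + d), and the relative radius r/t is below
  1.\<close>

lemma hyperbolic_ball_integral:
  fixes a e :: "'a::euclidean_space" and p :: real
  assumes e: "norm e = 1" and t: "1 < t" and s: "0 < s"
    and h: "\<And>c x. 0 < c \<Longrightarrow> \<delta> + a \<bullet> (c *\<^sub>R x) = c powr d * (\<delta> + a \<bullet> x)"
  shows "(LINT x:hyperbolic_ball e t s|lborel. (\<delta> + a \<bullet> x) * norm x powr p)
    = (s * t) powr (p + d) * (s * sqrt (t\<^sup>2 - 1)) ^ DIM('a) *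
      (LINT y:ball 0 1|lborel. (\<delta> + a \<bullet> (e + (sqrt (t\<^sup>2 - 1) / t) *\<^sub>R y)) * norm (e + (sqrt (t\<^sup>2 - 1) / t) *\<^sub>R y) powr p)"
proof -
  define r where "r = sqrt (t\<^sup>2 - 1)"
  have r: "r > 0" using t by (simp add: r_def one_less_power)
  define c where "c = s * r"
  have c: "c > 0" using s r by (simp add: c_def)
  define f where "f x = indicator (hyperbolic_ball e t s) x *\<^sub>R ((\<delta> + a \<bullet> x) * norm x powr p)" for x
  have [measurable]: "f \<in> borel_measurable borel" unfolding f_def by measurable
  have "(LINT x:hyperbolic_ball e t s|lborel. (\<delta> + a \<bullet> x) * norm x powr p) = (LBINT x. f x)"
    by (simp add: set_lebesgue_integral_def f_def)
  also have "\<dots> = c ^ DIM('a) * (LBINT y. f ((s * t) *\<^sub>R e + c *\<^sub>R y))"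
    by (rule lborel_integral_affine[OF _ c]) simp
  also have "(LBINT y. f ((s * t) *\<^sub>R e + c *\<^sub>R y)) = (LBINT y. (s * t) powr (p + d) *
      (indicator (ball 0 1) y *\<^sub>R ((\<delta> + a \<bullet> (e + (r / t) *\<^sub>R y)) * norm (e + (r / t) *\<^sub>R y) powr p)))"
  proof (rule integral_cong_AE)
    show "AE y in lborel. f ((s * t) *\<^sub>R e + c *\<^sub>R y) = (s * t) powr (p + d) *
      (indicator (ball 0 1) y *\<^sub>R ((\<delta> + a \<bullet> (e + (r / t) *\<^sub>R y)) * norm (e + (r / t) *\<^sub>R y) powr p))"
      using AE_not_in_sphere[of 0 1]
    proof eventually_elim
      case (elim y)
      have st: "s * t > 0" using s t by simp
      have eq: "(s * t) *\<^sub>R e + c *\<^sub>R y = (s * t) *\<^sub>R (e + (r / t) *\<^sub>R y)"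
        using t by (simp add: c_def algebra_simps)
      have "(s * t) *\<^sub>R e + c *\<^sub>R y \<in> hyperbolic_ball e t s \<longleftrightarrow> c * norm y \<le> c"
        using hyperbolic_ball_eq_cball[OF e, of t s] t s c by (simp add: dist_norm c_def r_def)
      also have "\<dots> \<longleftrightarrow> norm y \<le> 1" using c by (simp add: mult_le_cancel_left1)
      also have "\<dots> \<longleftrightarrow> y \<in> ball 0 1" using elim by auto
      finally have i: "indicat_real (hyperbolic_ball e t s) ((s * t) *\<^sub>R e + c *\<^sub>R y) = indicator (ball 0 1) y"
        by (simp add: indicator_def)
      define z where "z = e + (r / t) *\<^sub>R y"
      have nz: "norm ((s * t) *\<^sub>R z) powr p = (s * t) powr p * norm z powr p"
        using st by (simp only: norm_scaleR abs_of_pos powr_mult)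
      have "f ((s * t) *\<^sub>R e + c *\<^sub>R y) = indicator (ball 0 1) y *
         ((s * t) powr d * (\<delta> + a \<bullet> z) * ((s * t) powr p * norm z powr p))"
        unfolding f_def i unfolding eq z_def[symmetric] nz by (subst h[OF st]) simp
      also have "\<dots> = ((s * t) powr p * (s * t) powr d) * (indicator (ball 0 1) y *\<^sub>R ((\<delta> + a \<bullet> z) * norm z powr p))"
        by (simp only: mult_ac real_scaleR_def)
      finally show ?case unfolding powr_add z_def .
    qed
    show "(\<lambda>y. f ((s * t) *\<^sub>R e + c *\<^sub>R y)) \<in> borel_measurable lborel" by simp
    show "(\<lambda>y. (s * t) powr (p + d) * (indicator (ball 0 1) y *\<^sub>R
        ((\<delta> + a \<bullet> (e + (r / t) *\<^sub>R y)) * norm (e + (r / t) *\<^sub>R y) powr p))) \<in> borel_measurable lborel"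
    proof -
      define W where "W z = (\<delta> + a \<bullet> z) * norm z powr p" for z
      have [measurable]: "W \<in> borel_measurable borel" unfolding W_def by measurable
      have "(\<lambda>y. (s * t) powr (p + d) * (indicator (ball 0 1) y *\<^sub>R W (e + (r / t) *\<^sub>R y))) \<in> borel_measurable borel"
        by (intro borel_measurable_times borel_measurable_const borel_measurable_scaleR borel_measurable_indicator
            measurable_compose[OF _ \<open>W \<in> borel_measurable borel\<close>] borel_measurable_add) simp_all
      then show ?thesis unfolding W_def measurable_lborel2 .
    qed
  qed
  finally have E: "(LINT x:hyperbolic_ball e t s|lborel. (\<delta> + a \<bullet> x) * norm x powr p)
    = c ^ DIM('a) * ((s * t) powr (p + d) * (LINT y:ball 0 1|lborel. (\<delta> + a \<bullet> (e + (r / t) *\<^sub>R y)) * norm (e + (r / t) *\<^sub>R y) powr p))"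
    unfolding integral_mult_right_zero set_lebesgue_integral_def .
  show ?thesis unfolding E c_def r_def by (simp only: mult_ac)
qed

text \<open>The Pizzetti series has parameters -p/2 and \<open>A\<close> and argument (r/t)^2 = 1 -
  1/t^2. Since \<open>B\<close> is such that c - B = -p/2, this is the series side of Pfaff's
  transformation, which accounts for the extra exponent 2 A of t.\<close>

lemma hyperbolic_ball_integral_hypergeo:
  fixes a e :: "'a::euclidean_space" and p :: real
  defines "n \<equiv> real DIM('a)"
  assumes e: "norm e = 1" and t: "1 < t" and s: "0 < s"
    and h: "\<And>c x. 0 < c \<Longrightarrow> \<delta> + a \<bullet> (c *\<^sub>R x) = c powr d * (\<delta> + a \<bullet> x)"
    and a: "\<And>x. a \<bullet> x = d * (\<delta> + a \<bullet> x)" and 1: "\<delta> + a \<bullet> e = 1"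
    and A: "A = - (p + n - 2 + 2 * d) / 2" and B: "B = (n + 2 + p) / 2"
    and AB: "A = 0 \<or> 0 < A \<and> A < (n + 2) / 2 \<or> 0 < B \<and> B < (n + 2) / 2"
  shows "(LINT x:hyperbolic_ball e t s|lborel. (\<delta> + a \<bullet> x) * norm x powr p)
    = unit_ball_vol n * (s powr (p + d + n) * (t powr (p + d + 2 * A) * (t\<^sup>2 - 1) powr (n / 2) *
        hypergeo_2F1_real A B ((n + 2) / 2) (1 - t\<^sup>2)))"
proof -
  define r where "r = sqrt (t\<^sup>2 - 1)"
  have t2: "t\<^sup>2 > 1" using t by (simp add: one_less_power)
  have r: "r > 0" "r\<^sup>2 = t\<^sup>2 - 1" using t2 by (auto simp: r_def)
  have "r\<^sup>2 < t\<^sup>2" using r by simp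
  then have rt: "r < t" by (rule power_less_imp_less_base) (use t in simp)
  define I where "I = (LINT y:ball 0 1|lborel. (\<delta> + a \<bullet> (e + (r / t) *\<^sub>R y)) * norm (e + (r / t) *\<^sub>R y) powr p)"
  have y: "(r / t)\<^sup>2 = 1 - 1 / t\<^sup>2" using t by (simp add: power_divide r divide_simps)
  have cB: "(n + 2) / 2 - B = - p / 2" and c: "(n + 2) / 2 = n / 2 + 1" by (auto simp: B field_simps)
  have "(\<lambda>k. pochhammer (- p / 2) k * pochhammer A k / (pochhammer (n / 2 + 1) k * fact k) * ((r / t)\<^sup>2) ^ k * (unit_ball_vol n * (\<delta> + a \<bullet> e)))
     sums I"
    unfolding I_def A n_def using r(1) rt t by (intro ball_integral_sums[OF e _ _ a]) auto
  moreover have "(\<lambda>k. pochhammer A k * pochhammer (- p / 2) k / (pochhammer (n / 2 + 1) k * fact k) * (1 - 1 / t\<^sup>2) ^ k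
      * unit_ball_vol n) sums (t powr (2 * A) * hypergeo_2F1_real A B ((n + 2) / 2) (1 - t\<^sup>2) * unit_ball_vol n)"
    using hypergeo_2F1_real_pfaff[OF t AB] unfolding cB unfolding c by (rule sums_mult2)
  ultimately have I: "I = t powr (2 * A) * hypergeo_2F1_real A B ((n + 2) / 2) (1 - t\<^sup>2) * unit_ball_vol n"
    unfolding y 1 by (simp add: mult_ac sums_iff)
  have rn: "(s * r) ^ DIM('a) = s powr n * (t\<^sup>2 - 1) powr (n / 2)"
  proof -
    have "r powr n = (t\<^sup>2 - 1) powr (n / 2)"
      using t2 by (simp add: r_def powr_half_sqrt[symmetric] powr_powr)
    then show ?thesis using r s by (simp add: n_def power_mult_distrib powr_realpow)
  qed
  have "(LINT x:hyperbolic_ball e t s|lborel. (\<delta> + a \<bullet> x) * norm x powr p) = (s * t) powr (p + d) * (s * r) ^ DIM('a) * I"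
    unfolding I_def r_def by (rule hyperbolic_ball_integral[OF e t s h])
  also have "\<dots> = unit_ball_vol n * ((s powr (p + d) * s powr n) * ((t powr (p + d) * t powr (2 * A)) * (t\<^sup>2 - 1) powr (n / 2) *
        hypergeo_2F1_real A B ((n + 2) / 2) (1 - t\<^sup>2)))"
    unfolding rn I using s t by (simp add: powr_mult)
  finally show ?thesis by (simp only: powr_add[symmetric])
qed

lemma hyperbolic_ball_f_fun:
  fixes e :: "'a::euclidean_space" and \<beta> :: real
  assumes e: "norm e = 1" and t: "1 < t" and s: "0 < s" and \<beta>: "- 2 < \<beta>" "\<beta> \<le> 2"
  shows "(LINT x:hyperbolic_ball e t s|lborel. norm x powr (\<beta> - DIM('a)))
    = unit_ball_vol DIM('a) * (s powr \<beta> * f_fun DIM('a) \<beta> t)"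
proof -
  define n where "n = real DIM('a)"
  have n: "n \<ge> 1" using DIM_positive[where 'a='a] unfolding n_def by linarith
  have "(LINT x:hyperbolic_ball e t s|lborel. (1 + 0 \<bullet> x) * norm x powr (\<beta> - n))
    = unit_ball_vol n * (s powr (\<beta> - n + 0 + n) * (t powr (\<beta> - n + 0 + 2 * ((2 - \<beta>) / 2)) * (t\<^sup>2 - 1) powr (n / 2) *
        hypergeo_2F1_real ((2 - \<beta>) / 2) ((2 + \<beta>) / 2) ((n + 2) / 2) (1 - t\<^sup>2)))"
    unfolding n_def
  proof (rule hyperbolic_ball_integral_hypergeo[OF e t s])
    show "(2 - \<beta>) / 2 = 0 \<or> 0 < (2 - \<beta>) / 2 \<and> (2 - \<beta>) / 2 < (real DIM('a) + 2) / 2 \<or>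
      0 < (2 + \<beta>) / 2 \<and> (2 + \<beta>) / 2 < (real DIM('a) + 2) / 2"
    proof -
      \<comment> \<open>For 0 < \<beta> < 2 the first parameter lies in (0, 1), for -2 < \<beta>
        \<le> 0 the second lies in (0, 1], and c is at least 3/2. The indices \<alpha> and \<alpha>
        - 2 both fall in this range.\<close>
      consider "\<beta> = 2" | "0 < \<beta>" "\<beta> < 2" | "- 2 < \<beta>" "\<beta> \<le> 0" using \<beta> by linarith
      then show ?thesis
      proof cases
        case 2
        then have "0 < (2 - \<beta>) / 2" "(2 - \<beta>) / 2 < (n + 2) / 2" using n by simp_all
        then show ?thesis unfolding n_def by blast
      next
        case 3
        then have "0 < (2 + \<beta>) / 2" "(2 + \<beta>) / 2 < (n + 2) / 2" using n by simp_all
        then show ?thesis unfolding n_def by blast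
      qed simp
    qed
  qed (auto simp: field_simps)
  moreover have "\<beta> - n + 0 + n = \<beta>" "\<beta> - n + 0 + 2 * ((2 - \<beta>) / 2) = 2 - n"
    by (simp_all add: field_simps)
  ultimately show ?thesis by (simp only: f_fun_def n_def add_0 inner_zero_left add_0_right mult_1)
qed

lemma hyperbolic_ball_h_fun:
  fixes e :: "'a::euclidean_space" and \<alpha> :: real
  assumes e: "norm e = 1" and t: "1 < t" and s: "0 < s" and \<alpha>: "0 < \<alpha>" "\<alpha> \<le> 2"
  shows "(LINT x:hyperbolic_ball e t s|lborel. (e \<bullet> x) * norm x powr (\<alpha> - 2 - DIM('a)))
    = unit_ball_vol DIM('a) * (s powr (\<alpha> - 1) * h_fun DIM('a) \<alpha> t)"
proof -
  define n where "n = real DIM('a)"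
  have n: "n \<ge> 1" using DIM_positive[where 'a='a] unfolding n_def by linarith
  have "(LINT x:hyperbolic_ball e t s|lborel. (0 + e \<bullet> x) * norm x powr (\<alpha> - 2 - n))
    = unit_ball_vol n * (s powr (\<alpha> - 2 - n + 1 + n) * (t powr (\<alpha> - 2 - n + 1 + 2 * ((2 - \<alpha>) / 2)) * (t\<^sup>2 - 1) powr (n / 2) *
        hypergeo_2F1_real ((2 - \<alpha>) / 2) (\<alpha> / 2) ((n + 2) / 2) (1 - t\<^sup>2)))"
    unfolding n_def
  proof (rule hyperbolic_ball_integral_hypergeo[OF e t s])
    show "(2 - \<alpha>) / 2 = 0 \<or> 0 < (2 - \<alpha>) / 2 \<and> (2 - \<alpha>) / 2 < (real DIM('a) + 2) / 2 \<or>
      0 < \<alpha> / 2 \<and> \<alpha> / 2 < (real DIM('a) + 2) / 2"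
      using \<alpha> n by (auto simp: n_def)
    show "0 + e \<bullet> e = 1" using e by (simp add: dot_square_norm)
  qed (auto simp: field_simps)
  moreover have "\<alpha> - 2 - n + 1 + n = \<alpha> - 1" "\<alpha> - 2 - n + 1 + 2 * ((2 - \<alpha>) / 2) = 1 - n"
    by (simp_all add: field_simps)
  ultimately show ?thesis by (simp only: h_fun_def n_def add_0)
qed

section \<open>The functionals of a hyperbolic ball\<close>

lemma scale_measure_eq_density: "scale_measure c M = density M (\<lambda>_. c)"
  by (rule measure_eqI) (auto simp: emeasure_density nn_integral_cmult_indicator)

lemma unit_ball_vol_nat_pos: "0 < unit_ball_vol (real n)"
  by (rule unit_ball_vol_pos) simp

lemma nn_integral_lebesgue_normalized:
  fixes f :: "real ^ 'n \<Rightarrow> ennreal"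
  assumes "f \<in> borel_measurable lebesgue"
  shows "(\<integral>\<^sup>+x. f x \<partial>lebesgue_normalized) = ennreal (1 / unit_ball_vol (real CARD('n))) * (\<integral>\<^sup>+x. f x \<partial>lborel)"
  unfolding lebesgue_normalized_def
  using assms by (simp add: nn_integral_scale_measure nn_integral_completion)

lemma integral_lebesgue_normalized:
  fixes f :: "real ^ 'n \<Rightarrow> real"
  assumes "f \<in> borel_measurable borel"
  shows "(LINT x|lebesgue_normalized. f x) = (LBINT x. f x) / unit_ball_vol (real CARD('n))"
proof -
  have "f \<in> borel_measurable lebesgue" using assms by (simp add: measurable_completion)
  then have "(LINT x|lebesgue_normalized. f x) = (LINT x|lebesgue. (1 / unit_ball_vol (real CARD('n))) *\<^sub>R f x)"
    unfolding lebesgue_normalized_def scale_measure_eq_density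
    using unit_ball_vol_nat_pos[of "CARD('n)"] by (subst integral_density) (auto simp: less_imp_le)
  also have "\<dots> = (LINT x|lebesgue. f x) / unit_ball_vol (real CARD('n))" by simp
  also have "(LINT x|lebesgue. f x) = (LBINT x. f x)"
    using assms by (intro integral_completion) simp
  finally show ?thesis .
qed

lemma measurable_lebesgue_normalized [simp]:
  "borel_measurable lebesgue_normalized = borel_measurable lebesgue"
  by (intro measurable_cong_sets) (simp_all add: lebesgue_normalized_def)

lemma hyperbolic_ball_powr_integrable:
  fixes e :: "'a::euclidean_space"
  assumes "norm e = 1" "1 \<le> t" "0 < s" "continuous_on (hyperbolic_ball e t s) g"
  shows "integrable lborel (\<lambda>x. indicator (hyperbolic_ball e t s) x * (g x * norm x powr p))"
proof -
  have "continuous_on (hyperbolic_ball e t s) (\<lambda>x. g x * norm x powr p)"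
    using hyperbolic_ball_nonzero[OF assms(3)] assms(4) by (intro continuous_intros) auto
  from borel_integrable_compact[OF hyperbolic_ball_compact[OF assms(1-3)] this] show ?thesis by simp
qed

lemma F_fun_hyperbolic_ball:
  fixes e :: "real ^ 'n"
  assumes e: "norm e = 1" and t: "1 < t" and s: "0 < s" and \<beta>: "- 2 < \<beta>" "\<beta> \<le> 2"
  shows "F_fun \<beta> (indicator (hyperbolic_ball e t s)) = ennreal (s powr \<beta> * f_fun CARD('n) \<beta> t)"
proof -
  define V where "V = unit_ball_vol (real CARD('n))"
  have V: "V > 0" unfolding V_def by (rule unit_ball_vol_nat_pos)
  let ?g = "\<lambda>x::real^'n. indicator (hyperbolic_ball e t s) x * (1 * norm x powr (\<beta> - CARD('n)))"
  have eq: "indicator (hyperbolic_ball e t s) x / norm x powr (real CARD('n) - \<beta>) = ?g x" for x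
    by (simp add: powr_minus[symmetric] divide_inverse)
  have int: "integrable lborel ?g"
    using t by (intro hyperbolic_ball_powr_integrable[OF e _ s]) auto
  have m: "?g \<in> borel_measurable borel" using int by (simp add: borel_measurable_integrable)
  have "F_fun \<beta> (indicator (hyperbolic_ball e t s)) = ennreal (1 / V) * (\<integral>\<^sup>+x. ennreal (?g x) \<partial>lborel)"
    unfolding F_fun_def eq V_def using m by (intro nn_integral_lebesgue_normalized) (simp add: measurable_completion)
  also have "(\<integral>\<^sup>+x. ennreal (?g x) \<partial>lborel) = ennreal (LBINT x. ?g x)"
    using int by (intro nn_integral_eq_integral) auto
  also have "(LBINT x. ?g x) = V * (s powr \<beta> * f_fun CARD('n) \<beta> t)"
    using hyperbolic_ball_f_fun[OF e t s \<beta>] by (simp add: V_def set_lebesgue_integral_def)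
  also have "ennreal (1 / V) * ennreal (V * (s powr \<beta> * f_fun CARD('n) \<beta> t)) = ennreal (1 / V * (V * (s powr \<beta> * f_fun CARD('n) \<beta> t)))"
    using V by (intro ennreal_mult'[symmetric]) simp
  also have "1 / V * (V * (s powr \<beta> * f_fun CARD('n) \<beta> t)) = s powr \<beta> * f_fun CARD('n) \<beta> t"
    using V by simp
  finally show ?thesis .
qed

lemma H_integral_hyperbolic_ball:
  fixes e :: "real ^ 'n"
  assumes e: "norm e = 1" and t: "1 < t" and s: "0 < s" and \<alpha>: "0 < \<alpha>" "\<alpha> \<le> 2"
  shows "(LINT x|lebesgue_normalized. (e \<bullet> x) * indicator (hyperbolic_ball e t s) x / norm x powr (real CARD('n) + 2 - \<alpha>))
     = s powr (\<alpha> - 1) * h_fun CARD('n) \<alpha> t"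
proof -
  define V where "V = unit_ball_vol (real CARD('n))"
  have V: "V > 0" unfolding V_def by (rule unit_ball_vol_nat_pos)
  let ?g = "\<lambda>x::real^'n. indicator (hyperbolic_ball e t s) x * ((e \<bullet> x) * norm x powr (\<alpha> - 2 - CARD('n)))"
  have eq: "(e \<bullet> x) * indicator (hyperbolic_ball e t s) x / norm x powr (real CARD('n) + 2 - \<alpha>) = ?g x" for x
  proof -
    have "\<alpha> - 2 - real CARD('n) = - (real CARD('n) + 2 - \<alpha>)" by simp
    then show ?thesis by (simp only: powr_minus) (simp add: divide_inverse)
  qed
  have int: "integrable lborel ?g"
    using t by (intro hyperbolic_ball_powr_integrable[OF e _ s] continuous_intros) auto
  have m: "?g \<in> borel_measurable borel" using int by (simp add: borel_measurable_integrable)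
  have "(LBINT x. ?g x) = V * (s powr (\<alpha> - 1) * h_fun CARD('n) \<alpha> t)"
    using hyperbolic_ball_h_fun[OF e t s \<alpha>] by (simp add: V_def set_lebesgue_integral_def)
  then show ?thesis unfolding eq integral_lebesgue_normalized[OF m] V_def[symmetric] using V by simp
qed

section \<open>Inclusions between hyperbolic balls\<close>

lemma hyperbolic_ball_inner_pos:
  assumes "0 < s" "0 \<le> t" "x \<in> hyperbolic_ball e t s"
  shows "0 < e \<bullet> x"
proof (rule ccontr)
  assume "\<not> 0 < e \<bullet> x"
  then have "2 * t * s * (e \<bullet> x) \<le> 0" using assms by (intro mult_nonneg_nonpos) auto
  moreover have "0 < (norm x)\<^sup>2 + s\<^sup>2" using assms by (simp add: add_nonneg_pos)
  moreover have "(norm x)\<^sup>2 + s\<^sup>2 \<le> 2 * t * s * (e \<bullet> x)" using assms(3) by (simp add: hyperbolic_ball_def)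
  ultimately show False by linarith
qed

lemma hyperbolic_ball_mono:
  assumes "0 < s" "0 \<le> t" "t \<le> t'"
  shows "hyperbolic_ball e t s \<subseteq> hyperbolic_ball e t' s"
proof
  fix x assume x: "x \<in> hyperbolic_ball e t s"
  have "2 * t * s * (e \<bullet> x) \<le> 2 * t' * s * (e \<bullet> x)"
    using assms hyperbolic_ball_inner_pos[OF assms(1,2) x] by (intro mult_right_mono) auto
  then show "x \<in> hyperbolic_ball e t' s" using x by (simp add: hyperbolic_ball_def)
qed

text \<open>Points of the first ball have |x| < 2 t, while the second requires |x|^2 + 64 t^2 \<le>
  32 t |x|; the scale 8 t makes these incompatible.\<close>

lemma hyperbolic_ball_disjoint:
  assumes e: "norm e = 1" and t: "1 < t"
  shows "hyperbolic_ball e t 1 \<inter> hyperbolic_ball e 2 (8 * t) = {}"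
proof (rule equals0I)
  fix x assume x: "x \<in> hyperbolic_ball e t 1 \<inter> hyperbolic_ball e 2 (8 * t)"
  have ex: "e \<bullet> x \<le> norm x" using norm_cauchy_schwarz[of e x] e by simp
  then have "t * (e \<bullet> x) \<le> t * norm x" using t by simp
  then have 1: "(norm x)\<^sup>2 + 1 \<le> 2 * t * norm x" and 2: "(norm x)\<^sup>2 + 64 * (t * t) \<le> 32 * (t * norm x)"
    using x by (auto simp: hyperbolic_ball_def power2_eq_square)
  have "norm x < 2 * t"
  proof (rule ccontr)
    assume "\<not> norm x < 2 * t"
    then have "2 * t * norm x \<le> norm x * norm x" by (intro mult_right_mono) auto
    then show False using 1 by (simp add: power2_eq_square)
  qed
  then have "t * norm x < t * (2 * t)" using t by (intro mult_strict_left_mono) auto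
  moreover have "t * (2 * t) = 2 * (t * t)" by simp
  ultimately show False using 2 zero_le_power2[of "norm x"] by linarith
qed

text \<open>Any dilate of a ball of fixed shape fits into a ball of scale 1 with large parameter.
  Its points satisfy s \<le> 2 (e . x), hence 1 \<le> (2/s)(e . x), which pays for the constant 1 in
  the target inequality.\<close>

lemma hyperbolic_ball_scaled_subset:
  assumes "0 < s" "s + 1 / s \<le> T"
  shows "hyperbolic_ball e 2 (2 * s) \<subseteq> hyperbolic_ball e (4 * T) 1"
proof
  fix x assume x: "x \<in> hyperbolic_ball e 2 (2 * s)"
  have ex: "0 < e \<bullet> x" by (rule hyperbolic_ball_inner_pos[OF _ _ x]) (use assms in auto)
  have 1: "(norm x)\<^sup>2 + 4 * s\<^sup>2 \<le> 8 * s * (e \<bullet> x)" using x by (simp add: hyperbolic_ball_def power_mult_distrib)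
  then have "4 * s\<^sup>2 \<le> 8 * s * (e \<bullet> x)" using zero_le_power2[of "norm x"] by linarith
  then have "s \<le> 2 * (e \<bullet> x)" using assms(1) by (simp add: power2_eq_square)
  then have "1 \<le> 2 / s * (e \<bullet> x)" using assms(1) by (simp add: field_simps)
  moreover have "8 * (1 / s) * (e \<bullet> x) = 4 * (2 / s * (e \<bullet> x))" by simp
  ultimately have "(norm x)\<^sup>2 + 1 \<le> 8 * s * (e \<bullet> x) + 8 * (1 / s) * (e \<bullet> x)"
    using 1 zero_le_power2[of s] by linarith
  also have "\<dots> = 8 * ((s + 1 / s) * (e \<bullet> x))" by (simp add: algebra_simps)
  also have "\<dots> \<le> 8 * (T * (e \<bullet> x))" using assms ex by (intro mult_left_mono mult_right_mono) auto
  finally show "x \<in> hyperbolic_ball e (4 * T) 1" by (simp add: hyperbolic_ball_def)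
qed

section \<open>Positivity, monotonicity, continuity and growth of \<open>f_fun\<close>\<close>

context
  fixes \<beta> :: real
  assumes \<beta>: "- 2 < \<beta>" "\<beta> \<le> 2"
begin

text \<open>Read off from the ball integral instead of the hypergeometric expression. Any unit
  vector will do, hence \<open>axis undefined 1\<close>.\<close>

lemma f_fun_nonneg:
  assumes t: "1 < t"
  shows "0 \<le> f_fun CARD('n::finite) \<beta> t"
proof -
  have e: "norm (axis undefined 1 :: real ^ 'n) = 1" by simp
  have "0 \<le> (LINT x:hyperbolic_ball (axis undefined 1 :: real ^ 'n) t 1|lborel. norm x powr (\<beta> - DIM(real^'n)))"
    unfolding set_lebesgue_integral_def by (rule Bochner_Integration.integral_nonneg) simp
  then have "0 \<le> unit_ball_vol (real CARD('n)) * f_fun CARD('n) \<beta> t"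
    using hyperbolic_ball_f_fun[OF e t zero_less_one \<beta>] by simp
  then show ?thesis using unit_ball_vol_nat_pos[of "CARD('n)"] by (meson mult_pos_neg not_le)
qed

text \<open>The balls are nested and the weight is positive on them. Equal integrals would make them
  equal almost everywhere, but their volumes differ.\<close>

lemma f_fun_strict_mono:
  assumes t: "1 < t" "t < t'"
  shows "f_fun CARD('n::finite) \<beta> t < f_fun CARD('n) \<beta> t'"
proof -
  define e where "e = (axis undefined 1 :: real ^ 'n)"
  have e: "norm e = 1" by (simp add: e_def)
  define B where "B = hyperbolic_ball e t 1"
  define B' where "B' = hyperbolic_ball e t' 1"
  define V where "V = unit_ball_vol (real CARD('n))"
  have V: "V > 0" unfolding V_def by (rule unit_ball_vol_nat_pos)
  define w where "w x = 1 * norm x powr (\<beta> - CARD('n))" for x :: "real ^ 'n"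
  have sub: "B \<subseteq> B'" unfolding B_def B'_def using t by (intro hyperbolic_ball_mono) auto
  have i: "integrable lborel (\<lambda>x. indicator B x * w x)" "integrable lborel (\<lambda>x. indicator B' x * w x)"
    unfolding B_def B'_def w_def using t
    by (intro hyperbolic_ball_powr_integrable[OF e _ zero_less_one] continuous_on_const; simp)+
  have eq: "(LBINT x. indicator B x * w x) = V * f_fun CARD('n) \<beta> t"
    "(LBINT x. indicator B' x * w x) = V * f_fun CARD('n) \<beta> t'"
    using hyperbolic_ball_f_fun[OF e _ zero_less_one \<beta>, of t] hyperbolic_ball_f_fun[OF e _ zero_less_one \<beta>, of t'] t
    by (simp_all add: V_def B_def B'_def w_def set_lebesgue_integral_def)
  define d where "d x = indicator B' x * w x - indicator B x * w x" for x
  have d0: "0 \<le> d x" for x using sub by (auto simp: d_def w_def indicator_def)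
  have di: "integrable lborel d" unfolding d_def using i by (intro Bochner_Integration.integrable_diff)
  have D: "(LBINT x. d x) = V * f_fun CARD('n) \<beta> t' - V * f_fun CARD('n) \<beta> t"
    unfolding d_def eq[symmetric] by (rule Bochner_Integration.integral_diff[OF i(2,1)])
  have "(LBINT x. d x) \<noteq> 0"
  proof
    assume "(LBINT x. d x) = 0"
    then have "AE x in lborel. d x = 0"
      using integral_nonneg_eq_0_iff_AE[OF di] d0 by simp
    then have "AE x in lborel. x \<in> B \<longleftrightarrow> x \<in> B'"
    proof eventually_elim
      case (elim x)
      then show ?case
        using sub hyperbolic_ball_nonzero[of 1 x e t'] by (auto simp: d_def w_def B'_def indicator_def split: if_splits)
    qed
    then have "measure lborel B = measure lborel B'"
      by (intro measure_eq_AE) (auto simp: B_def B'_def)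
    moreover have m: "measure lborel (hyperbolic_ball e u 1) = V * sqrt (u\<^sup>2 - 1) ^ CARD('n)" if "1 < u" for u
      using that hyperbolic_ball_eq_cball[OF e, of u 1] content_cball[of "sqrt (u\<^sup>2 - 1)" "u *\<^sub>R e"]
      by (simp add: V_def one_le_power)
    moreover have "sqrt (t\<^sup>2 - 1) ^ CARD('n) < sqrt (t'\<^sup>2 - 1) ^ CARD('n)"
    proof (rule power_strict_mono)
      have "t\<^sup>2 < t'\<^sup>2" using t by (intro power_strict_mono) auto
      then show "sqrt (t\<^sup>2 - 1) < sqrt (t'\<^sup>2 - 1)" by simp
    qed (use t in \<open>auto simp: one_le_power\<close>)
    ultimately show False using t V by (simp add: B_def B'_def)
  qed
  moreover have "0 \<le> (LBINT x. d x)" using d0 by simp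
  ultimately have "0 < (LBINT x. d x)" by linarith
  then have "0 < V * (f_fun CARD('n) \<beta> t' - f_fun CARD('n) \<beta> t)"
    unfolding D right_diff_distrib .
  then show ?thesis using V by (simp add: zero_less_mult_iff)
qed

lemma f_fun_pos:
  assumes t: "1 < t"
  shows "0 < f_fun CARD('n::finite) \<beta> t"
proof -
  have "0 \<le> f_fun CARD('n) \<beta> ((1 + t) / 2)" using t by (intro f_fun_nonneg) simp
  also have "\<dots> < f_fun CARD('n) \<beta> t" using t by (intro f_fun_strict_mono) auto
  finally show ?thesis .
qed

text \<open>The endpoint t = 1 is included, although the ball formula is stated only for t > 1, so
  that the intermediate value theorem can start from the value 0.\<close>

lemma f_fun_continuous: "continuous_on {1..} (f_fun CARD('n::finite) \<beta>)"
proof -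
  have n: "real CARD('n) \<ge> 1" by (simp add: Suc_leI)
  have "(2 - \<beta>) / 2 = 0 \<or> 0 < (2 - \<beta>) / 2 \<and> (2 - \<beta>) / 2 < (real CARD('n) + 2) / 2 \<or>
      0 < (2 + \<beta>) / 2 \<and> (2 + \<beta>) / 2 < (real CARD('n) + 2) / 2"
  proof -
    consider "\<beta> = 2" | "0 < \<beta>" "\<beta> < 2" | "- 2 < \<beta>" "\<beta> \<le> 0" using \<beta> by linarith
    then show ?thesis
    proof cases
      case 2
      have "0 < (2 - \<beta>) / 2" using 2 by simp
      moreover have "(2 - \<beta>) / 2 < (real CARD('n) + 2) / 2" using n 2 by (intro divide_strict_right_mono) linarith+
      ultimately show ?thesis by blast
    next
      case 3
      have "0 < (2 + \<beta>) / 2" using 3 by simp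
      moreover have "(2 + \<beta>) / 2 < (real CARD('n) + 2) / 2" using n 3 by (intro divide_strict_right_mono) linarith+
      ultimately show ?thesis by blast
    qed simp
  qed
  from hypergeo_2F1_real_continuous[OF this]
  have "continuous_on {1..} (\<lambda>t. hypergeo_2F1_real ((2 - \<beta>) / 2) ((2 + \<beta>) / 2) ((real CARD('n) + 2) / 2) (1 - t\<^sup>2))"
    by (rule continuous_on_compose2) (auto intro!: continuous_intros)
  moreover have "continuous_on {1..} (\<lambda>t::real. t powr (2 - real CARD('n)))"
    by (intro continuous_intros) auto
  moreover have "continuous_on {1..} (\<lambda>t::real. (t\<^sup>2 - 1) powr (real CARD('n) / 2))"
    by (intro continuous_on_powr' continuous_intros) (auto simp: one_le_power)
  ultimately show ?thesis
    unfolding f_fun_def[abs_def] by (intro continuous_on_mult)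
qed

lemma f_fun_1: "f_fun CARD('n::finite) \<beta> 1 = 0"
  by (simp add: f_fun_def)

text \<open>Beside the ball with parameter t lies a disjoint dilate of the ball with parameter 2,
  and a larger ball of scale 1 contains both. For \<beta> \<ge> 0 dilation by a factor s \<ge> 1
  does not decrease the integral, so each such step adds at least the fixed amount
  \<open>c\<close>.\<close>

lemma f_fun_unbounded:
  assumes "0 \<le> \<beta>"
  obtains t where "T \<le> t" "1 < t" "M \<le> f_fun CARD('n::finite) \<beta> t"
proof -
  define e where "e = (axis undefined 1 :: real ^ 'n)"
  have e: "norm e = 1" by (simp add: e_def)
  define c where "c = f_fun CARD('n) \<beta> 2"
  have c: "c > 0" unfolding c_def by (rule f_fun_pos) simp
  define V where "V = unit_ball_vol (real CARD('n))"
  have V: "V > 0" unfolding V_def by (rule unit_ball_vol_nat_pos)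
  define w where "w x = 1 * norm x powr (\<beta> - CARD('n))" for x :: "real ^ 'n"
  have I: "integrable lborel (\<lambda>x. indicator (hyperbolic_ball e t s) x * w x)"
    "(LBINT x. indicator (hyperbolic_ball e t s) x * w x) = V * (s powr \<beta> * f_fun CARD('n) \<beta> t)" if "1 < t" "0 < s" for t s
  proof -
    show "integrable lborel (\<lambda>x. indicator (hyperbolic_ball e t s) x * w x)"
      unfolding w_def using that by (intro hyperbolic_ball_powr_integrable[OF e]) auto
    show "(LBINT x. indicator (hyperbolic_ball e t s) x * w x) = V * (s powr \<beta> * f_fun CARD('n) \<beta> t)"
      using hyperbolic_ball_f_fun[OF e that \<beta>] by (simp add: V_def w_def set_lebesgue_integral_def)
  qed
  have step: "\<exists>t'>t. f_fun CARD('n) \<beta> t + c \<le> f_fun CARD('n) \<beta> t'" if t: "1 < t" for t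
  proof -
    define s where "s = 8 * t"
    \<comment> \<open>The parameter that \<open>hyperbolic_ball_scaled_subset\<close> yields for the
      dilation s / 2.\<close>
    define t' where "t' = 4 * (s / 2 + 1 / (s / 2))"
    have s: "1 < s" using t by (simp add: s_def)
    have tt': "t < t'" using t by (simp add: t'_def s_def add_pos_pos)
    have sub1: "hyperbolic_ball e t 1 \<subseteq> hyperbolic_ball e t' 1"
      using t tt' by (intro hyperbolic_ball_mono) auto
    have sub2: "hyperbolic_ball e 2 s \<subseteq> hyperbolic_ball e t' 1"
      using hyperbolic_ball_scaled_subset[of "s / 2" "s / 2 + 1 / (s / 2)" e] s by (simp add: t'_def)
    have disj: "hyperbolic_ball e t 1 \<inter> hyperbolic_ball e 2 s = {}"
      unfolding s_def by (rule hyperbolic_ball_disjoint[OF e t])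
    have "(LBINT x. indicator (hyperbolic_ball e t 1) x * w x + indicator (hyperbolic_ball e 2 s) x * w x)
       \<le> (LBINT x. indicator (hyperbolic_ball e t' 1) x * w x)"
    proof (rule integral_mono)
      fix x
      show "indicator (hyperbolic_ball e t 1) x * w x + indicator (hyperbolic_ball e 2 s) x * w x
         \<le> indicator (hyperbolic_ball e t' 1) x * w x"
        using sub1 sub2 disj by (auto simp: indicator_def w_def)
    qed (use I[of t 1] I[of 2 s] I[of t' 1] t tt' s in auto)
    also have "(LBINT x. indicator (hyperbolic_ball e t 1) x * w x + indicator (hyperbolic_ball e 2 s) x * w x)
      = V * (1 powr \<beta> * f_fun CARD('n) \<beta> t) + V * (s powr \<beta> * c)"
      using I[of t 1] I[of 2 s] t s by (subst Bochner_Integration.integral_add) (auto simp: c_def)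
    finally have "V * (f_fun CARD('n) \<beta> t + s powr \<beta> * c) \<le> V * f_fun CARD('n) \<beta> t'"
      using I(2)[of t' 1] t tt' by (simp add: algebra_simps)
    then have "f_fun CARD('n) \<beta> t + s powr \<beta> * c \<le> f_fun CARD('n) \<beta> t'" using V by simp
    moreover have "1 * c \<le> s powr \<beta> * c" using s assms c by (intro mult_right_mono ge_one_powr_ge_zero) auto
    ultimately show ?thesis using tt' by (intro exI[of _ t']) auto
  qed
  define t0 where "t0 = max 2 T"
  have ex: "\<exists>t\<ge>t0. real N * c \<le> f_fun CARD('n) \<beta> t" for N
  proof (induction N)
    case 0
    show ?case using f_fun_nonneg[where 'n='n, of t0] by (intro exI[of _ t0]) (auto simp: t0_def)
  next
    case (Suc N)
    then obtain t where t: "t \<ge> t0" "real N * c \<le> f_fun CARD('n) \<beta> t" by blast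
    then obtain t' where "t' > t" "f_fun CARD('n) \<beta> t + c \<le> f_fun CARD('n) \<beta> t'"
      using step[of t] by (auto simp: t0_def)
    then show ?case using t by (intro exI[of _ t']) (auto simp: algebra_simps)
  qed
  obtain N where "M / c \<le> real N" using real_arch_simple by blast
  then have "M \<le> real N * c" using c by (simp add: divide_le_eq)
  moreover obtain t where "t \<ge> t0" "real N * c \<le> f_fun CARD('n) \<beta> t" using ex by blast
  ultimately show ?thesis by (intro that[of t]) (auto simp: t0_def)
qed

end

section \<open>The variational problem\<close>

lemma admissible_density_integral:
  fixes \<rho> :: "real ^ 'n \<Rightarrow> real"
  assumes "admissible_density \<rho>" "F_fun \<beta> \<rho> = ennreal u" "0 \<le> u"
  shows "has_bochner_integral lebesgue_normalized (\<lambda>x. \<rho> x / norm x powr (real CARD('n) - \<beta>)) u"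
proof (rule has_bochner_integral_nn_integral)
  have [measurable]: "\<rho> \<in> borel_measurable lebesgue"
    using assms(1) by (simp add: admissible_density_def)
  have [measurable]: "(\<lambda>x::real^'n. norm x powr (real CARD('n) - \<beta>)) \<in> borel_measurable lebesgue"
    by (intro measurable_completion) simp
  show "(\<lambda>x. \<rho> x / norm x powr (real CARD('n) - \<beta>)) \<in> borel_measurable lebesgue_normalized"
    unfolding measurable_lebesgue_normalized by measurable
  show "AE x in lebesgue_normalized. 0 \<le> \<rho> x / norm x powr (real CARD('n) - \<beta>)"
    using assms(1) by (simp add: admissible_density_def)
qed (use assms in \<open>simp_all add: F_fun_def\<close>)

lemma admissible_density_hyperbolic_ball:
  assumes "0 < s"
  shows "admissible_density (indicator (hyperbolic_ball e t s))"
proof -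
  have "{x. indicator (hyperbolic_ball e t s) x \<noteq> (0::real)} = hyperbolic_ball e t s"
    by (auto simp: indicator_def)
  moreover have "0 \<notin> hyperbolic_ball e t s" using hyperbolic_ball_nonzero[OF assms] by blast
  ultimately have "0 \<notin> closure {x. indicator (hyperbolic_ball e t s) x \<noteq> (0::real)}"
    by (simp add: closure_closed[OF hyperbolic_ball_closed])
  moreover have "indicator (hyperbolic_ball e t s) \<in> borel_measurable lebesgue"
    by (intro measurable_completion) simp
  ultimately show ?thesis by (simp add: admissible_density_def)
qed

lemma feasible_hyperbolic_ball:
  fixes e :: "real ^ 'n"
  assumes "norm e = 1" "1 < t" "0 < s" "0 < \<alpha>" "\<alpha> \<le> 2"
    and "u = s powr \<alpha> * f_fun CARD('n) \<alpha> t" "v = s powr (\<alpha> - 2) * f_fun CARD('n) (\<alpha> - 2) t"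
  shows "indicator (hyperbolic_ball e t s) \<in> feasible_densities \<alpha> u v"
  using assms f_fun_nonneg[where 'n='n, of \<alpha> t] f_fun_nonneg[where 'n='n, of "\<alpha> - 2" t]
  by (simp add: feasible_densities_def admissible_density_hyperbolic_ball F_fun_hyperbolic_ball)

text \<open>The bathtub principle: with weight \<open>w = |x|\<^bsup>\<alpha>-n-2\<^esup>\<close>, the functional
  \<open>\<rho> \<mapsto> \<integral> (2 t s (e \<bullet> x) - |x|\<^sup>2 - s\<^sup>2) w \<rho>\<close> is maximised by the indicator of the set where the
  bracket is nonnegative, and its last two terms are fixed by the constraints.\<close>

lemma feasible_bound:
  fixes e :: "real ^ 'n"
  assumes e: "norm e = 1" and t: "1 < t" and s: "0 < s" and \<alpha>: "0 < \<alpha>" "\<alpha> \<le> 2"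
    and uv: "u = s powr \<alpha> * f_fun CARD('n) \<alpha> t" "v = s powr (\<alpha> - 2) * f_fun CARD('n) (\<alpha> - 2) t"
    and \<rho>: "\<rho> \<in> feasible_densities \<alpha> u v"
  shows "(LINT x|lebesgue_normalized. (e \<bullet> x) * \<rho> x / norm x powr (real CARD('n) + 2 - \<alpha>))
     \<le> s powr (\<alpha> - 1) * h_fun CARD('n) \<alpha> t"
proof -
  define w where "w x = 1 / norm x powr (real CARD('n) + 2 - \<alpha>)" for x :: "real ^ 'n"
  have w0: "0 \<le> w x" for x by (simp add: w_def)
  have [measurable]: "w \<in> borel_measurable borel" unfolding w_def by measurable
  have w2: "(norm x)\<^sup>2 * w x = 1 / norm x powr (real CARD('n) - \<alpha>)" for x
  proof (cases "x = 0")
    case False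
    have "real CARD('n) + 2 - \<alpha> = 2 + (real CARD('n) - \<alpha>)" by simp
    then have "norm x powr (real CARD('n) + 2 - \<alpha>) = (norm x)\<^sup>2 * norm x powr (real CARD('n) - \<alpha>)"
      using False by (simp only: powr_add) (simp add: powr_numeral)
    then show ?thesis using False by (simp add: w_def)
  qed (simp add: w_def)
  define I where "I \<sigma> = (LINT x|lebesgue_normalized. (e \<bullet> x) * (\<sigma> x * w x))" for \<sigma>
  have *: "has_bochner_integral lebesgue_normalized (\<lambda>x. (norm x)\<^sup>2 * (\<sigma> x * w x)) u"
    "has_bochner_integral lebesgue_normalized (\<lambda>x. \<sigma> x * w x) v"
    "has_bochner_integral lebesgue_normalized (\<lambda>x. (e \<bullet> x) * (\<sigma> x * w x)) (I \<sigma>)"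
    if \<sigma>: "\<sigma> \<in> feasible_densities \<alpha> u v" for \<sigma>
  proof -
    have f: "admissible_density \<sigma>" "0 \<le> u" "0 \<le> v" "F_fun \<alpha> \<sigma> = ennreal u" "F_fun (\<alpha> - 2) \<sigma> = ennreal v"
      using \<sigma> by (auto simp: feasible_densities_def)
    have "(norm x)\<^sup>2 * (\<sigma> x * w x) = \<sigma> x / norm x powr (real CARD('n) - \<alpha>)" for x
    proof -
      have "(norm x)\<^sup>2 * (\<sigma> x * w x) = \<sigma> x * ((norm x)\<^sup>2 * w x)" by simp
      then show ?thesis unfolding w2 by simp
    qed
    then show 1: "has_bochner_integral lebesgue_normalized (\<lambda>x. (norm x)\<^sup>2 * (\<sigma> x * w x)) u"
      using admissible_density_integral[OF f(1,4,2)] by simp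
    have "\<sigma> x * w x = \<sigma> x / norm x powr (real CARD('n) - (\<alpha> - 2))" for x
      by (simp add: w_def algebra_simps)
    then show 2: "has_bochner_integral lebesgue_normalized (\<lambda>x. \<sigma> x * w x) v"
      using admissible_density_integral[OF f(1,5,3)] by simp
    \<comment> \<open>Here |e . x| \<le> |x| \<le> |x|^2 + 1, so the two constraint integrals
      dominate.\<close>
    have "integrable lebesgue_normalized (\<lambda>x. (e \<bullet> x) * (\<sigma> x * w x))"
    proof (rule Bochner_Integration.integrable_bound)
      show "integrable lebesgue_normalized (\<lambda>x. (norm x)\<^sup>2 * (\<sigma> x * w x) + \<sigma> x * w x)"
        using 1 2 by (intro Bochner_Integration.integrable_add) (auto simp: has_bochner_integral_iff)
      have [measurable]: "\<sigma> \<in> borel_measurable lebesgue" "w \<in> borel_measurable lebesgue"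
        "(\<lambda>x. e \<bullet> x) \<in> borel_measurable lebesgue"
        using f(1) by (auto simp: admissible_density_def intro!: measurable_completion)
      show "(\<lambda>x. (e \<bullet> x) * (\<sigma> x * w x)) \<in> borel_measurable lebesgue_normalized"
        unfolding measurable_lebesgue_normalized by measurable
      show "AE x in lebesgue_normalized. norm ((e \<bullet> x) * (\<sigma> x * w x)) \<le> norm ((norm x)\<^sup>2 * (\<sigma> x * w x) + \<sigma> x * w x)"
      proof (rule AE_I2)
        fix x
        have q: "0 \<le> \<sigma> x * w x" using f(1) w0 by (simp add: admissible_density_def)
        have "\<bar>e \<bullet> x\<bar> \<le> norm x" using Cauchy_Schwarz_ineq2[of e x] e by simp
        also have "norm x \<le> (norm x)\<^sup>2 + 1"
          using zero_le_power2[of "norm x - 1 / 2"] by (simp add: power2_eq_square algebra_simps)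
        finally have "\<bar>e \<bullet> x\<bar> * (\<sigma> x * w x) \<le> ((norm x)\<^sup>2 + 1) * (\<sigma> x * w x)"
          using q by (rule mult_right_mono)
        also have "\<dots> = (norm x)\<^sup>2 * (\<sigma> x * w x) + \<sigma> x * w x" by (simp add: algebra_simps)
        finally show "norm ((e \<bullet> x) * (\<sigma> x * w x)) \<le> norm ((norm x)\<^sup>2 * (\<sigma> x * w x) + \<sigma> x * w x)"
          using q unfolding real_norm_def abs_mult[of "e \<bullet> x"] abs_of_nonneg[OF q] by linarith
      qed
    qed
    then show "has_bochner_integral lebesgue_normalized (\<lambda>x. (e \<bullet> x) * (\<sigma> x * w x)) (I \<sigma>)"
      unfolding I_def by (rule has_bochner_integral_integrable)
  qed
  define \<rho>' where "\<rho>' = (indicator (hyperbolic_ball e t s) :: real ^ 'n \<Rightarrow> real)"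
  have \<rho>': "\<rho>' \<in> feasible_densities \<alpha> u v"
    unfolding \<rho>'_def by (rule feasible_hyperbolic_ball[OF e t s \<alpha> uv])
  \<comment> \<open>The product (\<rho>' - \<rho>) (2 t s (e . x) - |x|^2 - s^2) w, expanded into
    pieces with known integrals; the constraint pieces integrate to u - u and v - v. It is
    nonnegative because both factors change sign together.\<close>
  define D where "D x = 2 * t * s * ((e \<bullet> x) * (\<rho>' x * w x) - (e \<bullet> x) * (\<rho> x * w x))
         - ((norm x)\<^sup>2 * (\<rho>' x * w x) - (norm x)\<^sup>2 * (\<rho> x * w x))
         - s\<^sup>2 * (\<rho>' x * w x - \<rho> x * w x)" for x
  have "has_bochner_integral lebesgue_normalized D
      (2 * t * s * (I \<rho>' - I \<rho>) - (u - u) - s\<^sup>2 * (v - v))"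
    unfolding D_def[abs_def]
    by (intro has_bochner_integral_diff has_bochner_integral_mult_right *[OF \<rho>] *[OF \<rho>'])
  moreover have "0 \<le> D x" for x
  proof -
    have r: "0 \<le> \<rho> x" "\<rho> x \<le> 1" using \<rho> by (auto simp: feasible_densities_def admissible_density_def)
    have "0 \<le> (\<rho>' x - \<rho> x) * (2 * t * s * (e \<bullet> x) - ((norm x)\<^sup>2 + s\<^sup>2))"
    proof (cases "x \<in> hyperbolic_ball e t s")
      case True
      then show ?thesis using r by (intro mult_nonneg_nonneg) (auto simp: \<rho>'_def hyperbolic_ball_def)
    next
      case False
      then show ?thesis using r by (intro mult_nonpos_nonpos) (auto simp: \<rho>'_def hyperbolic_ball_def)
    qed
    then have "0 \<le> (\<rho>' x - \<rho> x) * (2 * t * s * (e \<bullet> x) - ((norm x)\<^sup>2 + s\<^sup>2)) * w x"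
      using w0 by (rule mult_nonneg_nonneg)
    then show ?thesis by (simp add: D_def algebra_simps)
  qed
  then have "0 \<le> (LINT x|lebesgue_normalized. D x)" by simp
  ultimately have "0 \<le> 2 * t * s * (I \<rho>' - I \<rho>) - (u - u) - s\<^sup>2 * (v - v)"
    by (simp only: has_bochner_integral_integral_eq)
  then have "0 \<le> 2 * t * s * (I \<rho>' - I \<rho>)" by simp
  moreover have "0 < 2 * t * s" using t s by simp
  ultimately have "0 \<le> I \<rho>' - I \<rho>" by (meson mult_pos_neg not_le)
  then have "I \<rho> \<le> I \<rho>'" by simp
  moreover have "I \<rho>' = s powr (\<alpha> - 1) * h_fun CARD('n) \<alpha> t"
    using H_integral_hyperbolic_ball[OF e t s \<alpha>] by (simp add: I_def \<rho>'_def w_def)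
  ultimately show ?thesis by (simp add: I_def w_def)
qed

text \<open>The bathtub bound for -e is the lower bound for \<open>H_fun\<close>, so the absolute
  value is controlled. The ball in direction \<open>e\<close> attains the bound, hence the supremum
  is a maximum.\<close>

lemma N_fun_eq:
  fixes k :: "'n::finite"
  assumes t: "1 < t" and s: "0 < s" and \<alpha>: "0 < \<alpha>" "\<alpha> \<le> 2"
    and uv: "u = s powr \<alpha> * f_fun CARD('n) \<alpha> t" "v = s powr (\<alpha> - 2) * f_fun CARD('n) (\<alpha> - 2) t"
  shows "N_fun k \<alpha> u v = ereal ((s powr (\<alpha> - 1) * h_fun CARD('n) \<alpha> t)\<^sup>2)"
proof -
  define X where "X = s powr (\<alpha> - 1) * h_fun CARD('n) \<alpha> t"
  define e where "e = (axis k 1 :: real ^ 'n)"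
  have e: "norm e = 1" "norm (- e) = 1" by (simp_all add: e_def)
  have ex: "e \<bullet> x = x $ k" for x by (simp add: e_def inner_axis')
  have le: "\<bar>H_fun k \<alpha> \<rho>\<bar> \<le> X" if "\<rho> \<in> feasible_densities \<alpha> u v" for \<rho> :: "real ^ 'n \<Rightarrow> real"
    using feasible_bound[OF e(1) t s \<alpha> uv that] feasible_bound[OF e(2) t s \<alpha> uv that]
    by (simp add: H_fun_def X_def ex abs_le_iff)
  have feas: "indicator (hyperbolic_ball e t s) \<in> feasible_densities \<alpha> u v"
    by (rule feasible_hyperbolic_ball[OF e(1) t s \<alpha> uv])
  have H: "H_fun k \<alpha> (indicator (hyperbolic_ball e t s)) = X"
    using H_integral_hyperbolic_ball[OF e(1) t s \<alpha>] by (simp add: H_fun_def X_def ex)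
  show ?thesis
    unfolding N_fun_def X_def[symmetric]
  proof (rule antisym)
    show "(SUP \<rho>\<in>feasible_densities \<alpha> u v. ereal (\<bar>H_fun k \<alpha> \<rho>\<bar>\<^sup>2)) \<le> ereal (X\<^sup>2)"
    proof (rule SUP_least)
      fix \<rho> :: "real ^ 'n \<Rightarrow> real" assume "\<rho> \<in> feasible_densities \<alpha> u v"
      from power_mono[OF le[OF this] abs_ge_zero, of 2]
      show "ereal (\<bar>H_fun k \<alpha> \<rho>\<bar>\<^sup>2) \<le> ereal (X\<^sup>2)" by simp
    qed
    show "ereal (X\<^sup>2) \<le> (SUP \<rho>\<in>feasible_densities \<alpha> u v. ereal (\<bar>H_fun k \<alpha> \<rho>\<bar>\<^sup>2))"
      by (rule SUP_upper2[OF feas]) (simp add: H)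
  qed
qed

section \<open>The equation for t\<close>

context
  fixes \<alpha> :: real
  assumes \<alpha>: "0 < \<alpha>" "\<alpha> \<le> 2"
begin

text \<open>The scale is solved from the first constraint. Substituted into the relation between t
  and (u, v), it yields the \<alpha>-th power of the second constraint, and a root can be taken
  because all quantities are positive.\<close>

lemma scale_exists:
  assumes t: "1 < t" and u: "0 < u" and v: "0 < v"
    and eq: "f_fun CARD('n::finite) \<alpha> t powr (2 - \<alpha>) * f_fun CARD('n) (\<alpha> - 2) t powr \<alpha> = u powr (2 - \<alpha>) * v powr \<alpha>"
  defines "s \<equiv> (u / f_fun CARD('n) \<alpha> t) powr (1 / \<alpha>)"
  shows "0 < s" "u = s powr \<alpha> * f_fun CARD('n) \<alpha> t" "v = s powr (\<alpha> - 2) * f_fun CARD('n) (\<alpha> - 2) t"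
proof -
  define f where "f = f_fun CARD('n) \<alpha> t"
  define g where "g = f_fun CARD('n) (\<alpha> - 2) t"
  have f: "f > 0" and g: "g > 0" unfolding f_def g_def using \<alpha> t by (auto intro!: f_fun_pos)
  show s: "0 < s" using u f by (simp add: s_def f_def)
  have sa: "s powr \<alpha> = u / f" using \<alpha> u f by (simp add: s_def f_def powr_powr)
  then show u': "u = s powr \<alpha> * f_fun CARD('n) \<alpha> t" using f by (simp add: f_def)
  have "u powr (2 - \<alpha>) * v powr \<alpha> = f powr (2 - \<alpha>) * g powr \<alpha>" using eq by (simp add: f_def g_def)
  also have "u = s powr \<alpha> * f" using u' by (simp add: f_def)
  also have "(s powr \<alpha> * f) powr (2 - \<alpha>) = (s powr \<alpha>) powr (2 - \<alpha>) * f powr (2 - \<alpha>)"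
    using f by (simp add: powr_mult)
  finally have "(s powr \<alpha>) powr (2 - \<alpha>) * v powr \<alpha> = g powr \<alpha>" using f by simp
  moreover have "(s powr \<alpha>) powr (2 - \<alpha>) = 1 / (s powr (\<alpha> - 2)) powr \<alpha>"
    unfolding powr_powr using s by (simp add: powr_minus[symmetric] divide_inverse algebra_simps)
  ultimately have "v powr \<alpha> = (s powr (\<alpha> - 2)) powr \<alpha> * g powr \<alpha>" using s by (simp add: field_simps)
  also have "\<dots> = (s powr (\<alpha> - 2) * g) powr \<alpha>" using g by (simp add: powr_mult)
  finally have "(v powr \<alpha>) powr (1 / \<alpha>) = ((s powr (\<alpha> - 2) * g) powr \<alpha>) powr (1 / \<alpha>)" by simp
  then show "v = s powr (\<alpha> - 2) * f_fun CARD('n) (\<alpha> - 2) t"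
    unfolding powr_powr using \<alpha> v g s by (simp add: g_def)
qed

text \<open>At \<alpha> = 2 the first factor is constant, so strictness has to come from the second,
  whose exponent \<alpha> is positive.\<close>

lemma constraint_strict_mono:
  assumes t: "1 < t" "t < t'"
  shows "f_fun CARD('n::finite) \<alpha> t powr (2 - \<alpha>) * f_fun CARD('n) (\<alpha> - 2) t powr \<alpha>
     < f_fun CARD('n) \<alpha> t' powr (2 - \<alpha>) * f_fun CARD('n) (\<alpha> - 2) t' powr \<alpha>"
proof (rule mult_le_less_imp_less)
  have 1: "0 < f_fun CARD('n) \<alpha> t" "0 < f_fun CARD('n) (\<alpha> - 2) t"
    using \<alpha> t by (auto intro!: f_fun_pos)
  have 2: "f_fun CARD('n) \<alpha> t < f_fun CARD('n) \<alpha> t'" "f_fun CARD('n) (\<alpha> - 2) t < f_fun CARD('n) (\<alpha> - 2) t'"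
    using \<alpha> t by (auto intro!: f_fun_strict_mono)
  show "f_fun CARD('n) \<alpha> t powr (2 - \<alpha>) \<le> f_fun CARD('n) \<alpha> t' powr (2 - \<alpha>)"
    using 1 2 \<alpha> by (intro powr_mono2) auto
  show "f_fun CARD('n) (\<alpha> - 2) t powr \<alpha> < f_fun CARD('n) (\<alpha> - 2) t' powr \<alpha>"
    using 1 2 \<alpha> by (intro powr_less_mono2) auto
  show "0 < f_fun CARD('n) \<alpha> t powr (2 - \<alpha>)" using 1 by simp
qed simp

lemma constraint_solvable:
  assumes M: "0 < M"
  shows "\<exists>t>1. f_fun CARD('n::finite) \<alpha> t powr (2 - \<alpha>) * f_fun CARD('n) (\<alpha> - 2) t powr \<alpha> = M"
proof -
  let ?f = "f_fun CARD('n) \<alpha>" and ?g = "f_fun CARD('n) (\<alpha> - 2)"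
  \<comment> \<open>At \<open>t = 1\<close> the first factor is \<open>0 powr (2 - \<alpha>)\<close>, hence \<open>0\<close> and not \<open>1\<close> for \<open>\<alpha> = 2\<close>.\<close>
  define p where "p t = (if \<alpha> = 2 then 1 else ?f t powr (2 - \<alpha>))" for t
  have p: "p t = ?f t powr (2 - \<alpha>)" if "1 < t" for t
    using f_fun_pos[where 'n='n, of \<alpha> t] \<alpha> that by (auto simp: p_def)
  have nn: "0 \<le> ?f t" "0 \<le> ?g t" if "1 \<le> t" for t
  proof -
    show "0 \<le> ?f t" using f_fun_nonneg[where 'n='n, of \<alpha> t] f_fun_1[where 'n='n, of \<alpha>] \<alpha> that
      by (cases "t = 1") auto
    show "0 \<le> ?g t" using f_fun_nonneg[where 'n='n, of "\<alpha> - 2" t] f_fun_1[where 'n='n, of "\<alpha> - 2"] \<alpha> that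
      by (cases "t = 1") auto
  qed
  have c: "continuous_on {1..} (\<lambda>t. p t * ?g t powr \<alpha>)"
  proof (intro continuous_on_mult)
    show "continuous_on {1..} (\<lambda>t. ?g t powr \<alpha>)"
      using \<alpha> nn by (intro continuous_on_powr' f_fun_continuous continuous_on_const) auto
    show "continuous_on {1..} p"
    proof (cases "\<alpha> = 2")
      case False
      then have "continuous_on {1..} (\<lambda>t. ?f t powr (2 - \<alpha>))"
        using \<alpha> nn by (intro continuous_on_powr' f_fun_continuous continuous_on_const) auto
      then show ?thesis using False by (simp add: p_def[abs_def])
    qed (simp add: p_def[abs_def])
  qed
  \<comment> \<open>Unboundedness is known only for nonnegative index. At \<alpha> = 2 the second
    factor has index 0 and provides the growth; for \<alpha> < 2 the first factor grows while the
    second stays above its value at 2.\<close>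
  obtain T where T: "1 < T" "M \<le> p T * ?g T powr \<alpha>"
  proof (cases "\<alpha> = 2")
    case True
    obtain T where T: "1 < T" "M powr (1 / 2) \<le> f_fun CARD('n) 0 T"
      using f_fun_unbounded[where 'n='n, of 0 1 "M powr (1 / 2)"] by auto
    have "M = (M powr (1 / 2)) powr 2" using M by (simp add: powr_powr)
    also have "\<dots> \<le> f_fun CARD('n) 0 T powr 2" using T by (intro powr_mono2) auto
    finally show ?thesis using T True by (intro that[of T]) (simp_all add: p_def)
  next
    case False
    define c where "c = ?g 2 powr \<alpha>"
    have c: "c > 0" using f_fun_pos[where 'n='n, of "\<alpha> - 2" 2] \<alpha> by (simp add: c_def)
    obtain T where T: "2 \<le> T" "(M / c) powr (1 / (2 - \<alpha>)) \<le> ?f T"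
      using f_fun_unbounded[where 'n='n, of \<alpha> 2 "(M / c) powr (1 / (2 - \<alpha>))"] \<alpha> by auto
    have "?g 2 \<le> ?g T"
      using T \<alpha> f_fun_strict_mono[where 'n='n, of "\<alpha> - 2" 2 T] by (cases "T = 2") auto
    then have g: "c \<le> ?g T powr \<alpha>"
      unfolding c_def using \<alpha> nn[of 2] by (intro powr_mono2) auto
    have "M / c = ((M / c) powr (1 / (2 - \<alpha>))) powr (2 - \<alpha>)"
      using False M c by (simp add: powr_powr)
    also have "\<dots> \<le> ?f T powr (2 - \<alpha>)" using T \<alpha> by (intro powr_mono2) auto
    finally have "M / c * c \<le> ?f T powr (2 - \<alpha>) * ?g T powr \<alpha>"
      using g c M by (intro mult_mono) auto
    then show ?thesis using T c False by (intro that[of T]) (simp_all add: p_def)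
  qed
  have "\<exists>t\<ge>1. t \<le> T \<and> p t * ?g t powr \<alpha> = M"
  proof (rule IVT')
    show "p 1 * ?g 1 powr \<alpha> \<le> M" using M \<alpha> f_fun_1[where 'n='n, of "\<alpha> - 2"] by simp
    show "continuous_on {1..T} (\<lambda>t. p t * ?g t powr \<alpha>)" by (rule continuous_on_subset[OF c]) auto
  qed (use T in auto)
  then obtain t where t: "1 \<le> t" "p t * ?g t powr \<alpha> = M" by blast
  moreover have "t \<noteq> 1" using t M \<alpha> f_fun_1[where 'n='n, of "\<alpha> - 2"] by auto
  ultimately show ?thesis using p by (intro exI[of _ t]) auto
qed

end

theorem theorem2p3:
  fixes k :: "'n::finite" and \<alpha> :: real
  assumes "0 < \<alpha>" and "\<alpha> \<le> 2"
  shows "(\<forall>u v. 0 < u \<and> 0 < v \<longrightarrow> admissible_pair TYPE('n) \<alpha> u v) \<and>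
    (\<forall>u v. 0 < u \<and> 0 < v \<longrightarrow>
      (\<exists>!t. 1 < t \<and>
        f_fun CARD('n) \<alpha> t powr (2 - \<alpha>) * f_fun CARD('n) (\<alpha> - 2) t powr \<alpha>
          = u powr (2 - \<alpha>) * v powr \<alpha>) \<and>
      (\<forall>t. 1 < t \<and>
        f_fun CARD('n) \<alpha> t powr (2 - \<alpha>) * f_fun CARD('n) (\<alpha> - 2) t powr \<alpha>
          = u powr (2 - \<alpha>) * v powr \<alpha> \<longrightarrow>
        N_fun k \<alpha> u v =
          ereal (u powr (2 * (\<alpha> - 1) / \<alpha>) *
            ((h_fun CARD('n) \<alpha> t)\<^sup>2 / f_fun CARD('n) \<alpha> t powr (2 * (\<alpha> - 1) / \<alpha>)))))"
proof -
  let ?\<Phi> = "\<lambda>t. f_fun CARD('n) \<alpha> t powr (2 - \<alpha>) * f_fun CARD('n) (\<alpha> - 2) t powr \<alpha>"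
  have ex: "\<exists>t>1. ?\<Phi> t = u powr (2 - \<alpha>) * v powr \<alpha>" if "0 < u" "0 < v" for u v
    using that by (intro constraint_solvable[OF assms]) simp
  show ?thesis
  proof (intro conjI allI impI; elim conjE)
    fix u v :: real assume uv: "0 < u" "0 < v"
    obtain t where t: "1 < t" "?\<Phi> t = u powr (2 - \<alpha>) * v powr \<alpha>" using ex[OF uv] by blast
    have "norm (axis undefined 1 :: real ^ 'n) = 1" by simp
    from feasible_hyperbolic_ball[OF this t(1) scale_exists(1)[OF assms t(1) uv t(2)] assms scale_exists(2,3)[OF assms t(1) uv t(2)]]
    show "admissible_pair TYPE('n) \<alpha> u v" unfolding admissible_pair_def by blast
  next
    fix u v :: real assume uv: "0 < u" "0 < v"
    have uniq: "t = t'" if "1 < t" "1 < t'" "?\<Phi> t = ?\<Phi> t'" for t t'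
      using constraint_strict_mono[OF assms, of t t', where 'n='n] constraint_strict_mono[OF assms, of t' t, where 'n='n] that
      by (cases t t' rule: linorder_cases) auto
    obtain t where t: "1 < t" "?\<Phi> t = u powr (2 - \<alpha>) * v powr \<alpha>" using ex[OF uv] by blast
    show "\<exists>!t. 1 < t \<and> ?\<Phi> t = u powr (2 - \<alpha>) * v powr \<alpha>"
    proof (rule ex1I[of _ t])
      show "t' = t" if "1 < t' \<and> ?\<Phi> t' = u powr (2 - \<alpha>) * v powr \<alpha>" for t'
        by (rule uniq[OF conjunct1[OF that] t(1) trans[OF conjunct2[OF that] t(2)[symmetric]]])
    qed (rule conjI[OF t])
  next
    fix u v t :: real
    assume uv: "0 < u" "0 < v" and t: "1 < t" "?\<Phi> t = u powr (2 - \<alpha>) * v powr \<alpha>"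
    define f where "f = f_fun CARD('n) \<alpha> t"
    have f: "f > 0" unfolding f_def using assms t by (intro f_fun_pos) auto
    define s where "s = (u / f) powr (1 / \<alpha>)"
    have N: "N_fun k \<alpha> u v = ereal ((s powr (\<alpha> - 1) * h_fun CARD('n) \<alpha> t)\<^sup>2)"
      unfolding s_def f_def
      by (rule N_fun_eq[OF t(1) scale_exists(1)[OF assms t(1) uv t(2)] assms scale_exists(2,3)[OF assms t(1) uv t(2)]])
    \<comment> \<open>The square is written as a real power so that its exponent multiplies with the
      exponent 1/\<alpha> hidden in \<open>s\<close>.\<close>
    have "(s powr (\<alpha> - 1))\<^sup>2 = (s powr (\<alpha> - 1)) powr 2" using uv f by (simp add: powr_numeral)
    also have "\<dots> = (u / f) powr (2 * (\<alpha> - 1) / \<alpha>)" unfolding s_def powr_powr by (simp add: mult.commute)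
    also have "\<dots> = u powr (2 * (\<alpha> - 1) / \<alpha>) / f powr (2 * (\<alpha> - 1) / \<alpha>)"
      using uv f by (simp add: powr_divide)
    finally have S: "(s powr (\<alpha> - 1))\<^sup>2 = u powr (2 * (\<alpha> - 1) / \<alpha>) / f powr (2 * (\<alpha> - 1) / \<alpha>)" .
    show "N_fun k \<alpha> u v = ereal (u powr (2 * (\<alpha> - 1) / \<alpha>) *
            ((h_fun CARD('n) \<alpha> t)\<^sup>2 / f_fun CARD('n) \<alpha> t powr (2 * (\<alpha> - 1) / \<alpha>)))"
      unfolding N power_mult_distrib S f_def[symmetric] by simp
  qed
qed

end
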